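(* There is an algorithm that, given an undirected $n$-vertex graph $G=(V,E)$, a weight function $\omega:V\rightarrow\mathbb{Z}_+$ whose values are bounded by a polynomial in $n$, and an integer $k$, finds a minimum-weight connected vertex cover of $G$ among those of cardinality at most $k$ (or reports that none exists), in $O(2^k n^{O(1)})$ time and polynomial space.
   Context: A vertex cover of $G$ is a set $X\subseteq V$ containing at least one endpoint of every edge. It is a connected vertex cover if moreover the induced subgraph $G[X]$ is connected. The weight of a set $X$ is $\sum_{v\in X}\omega(v)$. *)

theory Defs
  imports
    "Graph_Theory.Graph_Theory"
    "HOL-Library.Log_Nat"
    "HOL-Computational_Algebra.Polynomial"
begin

section \<open>Connected vertex covers\<close>

text \<open>
  A finite simple undirected graph is a \<open>pair_graph\<close>: each edge is a pair of opposite arcs.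
  \<open>connected\<close> is the library notion, under which the graph without vertices is not connected.
\<close>

definition vertex_cover :: "'a pair_pre_digraph \<Rightarrow> 'a set \<Rightarrow> bool" where
  "vertex_cover G X \<longleftrightarrow> X \<subseteq> pverts G \<and> (\<forall>(u, v) \<in> parcs G. u \<in> X \<or> v \<in> X)"

definition connected_vertex_cover :: "'a pair_pre_digraph \<Rightarrow> 'a set \<Rightarrow> bool" where
  "connected_vertex_cover G X \<longleftrightarrow>
    vertex_cover G X \<and> connected (induce_subgraph (with_proj G) X)"

definition weight :: "('a \<Rightarrow> nat) \<Rightarrow> 'a set \<Rightarrow> nat" where
  "weight w X = (\<Sum>v\<in>X. w v)"


section \<open>Random access machine programs under the logarithmic cost criterion\<close>

text \<open>
  A deterministic random access machine with integer registers, programmed in a structured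
  language.  Its memory is a family of named infinite arrays; a scalar variable is cell 0 of an
  array.  A program mentions only finitely many names.  Negative addresses are read as 0, and
  \<open>div\<close>, \<open>mod\<close> are those of HOL.
\<close>

type_synonym store = "string \<Rightarrow> nat \<Rightarrow> int"

datatype expr =
    Const int
  | Read string expr
  | Add expr expr
  | Sub expr expr
  | Mul expr expr
  | Div expr expr
  | Mod expr expr

datatype test =
    Less expr expr
  | Equal expr expr
  | Neg test
  | And test test

datatype program =
    Skip
  | Write string expr expr  \<comment> \<open>array name, address, value\<close>
  | Seq program program
  | Cond test program program
  | While test program

text \<open>Number of bits of an integer in sign-magnitude representation.\<close>

definition bits :: "int \<Rightarrow> nat" where
  "bits z = Suc (floorlog 2 (nat \<bar>z\<bar>))"

primrec expr_val :: "store \<Rightarrow> expr \<Rightarrow> int" where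
  "expr_val s (Const c) = c"
| "expr_val s (Read x a) = s x (nat (expr_val s a))"
| "expr_val s (Add a b) = expr_val s a + expr_val s b"
| "expr_val s (Sub a b) = expr_val s a - expr_val s b"
| "expr_val s (Mul a b) = expr_val s a * expr_val s b"
| "expr_val s (Div a b) = expr_val s a div expr_val s b"
| "expr_val s (Mod a b) = expr_val s a mod expr_val s b"

text \<open>
  Every operation costs the total bit length of its operands, and every memory access that of the
  address and of the contents.  Hence the cost of an expression also bounds the bit length of its
  value up to a constant factor, and a \<open>Write\<close> needs no further charge for storing it.
\<close>

primrec expr_cost :: "store \<Rightarrow> expr \<Rightarrow> nat" where
  "expr_cost s (Const c) = bits c"
| "expr_cost s (Read x a) =
    expr_cost s a + bits (expr_val s a) + bits (s x (nat (expr_val s a)))"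
| "expr_cost s (Add a b) =
    expr_cost s a + expr_cost s b + bits (expr_val s a) + bits (expr_val s b)"
| "expr_cost s (Sub a b) =
    expr_cost s a + expr_cost s b + bits (expr_val s a) + bits (expr_val s b)"
| "expr_cost s (Mul a b) =
    expr_cost s a + expr_cost s b + bits (expr_val s a) + bits (expr_val s b)"
| "expr_cost s (Div a b) =
    expr_cost s a + expr_cost s b + bits (expr_val s a) + bits (expr_val s b)"
| "expr_cost s (Mod a b) =
    expr_cost s a + expr_cost s b + bits (expr_val s a) + bits (expr_val s b)"

primrec test_val :: "store \<Rightarrow> test \<Rightarrow> bool" where
  "test_val s (Less a b) \<longleftrightarrow> expr_val s a < expr_val s b"
| "test_val s (Equal a b) \<longleftrightarrow> expr_val s a = expr_val s b"
| "test_val s (Neg t) \<longleftrightarrow> \<not> test_val s t"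
| "test_val s (And t u) \<longleftrightarrow> test_val s t \<and> test_val s u"

primrec test_cost :: "store \<Rightarrow> test \<Rightarrow> nat" where
  "test_cost s (Less a b) =
    expr_cost s a + expr_cost s b + bits (expr_val s a) + bits (expr_val s b)"
| "test_cost s (Equal a b) =
    expr_cost s a + expr_cost s b + bits (expr_val s a) + bits (expr_val s b)"
| "test_cost s (Neg t) = test_cost s t + 1"
| "test_cost s (And t u) = test_cost s t + test_cost s u + 1"

definition store_upd :: "string \<Rightarrow> nat \<Rightarrow> int \<Rightarrow> store \<Rightarrow> store" where
  "store_upd x i z s = s(x := (s x)(i := z))"

text \<open>
  The space occupied by a store is the length of a list of its nonzero cells, each given by its
  address and its contents.  Charging for addresses prevents information from being hidden in the
  position of a cell.  The support is finite in all stores that arise from an input, see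
  \<open>finite_support_input_store\<close> and \<open>finite_support_run\<close> below.
\<close>

definition support :: "store \<Rightarrow> (string \<times> nat) set" where
  "support s = {(x, i). s x i \<noteq> 0}"

definition store_space :: "store \<Rightarrow> nat" where
  "store_space s = (\<Sum>(x, i)\<in>support s. bits (int i) + bits (s x i))"

text \<open>
  \<open>run P s t m s'\<close>: started in store \<open>s\<close>, the program \<open>P\<close> halts in store \<open>s'\<close> after time \<open>t\<close>, and
  \<open>m\<close> is the maximum of the space of all stores it passes through, \<open>s\<close> and \<open>s'\<close> included.
  Temporaries of expressions are not counted in \<open>m\<close>, since they are at most a constant (depending
  on the program) times longer than the cells that they are computed from.
\<close>

inductive run :: "program \<Rightarrow> store \<Rightarrow> nat \<Rightarrow> nat \<Rightarrow> store \<Rightarrow> bool" where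
  run_Skip: "run Skip s 1 (store_space s) s"
| run_Write:
    "s' = store_upd x (nat (expr_val s a)) (expr_val s e) s \<Longrightarrow>
     run (Write x a e) s (expr_cost s a + expr_cost s e + 1) (max (store_space s) (store_space s')) s'"
| run_Seq:
    "run P s t1 m1 s1 \<Longrightarrow> run Q s1 t2 m2 s2 \<Longrightarrow>
     run (Seq P Q) s (t1 + t2) (max m1 m2) s2"
| run_Cond_True:
    "test_val s b \<Longrightarrow> run P s t m s' \<Longrightarrow> run (Cond b P Q) s (test_cost s b + t + 1) m s'"
| run_Cond_False:
    "\<not> test_val s b \<Longrightarrow> run Q s t m s' \<Longrightarrow> run (Cond b P Q) s (test_cost s b + t + 1) m s'"
| run_While_False:
    "\<not> test_val s b \<Longrightarrow> run (While b P) s (test_cost s b + 1) (store_space s) s"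
| run_While_True:
    "test_val s b \<Longrightarrow> run P s t1 m1 s1 \<Longrightarrow> run (While b P) s1 t2 m2 s2 \<Longrightarrow>
     run (While b P) s (test_cost s b + t1 + t2 + 1) (max m1 m2) s2"

inductive_cases run_SkipE: "run Skip s t m s'"
  and run_WriteE: "run (Write x a e) s t m s'"
  and run_SeqE: "run (Seq P Q) s t m s'"
  and run_CondE: "run (Cond b P Q) s t m s'"
  and run_WhileE: "run (While b P) s t m s'"

lemma run_deterministic:
  assumes "run P s t1 m1 s1" and "run P s t2 m2 s2"
  shows "t1 = t2 \<and> m1 = m2 \<and> s1 = s2"
  using assms
proof (induction arbitrary: t2 m2 s2 rule: run.induct)
  case (run_Seq P s u1 n1 r1 Q u2 n2 r2)
  from run_Seq.prems obtain u1' n1' r1' u2' n2' where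
    "t2 = u1' + u2'" "m2 = max n1' n2'" "run P s u1' n1' r1'" "run Q r1' u2' n2' s2"
    by (rule run_SeqE)
  with run_Seq.IH show ?case by metis
next
  case (run_Cond_True s b P u n r Q)
  from run_Cond_True.prems run_Cond_True.hyps obtain u' where
    "t2 = test_cost s b + u' + 1" "run P s u' m2 s2"
    by (auto elim: run_CondE)
  with run_Cond_True.IH show ?case by metis
next
  case (run_Cond_False s b Q u n r P)
  from run_Cond_False.prems run_Cond_False.hyps obtain u' where
    "t2 = test_cost s b + u' + 1" "run Q s u' m2 s2"
    by (auto elim: run_CondE)
  with run_Cond_False.IH show ?case by metis
next
  case (run_While_False s b P)
  from run_While_False.prems show ?case
    by (rule run_WhileE) (use run_While_False.hyps in simp_all)
next
  case (run_While_True s b P u1 n1 r1 u2 n2 r2)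
  from run_While_True.prems obtain u1' n1' r1' u2' n2' where
    "t2 = test_cost s b + u1' + u2' + 1" "m2 = max n1' n2'"
    "run P s u1' n1' r1'" "run (While b P) r1' u2' n2' s2"
    by (rule run_WhileE) (use run_While_True.hyps in simp_all)
  with run_While_True.IH show ?case by metis
qed (auto elim: run_SkipE run_WriteE)

lemma finite_support_run:
  assumes "run P s t m s'" and "finite (support s)"
  shows "finite (support s')"
  using assms
proof (induction rule: run.induct)
  case (run_Write s' x s a e)
  have "support s' \<subseteq> insert (x, nat (expr_val s a)) (support s)"
    using run_Write.hyps by (auto simp: support_def store_upd_def split: if_splits)
  then show ?case
    using run_Write.prems by (meson finite.insertI finite_subset)
qed auto


section \<open>Input and output\<close>

text \<open>
  The vertices are numbered \<open>0, \<dots>, n - 1\<close>; the graph is given by its adjacency matrix, row by row.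
\<close>

definition input_store :: "nat \<Rightarrow> nat pair_pre_digraph \<Rightarrow> (nat \<Rightarrow> nat) \<Rightarrow> nat \<Rightarrow> store" where
  "input_store n G w k = (\<lambda>x i.
     if x = ''n'' \<and> i = 0 then int n
     else if x = ''k'' \<and> i = 0 then int k
     else if x = ''weight'' \<and> i < n then int (w i)
     else if x = ''adj'' \<and> i < n * n \<and> (i div n, i mod n) \<in> parcs G then 1
     else 0)"

lemma finite_support_input_store: "finite (support (input_store n G w k))"
proof (rule finite_subset)
  show "support (input_store n G w k) \<subseteq>
      {''n'', ''k'', ''weight'', ''adj''} \<times> {..n * n + n}"
    by (auto simp: support_def input_store_def split: if_splits)
qed auto

definition feasible :: "'a pair_pre_digraph \<Rightarrow> nat \<Rightarrow> 'a set \<Rightarrow> bool" where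
  "feasible G k X \<longleftrightarrow> connected_vertex_cover G X \<and> card X \<le> k"

text \<open>
  A final store either reports that there is no solution (\<open>found\<close> is 0), or holds the
  characteristic function of an optimal one in the array \<open>sol\<close>.
\<close>

definition correct_output ::
    "nat pair_pre_digraph \<Rightarrow> (nat \<Rightarrow> nat) \<Rightarrow> nat \<Rightarrow> store \<Rightarrow> bool" where
  "correct_output G w k s \<longleftrightarrow>
    (if s ''found'' 0 = 0 then \<nexists>X. feasible G k X
     else is_arg_min (weight w) (feasible G k) {v \<in> pverts G. s ''sol'' v \<noteq> 0})"

end

theory Submission
  imports Defs
begin

text \<open>
  A minimum connected vertex cover through a fixed vertex \<open>r\<close> is found by compression.  Take an
  order of the component of \<open>r\<close> that starts at \<open>r\<close> and in which all prefixes are connected.  For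
  decreasing prefixes \<open>P\<close> we maintain a connected vertex cover \<open>C\<close> that contains \<open>P\<close> and has at most
  \<open>k\<close> other vertices, and compute from it a lightest one with fewer than \<open>k\<close> vertices outside \<open>P\<close>;
  the union of \<open>P\<close> with a solution through \<open>r\<close> witnesses that there is one, and for \<open>P = {r}\<close> it
  is the optimum.

  Such a cover \<open>X\<close> is determined by \<open>A = X \<inter> C\<close>, whose complement in \<open>C\<close> is independent, by the
  vertices outside \<open>C\<close> that are then forced into \<open>X\<close>, and by further vertices connecting the pieces
  of \<open>A\<close>, a Steiner tree problem.  We count branching walks from \<open>r\<close> (Nederlof), which are trees
  mapped homomorphically into the graph, of given size and weight that meet every piece, by
  inclusion--exclusion over the sets of pieces to be avoided.  The pieces are the components induced
  by \<open>A\<close> in a spanning tree of \<open>C\<close>.  A pair of a set \<open>A\<close> and a set of its pieces is a colouring of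
  \<open>C\<close> with three colours, and the colour of the parent in the spanning tree leaves only two choices
  for a vertex outside \<open>P\<close>.  Hence there are only \<open>2^|C - P| \<le> 2^k\<close> summands, each of them computed
  in polynomial time and space.  Sizes and weights are encoded as exponents of a large base.
\<close>

section \<open>Reasoning about bounded runs\<close>

text \<open>A deterministic count replaces the usual isolation of one optimum. Once the colourings
  that leave a piece unvisited have cancelled in pairs, every remaining summand has sign 1, so the
  total is a plain sum of powers of the base over a finite set of objects. The base exceeds the
  number of objects, hence there are no carries and a digit is nonzero exactly if its exponent
  occurs. Walks may repeat vertices, so an object only bounds weight and size of some solution from
  above; but every solution has an object with exactly its own weight and size, and this suffices
  for the minimum. The count yields only a minimum weight; a set is recovered by deleting allowed
  vertices one at a time.

  On the machine side, logarithmic cost is the obstacle: the numbers are exponentially large.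
  Polynomially bounded weights keep the exponents, and hence all bit lengths, polynomial. One
  invariant on stores then bounds the cost of each step and the space, and only steps remain to be
  counted. The single running sum over all colourings keeps the space polynomial although there are
  up to \<open>2 ^ k\<close> summands.\<close>

definition names :: "string set" where
  "names = set [''n'', ''k'', ''weight'', ''adj'', ''found'', ''sol'', ''best'', ''target'', ''res'',
     ''ok'', ''r'', ''len'', ''num'', ''j'', ''z'', ''ord'', ''lst'', ''par'', ''mark'', ''c'', ''d'',
     ''two'', ''q'', ''mask'', ''x'', ''y'', ''p'', ''a'', ''col'', ''e'', ''h0'', ''h1'', ''f'', ''acc'', ''tot'',
     ''pw'', ''bs'', ''mz'', ''ws'', ''lim'', ''i'', ''v'', ''u'', ''g'', ''t'', ''o'']"

text \<open>Addresses are bounded by \<open>b\<close> itself but contents by \<open>b\<close> bits: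
  the tables are of polynomial length while the numbers in them may be exponentially large. With
  finitely many names this already bounds the space polynomially in \<open>b\<close>.\<close>

definition bounded :: "nat \<Rightarrow> store \<Rightarrow> bool" where
  "bounded b s \<longleftrightarrow> (\<forall>x i. s x i \<noteq> 0 \<longrightarrow> x \<in> names \<and> i < b \<and> \<bar>s x i\<bar> < 2 ^ b)"

text \<open>
  In bounded stores a step costs at most \<open>step_cap\<close> and the space is at most \<open>space_cap\<close>, hence only
  the number of steps has to be counted.
\<close>

inductive steps :: "nat \<Rightarrow> program \<Rightarrow> store \<Rightarrow> nat \<Rightarrow> store \<Rightarrow> bool" for b where
  steps_Skip: "bounded b s \<Longrightarrow> steps b Skip s 1 s"
| steps_Write:
    "bounded b s \<Longrightarrow> s' = store_upd x (nat (expr_val s a)) (expr_val s e) s \<Longrightarrow> bounded b s' \<Longrightarrow>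
     steps b (Write x a e) s 1 s'"
| steps_Seq: "steps b P s t1 s1 \<Longrightarrow> steps b Q s1 t2 s2 \<Longrightarrow> steps b (Seq P Q) s (t1 + t2) s2"
| steps_Cond_True: "test_val s c \<Longrightarrow> steps b P s t s' \<Longrightarrow> steps b (Cond c P Q) s (t + 1) s'"
| steps_Cond_False: "\<not> test_val s c \<Longrightarrow> steps b Q s t s' \<Longrightarrow> steps b (Cond c P Q) s (t + 1) s'"
| steps_While_False: "bounded b s \<Longrightarrow> \<not> test_val s c \<Longrightarrow> steps b (While c P) s 1 s"
| steps_While_True:
    "test_val s c \<Longrightarrow> steps b P s t1 s1 \<Longrightarrow> steps b (While c P) s1 t2 s2 \<Longrightarrow>
     steps b (While c P) s (t1 + t2 + 1) s2"

inductive_cases steps_SkipE: "steps b Skip s t s'"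
  and steps_WriteE: "steps b (Write x a e) s t s'"
  and steps_SeqE: "steps b (Seq P Q) s t s'"
  and steps_CondE: "steps b (Cond c P Q) s t s'"

text \<open>Adding the lengths of the operands and one more bit covers products as well as the other
  operations, and a \<open>Read\<close> starts again from \<open>b\<close>. For a fixed expression
  this is therefore linear in \<open>b\<close>.\<close>

primrec expr_bits :: "nat \<Rightarrow> expr \<Rightarrow> nat" where
  "expr_bits b (Const c) = bits c"
| "expr_bits b (Read x a) = Suc b"
| "expr_bits b (Add a c) = Suc (expr_bits b a + expr_bits b c)"
| "expr_bits b (Sub a c) = Suc (expr_bits b a + expr_bits b c)"
| "expr_bits b (Mul a c) = Suc (expr_bits b a + expr_bits b c)"
| "expr_bits b (Div a c) = Suc (expr_bits b a + expr_bits b c)"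
| "expr_bits b (Mod a c) = Suc (expr_bits b a + expr_bits b c)"

primrec expr_cap :: "nat \<Rightarrow> expr \<Rightarrow> nat" where
  "expr_cap b (Const c) = bits c"
| "expr_cap b (Read x a) = expr_cap b a + Suc (expr_bits b a) + (b + 1)"
| "expr_cap b (Add a c) = expr_cap b a + expr_cap b c + Suc (expr_bits b a) + Suc (expr_bits b c)"
| "expr_cap b (Sub a c) = expr_cap b a + expr_cap b c + Suc (expr_bits b a) + Suc (expr_bits b c)"
| "expr_cap b (Mul a c) = expr_cap b a + expr_cap b c + Suc (expr_bits b a) + Suc (expr_bits b c)"
| "expr_cap b (Div a c) = expr_cap b a + expr_cap b c + Suc (expr_bits b a) + Suc (expr_bits b c)"
| "expr_cap b (Mod a c) = expr_cap b a + expr_cap b c + Suc (expr_bits b a) + Suc (expr_bits b c)"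

primrec test_cap :: "nat \<Rightarrow> test \<Rightarrow> nat" where
  "test_cap b (Less a c) = expr_cap b a + expr_cap b c + Suc (expr_bits b a) + Suc (expr_bits b c)"
| "test_cap b (Equal a c) = expr_cap b a + expr_cap b c + Suc (expr_bits b a) + Suc (expr_bits b c)"
| "test_cap b (Neg t) = test_cap b t + 1"
| "test_cap b (And t u) = test_cap b t + test_cap b u + 1"

text \<open>Both branches and all parts are added up. This is crude, but the cap of a part is then
  at most the cap of the whole, which lets \<open>run_steps\<close> multiply the total number of
  steps by one constant.\<close>

primrec step_cap :: "nat \<Rightarrow> program \<Rightarrow> nat" where
  "step_cap b Skip = 1"
| "step_cap b (Write x a e) = expr_cap b a + expr_cap b e + 1"
| "step_cap b (Seq P Q) = step_cap b P + step_cap b Q"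
| "step_cap b (Cond c P Q) = test_cap b c + 1 + step_cap b P + step_cap b Q"
| "step_cap b (While c P) = test_cap b c + 1 + step_cap b P"

definition space_cap :: "nat \<Rightarrow> nat" where
  "space_cap b = card names * b * (2 * (b + 1))"

section \<open>Cost of one step and space of a bounded store\<close>

lemma bits_le: "\<bar>z\<bar> < 2 ^ b \<Longrightarrow> bits z \<le> b + 1"
  unfolding bits_def using floorlog_le_iff[of 2 "nat \<bar>z\<bar>" b]
  by (simp add: nat_less_iff)

lemma less_two_power_bits: "\<bar>z\<bar> < 2 ^ bits z"
proof -
  have "nat \<bar>z\<bar> < 2 ^ floorlog 2 (nat \<bar>z\<bar>)"
    using floorlog_le_iff[of 2 "nat \<bar>z\<bar>" "floorlog 2 (nat \<bar>z\<bar>)"] by simp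
  then have "\<bar>z\<bar> < 2 ^ floorlog 2 (nat \<bar>z\<bar>)" by (simp add: nat_less_iff)
  also have "\<dots> \<le> 2 ^ bits z" by (simp add: bits_def)
  finally show ?thesis .
qed

lemma boundedD:
  assumes "bounded b s"
  shows "\<bar>s x i\<bar> < 2 ^ b"
  using assms by (cases "s x i = 0") (auto simp: bounded_def)

text \<open>Division rounds down, so a negative quotient is pushed away from 0. Still
  \<open>x div y * y\<close> differs from \<open>x\<close> by less than the absolute value of
  \<open>y\<close>, which leaves no room for a quotient larger than \<open>x\<close> in absolute
  value.\<close>

lemma abs_div_le: "\<bar>x div (y::int)\<bar> \<le> \<bar>x\<bar>"
proof (cases "y = 0")
  case False
  show ?thesis
  proof (rule ccontr)
    assume "\<not> ?thesis"
    then have "(\<bar>x\<bar> + 1) * \<bar>y\<bar> \<le> \<bar>x div y\<bar> * \<bar>y\<bar>" by (intro mult_right_mono) auto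
    also have "\<dots> = \<bar>x - x mod y\<bar>" by (simp add: minus_mod_eq_div_mult flip: abs_mult)
    also have "\<dots> < \<bar>x\<bar> + \<bar>y\<bar>" using abs_mod_less[OF False, of x] by linarith
    finally have "\<bar>x\<bar> * \<bar>y\<bar> < \<bar>x\<bar> * 1" by (simp add: algebra_simps)
    moreover have "\<bar>x\<bar> * 1 \<le> \<bar>x\<bar> * \<bar>y\<bar>" using False by (intro mult_left_mono) auto
    ultimately show False by simp
  qed
qed simp

lemma abs_mod_le: "\<bar>x mod (y::int)\<bar> \<le> \<bar>x\<bar> + \<bar>y\<bar>"
proof (cases "y = 0")
  case False
  then have "\<bar>x mod y\<bar> < \<bar>y\<bar>" by (rule abs_mod_less)
  then show ?thesis by simp
qed simp

lemma abs_expr_val_less: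
  assumes "bounded b s"
  shows "\<bar>expr_val s e\<bar> < 2 ^ expr_bits b e"
proof (induction e)
  case (Const c)
  then show ?case by (simp add: less_two_power_bits)
next
  case (Read x a)
  show ?case using boundedD[OF assms, of x "nat (expr_val s a)"] by (simp add: less_trans)
next
  case (Mul a c)
  have "\<bar>expr_val s a\<bar> * \<bar>expr_val s c\<bar> \<le> 2 ^ expr_bits b a * 2 ^ expr_bits b c"
    using Mul by (intro mult_mono) auto
  also have "\<dots> < 2 ^ expr_bits b (Mul a c)" by (simp add: power_add)
  finally show ?case by (simp add: abs_mult)
next
  have *: "2 ^ k + 2 ^ l \<le> (2::int) ^ Suc (k + l)" for k l
  proof -
    have "(2::int) ^ k \<le> 2 ^ (k + l)" "(2::int) ^ l \<le> 2 ^ (k + l)" by (simp_all add: power_increasing)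
    then have "2 ^ k + 2 ^ l \<le> 2 * (2::int) ^ (k + l)" by linarith
    then show ?thesis by simp
  qed
  {
    case (Add a c)
    then show ?case using *[of "expr_bits b a" "expr_bits b c"] by simp
  next
    case (Sub a c)
    then show ?case using *[of "expr_bits b a" "expr_bits b c"] by simp
  next
    case (Div a c)
    then show ?case using *[of "expr_bits b a" "expr_bits b c"] abs_div_le[of "expr_val s a" "expr_val s c"]
      by simp
  next
    case (Mod a c)
    then show ?case using *[of "expr_bits b a" "expr_bits b c"] abs_mod_le[of "expr_val s a" "expr_val s c"]
      by simp
  }
qed

lemma bits_expr_val_le: "bounded b s \<Longrightarrow> bits (expr_val s e) \<le> Suc (expr_bits b e)"
  using bits_le[OF abs_expr_val_less] by simp

lemma expr_cost_le:
  assumes "bounded b s"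
  shows "expr_cost s e \<le> expr_cap b e"
proof (induction e)
  case (Read x a)
  have "bits (s x (nat (expr_val s a))) \<le> b + 1"
    by (intro bits_le boundedD assms)
  with Read bits_expr_val_le[OF assms, of a] show ?case
    by simp
next
  have *: "expr_cost s a + expr_cost s c + bits (expr_val s a) + bits (expr_val s c)
      \<le> expr_cap b a + expr_cap b c + Suc (expr_bits b a) + Suc (expr_bits b c)"
    if "expr_cost s a \<le> expr_cap b a" "expr_cost s c \<le> expr_cap b c" for a c
    using that bits_expr_val_le[OF assms, of a] bits_expr_val_le[OF assms, of c] by simp
  {
    case Add then show ?case using * by simp
  next
    case Sub then show ?case using * by simp
  next
    case Mul then show ?case using * by simp
  next
    case Div then show ?case using * by simp
  next
    case Mod then show ?case using * by simp
  }
qed simp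

lemma test_cost_le:
  assumes "bounded b s"
  shows "test_cost s c \<le> test_cap b c"
proof (induction c)
  case (Less a c)
  show ?case using expr_cost_le[OF assms, of a] expr_cost_le[OF assms, of c]
      bits_expr_val_le[OF assms, of a] bits_expr_val_le[OF assms, of c] by simp
next
  case (Equal a c)
  show ?case using expr_cost_le[OF assms, of a] expr_cost_le[OF assms, of c]
      bits_expr_val_le[OF assms, of a] bits_expr_val_le[OF assms, of c] by simp
qed simp_all

lemma finite_names: "finite names"
  by (simp add: names_def)

text \<open>The length \<open>l\<close> of the contents is kept apart from \<open>b\<close> for the
  sake of the input store, whose cell \<open>''k''\<close> need not be bounded in terms of the
  number of vertices.\<close>

lemma store_space_le_card:
  assumes "\<And>x i. s x i \<noteq> 0 \<Longrightarrow> x \<in> names \<and> i < b \<and> bits (s x i) \<le> l"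
  shows "store_space s \<le> card names * b * (b + 1 + l)"
proof -
  have sub: "support s \<subseteq> names \<times> {..<b}" using assms by (auto simp: support_def)
  have "store_space s \<le> (\<Sum>(x, i)\<in>support s. b + 1 + l)"
    unfolding store_space_def
  proof (rule sum_mono, clarify)
    fix x i assume "(x, i) \<in> support s"
    then have *: "i < b" "bits (s x i) \<le> l" using assms by (auto simp: support_def)
    have "int i < 2 ^ b" using \<open>i < b\<close> by (meson less_exp of_nat_less_numeral_power_cancel_iff order_less_trans)
    then have "bits (int i) \<le> b + 1" by (intro bits_le) simp
    with * show "bits (int i) + bits (s x i) \<le> b + 1 + l" by simp
  qed
  also have "\<dots> \<le> (\<Sum>(x, i)\<in>names \<times> {..<b}. b + 1 + l)"
    by (rule sum_mono2) (use sub finite_names in auto)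
  also have "\<dots> = card names * b * (b + 1 + l)"
    by (simp add: card_cartesian_product split_def)
  finally show ?thesis .
qed

lemma store_space_le:
  assumes "bounded b s"
  shows "store_space s \<le> space_cap b"
proof -
  have "store_space s \<le> card names * b * (b + 1 + (b + 1))"
    by (rule store_space_le_card) (use assms in \<open>auto simp: bounded_def intro!: bits_le[THEN order_trans]\<close>)
  then show ?thesis by (simp add: space_cap_def algebra_simps)
qed

lemma bounded_steps: "steps b P s t s' \<Longrightarrow> bounded b s \<and> bounded b s'"
  by (induction rule: steps.induct) auto

lemma run_steps:
  assumes "steps b P s t s'"
  shows "\<exists>t' m. run P s t' m s' \<and> t' \<le> t * step_cap b P \<and> m \<le> space_cap b"
  using assms
proof (induction rule: steps.induct)
  case (steps_Skip s)
  show ?case using run_Skip[of s] store_space_le[OF steps_Skip] by fastforce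
next
  case (steps_Write s s' x a e)
  from run_Write[OF steps_Write(2)] show ?case
    using store_space_le[OF steps_Write(1)] store_space_le[OF steps_Write(3)]
      expr_cost_le[OF steps_Write(1), of a] expr_cost_le[OF steps_Write(1), of e]
    by (intro exI[of _ "expr_cost s a + expr_cost s e + 1"] exI[of _ "max (store_space s) (store_space s')"])
      auto
next
  case (steps_Seq P s t1 s1 Q t2 s2)
  then obtain u1 m1 u2 m2 where "run P s u1 m1 s1" "run Q s1 u2 m2 s2"
    and *: "u1 \<le> t1 * step_cap b P" "u2 \<le> t2 * step_cap b Q" "m1 \<le> space_cap b" "m2 \<le> space_cap b"
    by blast
  then have "run (Seq P Q) s (u1 + u2) (max m1 m2) s2" by (intro run_Seq)
  moreover have "u1 + u2 \<le> (t1 + t2) * step_cap b (Seq P Q)" using * by (simp add: algebra_simps)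
  ultimately show ?case using * by (metis max.bounded_iff)
next
  case (steps_Cond_True s c P t s' Q)
  then obtain u m where "run P s u m s'" and *: "u \<le> t * step_cap b P" "m \<le> space_cap b" by blast
  then have "run (Cond c P Q) s (test_cost s c + u + 1) m s'" using steps_Cond_True by (intro run_Cond_True)
  moreover have "test_cost s c + u + 1 \<le> (t + 1) * step_cap b (Cond c P Q)"
    using * test_cost_le[of b s c] bounded_steps[OF steps_Cond_True(2)] by (simp add: algebra_simps)
  ultimately show ?case using * by blast
next
  case (steps_Cond_False s c Q t s' P)
  then obtain u m where "run Q s u m s'" and *: "u \<le> t * step_cap b Q" "m \<le> space_cap b" by blast
  then have "run (Cond c P Q) s (test_cost s c + u + 1) m s'" using steps_Cond_False by (intro run_Cond_False)
  moreover have "test_cost s c + u + 1 \<le> (t + 1) * step_cap b (Cond c P Q)"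
    using * test_cost_le[of b s c] bounded_steps[OF steps_Cond_False(2)] by (simp add: algebra_simps)
  ultimately show ?case using * by blast
next
  case (steps_While_False s c P)
  then have "run (While c P) s (test_cost s c + 1) (store_space s) s" by (intro run_While_False)
  with test_cost_le[OF steps_While_False(1), of c] store_space_le[OF steps_While_False(1)] show ?case
    by (intro exI[of _ "test_cost s c + 1"] exI[of _ "store_space s"]) auto
next
  case (steps_While_True s c P t1 s1 t2 s2)
  then obtain u1 m1 u2 m2 where "run P s u1 m1 s1" "run (While c P) s1 u2 m2 s2"
    and *: "u1 \<le> t1 * step_cap b P" "u2 \<le> t2 * step_cap b (While c P)" "m1 \<le> space_cap b" "m2 \<le> space_cap b"
    by blast
  then have "run (While c P) s (test_cost s c + u1 + u2 + 1) (max m1 m2) s2"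
    using steps_While_True by (intro run_While_True)
  moreover have "test_cost s c + u1 + u2 + 1 \<le> (t1 + t2 + 1) * step_cap b (While c P)"
    using * test_cost_le[of b s c] bounded_steps[OF steps_While_True(2)] by (simp add: algebra_simps)
  ultimately show ?case using * by (metis max.bounded_iff)
qed

section \<open>Step-counting weakest preconditions and framing\<close>

primrec writes :: "program \<Rightarrow> string set" where
  "writes Skip = {}"
| "writes (Write x a e) = {x}"
| "writes (Seq P Q) = writes P \<union> writes Q"
| "writes (Cond c P Q) = writes P \<union> writes Q"
| "writes (While c P) = writes P"

lemma steps_frame: "steps b P s t s' \<Longrightarrow> x \<notin> writes P \<Longrightarrow> s' x = s x"
  by (induction rule: steps.induct) (auto simp: store_upd_def)

definition wp :: "nat \<Rightarrow> program \<Rightarrow> (nat \<Rightarrow> store \<Rightarrow> bool) \<Rightarrow> store \<Rightarrow> bool" where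
  "wp b P R s \<longleftrightarrow> (\<exists>t s'. steps b P s t s' \<and> R t s')"

lemma wp_Skip: "bounded b s \<Longrightarrow> wp b Skip R s \<longleftrightarrow> R 1 s"
  using steps_Skip by (fastforce simp: wp_def elim: steps_SkipE)

lemma wp_Write:
  "bounded b s \<Longrightarrow> wp b (Write x a e) R s \<longleftrightarrow>
    bounded b (store_upd x (nat (expr_val s a)) (expr_val s e) s) \<and>
    R 1 (store_upd x (nat (expr_val s a)) (expr_val s e) s)"
  using steps_Write by (fastforce simp: wp_def elim: steps_WriteE)

lemma wp_Seq: "wp b (Seq P Q) R s \<longleftrightarrow> wp b P (\<lambda>t1. wp b Q (\<lambda>t2. R (t1 + t2))) s"
  unfolding wp_def by (blast elim: steps_SeqE intro: steps_Seq)

lemma wp_Cond: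
  "wp b (Cond c P Q) R s \<longleftrightarrow>
    (if test_val s c then wp b P (\<lambda>t. R (t + 1)) s else wp b Q (\<lambda>t. R (t + 1)) s)"
  unfolding wp_def
  by (auto elim!: steps_CondE intro: steps_Cond_True steps_Cond_False)
     (metis Suc_eq_plus1 steps_Cond_False steps_Cond_True)+

lemma wp_mono:
  assumes "wp b P R s"
    and "\<And>t s'. bounded b s' \<Longrightarrow> \<forall>x. x \<notin> writes P \<longrightarrow> s' x = s x \<Longrightarrow> R t s' \<Longrightarrow> R' t s'"
  shows "wp b P R' s"
  using assms unfolding wp_def by (metis bounded_steps steps_frame)

lemma bounded_upd:
  "bounded b s \<Longrightarrow> x \<in> names \<Longrightarrow> i < b \<Longrightarrow> \<bar>z\<bar> < 2 ^ b \<Longrightarrow> bounded b (store_upd x i z s)"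
  by (auto simp: bounded_def store_upd_def)

lemma store_upd_apply: "store_upd x i z s y j = (if y = x \<and> j = i then z else s y j)"
  by (simp add: store_upd_def)

lemma store_upd_other: "y \<noteq> x \<Longrightarrow> store_upd x i z s y = s y"
  by (simp add: store_upd_def)

abbreviation var :: "string \<Rightarrow> expr" where
  "var x \<equiv> Read x (Const 0)"

abbreviation assign :: "string \<Rightarrow> expr \<Rightarrow> program" (infix "::=" 60) where
  "x ::= e \<equiv> Write x (Const 0) e"

abbreviation seq :: "program \<Rightarrow> program \<Rightarrow> program" (infixr ";;" 55) where
  "P ;; Q \<equiv> Seq P Q"

definition for_loop :: "string \<Rightarrow> expr \<Rightarrow> program \<Rightarrow> program" where
  "for_loop i h P = (i ::= Const 0 ;; While (Less (var i) h) (P ;; i ::= Add (var i) (Const 1)))"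

lemma writes_for_loop [simp]: "writes (for_loop i h P) = insert i (writes P)"
  by (auto simp: for_loop_def)

text \<open>Besides the body, each round pays one step for the test and one for the increment; the
  final 2 are the initial write and the failing test. As the counter is overwritten between rounds,
  the invariant has to survive any write to it; the body receives the counter value
  separately.\<close>

lemma wp_for_loop:
  fixes N K :: nat
  assumes s: "bounded b s" and i: "i \<in> names" "i \<notin> writes P" and N: "int N < 2 ^ b" and "0 < b"
    and h: "\<And>s'. \<forall>x. x \<notin> insert i (writes P) \<longrightarrow> s' x = s x \<Longrightarrow> expr_val s' h = int N"
    and upd: "\<And>m s' z. I m s' \<Longrightarrow> I m (store_upd i 0 z s')"
    and I0: "I 0 s"
    and step: "\<And>m s'. m < N \<Longrightarrow> bounded b s' \<Longrightarrow> I m s' \<Longrightarrow> s' i 0 = int m \<Longrightarrow>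
      \<forall>x. x \<notin> insert i (writes P) \<longrightarrow> s' x = s x \<Longrightarrow> wp b P (\<lambda>t s''. t \<le> K \<and> I (Suc m) s'') s'"
  shows "wp b (for_loop i h P) (\<lambda>t s'. t \<le> N * (K + 2) + 2 \<and> I N s') s"
proof -
  let ?W = "While (Less (var i) h) (P ;; i ::= Add (var i) (Const 1))"
  have loop: "\<exists>t s''. steps b ?W s' t s'' \<and> t \<le> l * (K + 2) + 1 \<and> I N s''"
    if "bounded b s'" "I m s'" "s' i 0 = int m" "m + l = N" "\<forall>x. x \<notin> insert i (writes P) \<longrightarrow> s' x = s x"
    for l m s'
    using that
  proof (induction l arbitrary: m s')
    case 0
    then have "steps b ?W s' 1 s'" by (intro steps_While_False) (auto simp: h[OF "0.prems"(5)])
    with 0 show ?case by force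
  next
    case (Suc l)
    then have "m < N" by simp
    from step[OF this Suc.prems(1-3) Suc.prems(5)] obtain t1 s1
      where 1: "steps b P s' t1 s1" "t1 \<le> K" "I (Suc m) s1" unfolding wp_def by blast
    have si: "s1 i 0 = int m" using steps_frame[OF 1(1) i(2)] Suc.prems(3) by simp
    define s2 where "s2 = store_upd i 0 (int (Suc m)) s1"
    have b2: "bounded b s2" unfolding s2_def
    proof (rule bounded_upd)
      have "\<bar>int (Suc m)\<bar> \<le> int N" using \<open>m < N\<close> by simp
      then show "\<bar>int (Suc m)\<bar> < 2 ^ b" using N by linarith
    qed (use bounded_steps[OF 1(1)] i \<open>0 < b\<close> in auto)
    have "steps b (P ;; i ::= Add (var i) (Const 1)) s' (t1 + 1) s2"
      by (rule steps_Seq[OF 1(1)], rule steps_Write)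
        (use bounded_steps[OF 1(1)] b2 si in \<open>auto simp: s2_def add.commute\<close>)
    moreover have "test_val s' (Less (var i) h)"
      using h[OF Suc.prems(5)] Suc.prems(3) \<open>m < N\<close> by simp
    moreover have "\<exists>t s''. steps b ?W s2 t s'' \<and> t \<le> l * (K + 2) + 1 \<and> I N s''"
    proof (rule Suc.IH[of s2 "Suc m", OF b2])
      show "I (Suc m) s2" unfolding s2_def by (rule upd[OF 1(3)])
      show "\<forall>x. x \<notin> insert i (writes P) \<longrightarrow> s2 x = s x"
        using Suc.prems(5) steps_frame[OF 1(1)] by (auto simp: s2_def store_upd_def)
    qed (use Suc.prems in \<open>auto simp: s2_def store_upd_def\<close>)
    ultimately obtain t s'' where "steps b ?W s' (t1 + 1 + t + 1) s''" "t \<le> l * (K + 2) + 1" "I N s''"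
      using steps_While_True by blast
    moreover have "t1 + 1 + t + 1 \<le> Suc l * (K + 2) + 1"
      using calculation(2) 1(2) by simp
    ultimately show ?case by blast
  qed
  have b0: "bounded b (store_upd i 0 0 s)" by (rule bounded_upd) (use assms in auto)
  have "\<exists>t s''. steps b ?W (store_upd i 0 0 s) t s'' \<and> t \<le> N * (K + 2) + 1 \<and> I N s''"
    by (rule loop[where m = 0]) (use b0 upd[OF I0] in \<open>auto simp: store_upd_def\<close>)
  then obtain t s'' where "steps b ?W (store_upd i 0 0 s) t s''" "t \<le> N * (K + 2) + 1" "I N s''" by blast
  moreover have "steps b (i ::= Const 0) s 1 (store_upd i 0 0 s)"
    by (rule steps_Write) (use s b0 in auto)
  ultimately have "steps b (for_loop i h P) s (1 + t) s''" unfolding for_loop_def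
    by (intro steps_Seq)
  with \<open>t \<le> _\<close> \<open>I N s''\<close> show ?thesis unfolding wp_def by force
qed

subsection \<open>Polynomially bounded functions\<close>

definition poly_bounded :: "(nat \<Rightarrow> nat) \<Rightarrow> bool" where
  "poly_bounded f \<longleftrightarrow> (\<exists>q :: nat poly. \<forall>n. f n \<le> poly q n)"

lemma poly_bounded_const: "poly_bounded (\<lambda>n. c)"
  unfolding poly_bounded_def by (rule exI[of _ "[:c:]"]) simp

lemma poly_bounded_id: "poly_bounded (\<lambda>n. n)"
  unfolding poly_bounded_def by (rule exI[of _ "[:0, 1:]"]) simp

lemma poly_bounded_poly: "poly_bounded (poly p)"
  unfolding poly_bounded_def by blast

lemma poly_bounded_add: "poly_bounded f \<Longrightarrow> poly_bounded g \<Longrightarrow> poly_bounded (\<lambda>n. f n + g n)"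
  unfolding poly_bounded_def by (metis add_mono poly_add)

lemma poly_bounded_mult: "poly_bounded f \<Longrightarrow> poly_bounded g \<Longrightarrow> poly_bounded (\<lambda>n. f n * g n)"
  unfolding poly_bounded_def by (metis mult_le_mono poly_mult)

lemma poly_bounded_Suc: "poly_bounded f \<Longrightarrow> poly_bounded (\<lambda>n. Suc (f n))"
  using poly_bounded_add[OF poly_bounded_const[of 1], of f] by simp

lemmas poly_bounded_intros = poly_bounded_const poly_bounded_id poly_bounded_poly poly_bounded_add
  poly_bounded_mult poly_bounded_Suc

lemma poly_mono_nat: "x \<le> y \<Longrightarrow> poly p x \<le> poly (p :: nat poly) y"
  by (induction p) (auto intro!: add_mono mult_mono)

text \<open>Polynomials over \<open>nat\<close> are monotone, so a bound for \<open>g n\<close> may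
  be inserted into a bound for \<open>f\<close>.\<close>

lemma poly_bounded_compose: "poly_bounded f \<Longrightarrow> poly_bounded g \<Longrightarrow> poly_bounded (\<lambda>n. f (g n))"
  unfolding poly_bounded_def by (metis poly_pcompose poly_mono_nat order_trans)

lemma poly_bounded_expr_bits: "poly_bounded (\<lambda>b. expr_bits b e)"
  by (induction e) (auto intro!: poly_bounded_intros)

lemma poly_bounded_expr_cap: "poly_bounded (\<lambda>b. expr_cap b e)"
  by (induction e) (auto intro!: poly_bounded_intros poly_bounded_expr_bits)

lemma poly_bounded_test_cap: "poly_bounded (\<lambda>b. test_cap b c)"
  by (induction c) (auto intro!: poly_bounded_intros poly_bounded_expr_bits poly_bounded_expr_cap)

lemma poly_bounded_step_cap: "poly_bounded (\<lambda>b. step_cap b P)"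
  by (induction P) (auto intro!: poly_bounded_intros poly_bounded_expr_cap poly_bounded_test_cap)

section \<open>Connectivity and branching walks\<close>

text \<open>This holds for the empty set, in contrast to the library's \<open>connected\<close>;
  nonemptiness is added separately wherever the two notions meet.\<close>

definition conn :: "('a \<times> 'a) set \<Rightarrow> 'a set \<Rightarrow> bool" where
  "conn E X \<longleftrightarrow> (\<forall>u\<in>X. \<forall>v\<in>X. (u, v) \<in> (Restr E X)\<^sup>*)"

definition covers :: "('a \<times> 'a) set \<Rightarrow> 'a set \<Rightarrow> bool" where
  "covers E X \<longleftrightarrow> (\<forall>(u, v)\<in>E. u \<in> X \<or> v \<in> X)"

lemma sym_rtrancl_Restr: "sym E \<Longrightarrow> (u, v) \<in> (Restr E X)\<^sup>* \<Longrightarrow> (v, u) \<in> (Restr E X)\<^sup>*"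
  by (rule symD[OF sym_rtrancl]) (auto simp: sym_def)

lemma conn_iff_root:
  assumes "sym E" "r \<in> X"
  shows "conn E X \<longleftrightarrow> (\<forall>v\<in>X. (r, v) \<in> (Restr E X)\<^sup>*)"
  unfolding conn_def using assms sym_rtrancl_Restr by (metis rtrancl_trans)

lemma rtrancl_Restr_mono: "(u, v) \<in> (Restr E X)\<^sup>* \<Longrightarrow> X \<subseteq> Y \<Longrightarrow> (u, v) \<in> (Restr E Y)\<^sup>*"
  by (erule rtrancl_mono[THEN subsetD, rotated]) auto

lemma rtrancl_exit:
  assumes "(u, v) \<in> R\<^sup>*" "u \<in> Y" "v \<notin> Y"
  shows "\<exists>a b. (a, b) \<in> R \<and> a \<in> Y \<and> b \<notin> Y"
  using assms by (induction rule: rtrancl_induct) auto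

text \<open>A rooted ordered tree with vertex labels, written as a binary tree:
  \<open>Join s t\<close> hangs \<open>t\<close> as last child below the root of \<open>s\<close>.
  Leaves are the tree nodes and joins the tree edges, and each nontrivial tree splits off its last
  child in exactly one way, so walks are counted once.\<close>

datatype walk = Leaf nat | Join walk walk

primrec wroot :: "walk \<Rightarrow> nat" where
  "wroot (Leaf v) = v"
| "wroot (Join s t) = wroot s"

primrec nodes :: "walk \<Rightarrow> nat set" where
  "nodes (Leaf v) = {v}"
| "nodes (Join s t) = nodes s \<union> nodes t"

primrec wlen :: "walk \<Rightarrow> nat" where
  "wlen (Leaf v) = 0"
| "wlen (Join s t) = Suc (wlen s + wlen t)"

primrec valid :: "(nat \<times> nat) set \<Rightarrow> walk \<Rightarrow> bool" where
  "valid E (Leaf v) \<longleftrightarrow> True"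
| "valid E (Join s t) \<longleftrightarrow> valid E s \<and> valid E t \<and> (wroot s, wroot t) \<in> E"

primrec wprod :: "(nat \<Rightarrow> int) \<Rightarrow> walk \<Rightarrow> int" where
  "wprod e (Leaf v) = e v"
| "wprod e (Join s t) = wprod e s * wprod e t"

primrec wsum :: "(nat \<Rightarrow> nat) \<Rightarrow> walk \<Rightarrow> nat" where
  "wsum c (Leaf v) = c v"
| "wsum c (Join s t) = wsum c s + wsum c t"

section \<open>Sets and weighted sums of branching walks\<close>

definition walks :: "(nat \<times> nat) set \<Rightarrow> nat \<Rightarrow> nat \<Rightarrow> walk set" where
  "walks E l v = {t. valid E t \<and> wroot t = v \<and> wlen t = l}"

lemma walks_0: "walks E 0 v = {Leaf v}"
proof -
  have "t = Leaf (wroot t)" if "wlen t = 0" for t using that by (cases t) auto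
  then show ?thesis by (auto simp: walks_def)
qed

lemma walks_Suc:
  "walks E (Suc l) v =
    (\<Union>a\<in>{..l}. \<Union>u\<in>E `` {v}. (\<lambda>(s, t). Join s t) ` (walks E a v \<times> walks E (l - a) u))"
proof (rule set_eqI)
  fix t
  show "t \<in> walks E (Suc l) v \<longleftrightarrow>
      t \<in> (\<Union>a\<in>{..l}. \<Union>u\<in>E `` {v}. (\<lambda>(s, t). Join s t) ` (walks E a v \<times> walks E (l - a) u))"
  proof (cases t)
    case (Join t1 t2)
    have "wlen t1 + wlen t2 = l \<longleftrightarrow> wlen t1 \<le> l \<and> wlen t2 = l - wlen t1" by auto
    then show ?thesis unfolding Join walks_def by (auto simp: image_iff)
  qed (auto simp: walks_def)
qed

lemma finite_walks: "finite E \<Longrightarrow> finite (walks E l v)"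
proof (induction l arbitrary: v rule: less_induct)
  case (less l)
  show ?case
  proof (cases l)
    case (Suc m)
    have "finite (E `` {v})" using less.prems by (rule finite_Image)
    with Suc less show ?thesis by (auto simp: walks_Suc)
  qed (simp add: walks_0)
qed

text \<open>A generating sum: for \<open>e v = b ^ c v\<close> each walk contributes
  \<open>b ^ wsum c t\<close>, so costs appear as exponents, and \<open>e v = 0\<close> forbids the
  vertex \<open>v\<close>.\<close>

definition walk_sum :: "(nat \<times> nat) set \<Rightarrow> (nat \<Rightarrow> int) \<Rightarrow> nat \<Rightarrow> nat \<Rightarrow> int" where
  "walk_sum E e l v = (\<Sum>t\<in>walks E l v. wprod e t)"

lemma walk_sum_0 [simp]: "walk_sum E e 0 v = e v"
  by (simp add: walk_sum_def walks_0)

text \<open>Unique decomposition of a tree into the last subtree and the rest turns the sum over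
  walks into a convolution. This recursion is the dynamic program that evaluates the sum without
  enumerating walks.\<close>

lemma walk_sum_Suc:
  assumes "finite E"
  shows "walk_sum E e (Suc l) v = (\<Sum>a\<le>l. \<Sum>u\<in>E `` {v}. walk_sum E e a v * walk_sum E e (l - a) u)"
proof -
  have fin: "finite (E `` {v})" using assms by (rule finite_Image)
  have inj: "inj_on (\<lambda>x. Join (fst x) (snd x)) X" for X by (auto simp: inj_on_def)
  have "walk_sum E e (Suc l) v =
      (\<Sum>a\<le>l. \<Sum>t\<in>(\<Union>u\<in>E `` {v}. (\<lambda>(s, t). Join s t) ` (walks E a v \<times> walks E (l - a) u)). wprod e t)"
    unfolding walk_sum_def walks_Suc
    by (rule sum.UNION_disjoint)
      (use fin finite_walks[OF assms] in \<open>auto simp: walks_def\<close>)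
  also have "\<dots> = (\<Sum>a\<le>l. \<Sum>u\<in>E `` {v}. \<Sum>t\<in>(\<lambda>(s, t). Join s t) ` (walks E a v \<times> walks E (l - a) u). wprod e t)"
    by (intro sum.cong refl sum.UNION_disjoint)
      (use fin finite_walks[OF assms] in \<open>auto simp: walks_def\<close>)
  also have "\<dots> = (\<Sum>a\<le>l. \<Sum>u\<in>E `` {v}. walk_sum E e a v * walk_sum E e (l - a) u)"
    unfolding walk_sum_def
    by (intro sum.cong refl) (simp add: case_prod_unfold sum.reindex[OF inj] sum_product sum.cartesian_product)
  finally show ?thesis .
qed

text \<open>The program runs through pairs with a single counter; this brings its sum back to the
  double sum of the recursion.\<close>

lemma sum_div_mod:
  fixes n l :: nat
  shows "(\<Sum>q<n * l. g (q div n) (q mod n)) = (\<Sum>a<l. \<Sum>u<n. g a u :: int)"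
proof (induction l)
  case (Suc l)
  have "{..<n * Suc l} = {..<n * l} \<union> {n * l..<n * l + n}" by auto
  moreover have "{..<n * l} \<inter> {n * l..<n * l + n} = {}" by auto
  ultimately have "(\<Sum>q<n * Suc l. g (q div n) (q mod n)) =
      (\<Sum>q<n * l. g (q div n) (q mod n)) + (\<Sum>q=n * l..<n * l + n. g (q div n) (q mod n))"
    using sum.union_disjoint[of "{..<n * l}" "{n * l..<n * l + n}" "\<lambda>q. g (q div n) (q mod n)"] by simp
  also have "(\<Sum>q=n * l..<n * l + n. g (q div n) (q mod n)) = (\<Sum>q=0 + n * l..<n + n * l. g (q div n) (q mod n))"
    by (simp add: add.commute)
  also have "\<dots> = (\<Sum>u=0..<n. g ((u + n * l) div n) ((u + n * l) mod n))"
    by (rule sum.shift_bounds_nat_ivl)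
  also have "\<dots> = (\<Sum>u<n. g l u)"
    by (rule sum.cong) auto
  finally show ?case using Suc by simp
qed simp

lemma walk_sum_Suc_div_mod:
  assumes "E \<subseteq> {..<n} \<times> {..<n}"
  shows "walk_sum E e (Suc l) v = (\<Sum>q<n * Suc l. of_bool ((v, q mod n) \<in> E) *
    walk_sum E e (q div n) v * walk_sum E e (l - q div n) (q mod n))"
proof -
  have fin: "finite E" using assms finite_subset by fastforce
  have "(\<Sum>q<n * Suc l. of_bool ((v, q mod n) \<in> E) *
      walk_sum E e (q div n) v * walk_sum E e (l - q div n) (q mod n)) =
      (\<Sum>a<Suc l. \<Sum>u<n. of_bool ((v, u) \<in> E) * walk_sum E e a v * walk_sum E e (l - a) u)"
    by (rule sum_div_mod)
  also have "\<dots> = (\<Sum>a\<le>l. \<Sum>u<n. of_bool ((v, u) \<in> E) * walk_sum E e a v * walk_sum E e (l - a) u)"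
    by (simp only: lessThan_Suc_atMost)
  also have "\<dots> = (\<Sum>a\<le>l. \<Sum>u\<in>E `` {v}. walk_sum E e a v * walk_sum E e (l - a) u)"
    by (intro sum.cong refl sum.mono_neutral_cong_right) (use assms in auto)
  finally show ?thesis using walk_sum_Suc[OF fin] by simp
qed

lemma wprod_nonneg: "(\<And>v. 0 \<le> e v) \<Longrightarrow> 0 \<le> wprod e t"
  by (induction t) auto

lemma walk_sum_nonneg: "(\<And>v. 0 \<le> e v) \<Longrightarrow> 0 \<le> walk_sum E e l v"
  unfolding walk_sum_def by (intro sum_nonneg wprod_nonneg)

text \<open>Each join allows at most \<open>N\<close> ways to split the length and \<open>n\<close>
  choices of the child, and each of the \<open>l + 1\<close> leaves contributes at most
  \<open>b\<close>.\<close>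

lemma walk_sum_le:
  assumes E: "E \<subseteq> {..<n} \<times> {..<n}" and e: "\<And>v. 0 \<le> e v" "\<And>v. e v \<le> b" and "l \<le> N"
  shows "walk_sum E e l v \<le> int (n * N) ^ l * b ^ Suc l"
  using \<open>l \<le> N\<close>
proof (induction l arbitrary: v rule: less_induct)
  case (less l)
  have b: "0 \<le> b" using e order_trans by blast
  show ?case
  proof (cases l)
    case 0
    then show ?thesis using e by simp
  next
    case (Suc m)
    have fin: "finite E" using E finite_subset by fastforce
    have "card (E `` {v}) \<le> card {..<n}" using E by (intro card_mono) auto
    then have cn: "card (E `` {v}) \<le> n" by simp
    have "walk_sum E e l v = (\<Sum>a\<le>m. \<Sum>u\<in>E `` {v}. walk_sum E e a v * walk_sum E e (m - a) u)"
      unfolding Suc by (rule walk_sum_Suc[OF fin])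
    also have "\<dots> \<le> (\<Sum>a\<le>m. \<Sum>u\<in>E `` {v}. (int (n * N) ^ a * b ^ Suc a) * (int (n * N) ^ (m - a) * b ^ Suc (m - a)))"
      using less Suc b by (intro sum_mono mult_mono walk_sum_nonneg e less.IH) auto
    also have "\<dots> = (\<Sum>a\<le>m. \<Sum>u\<in>E `` {v}. int (n * N) ^ m * b ^ Suc l)"
    proof (intro sum.cong refl)
      fix a assume "a \<in> {..m}"
      then have a: "m = a + (m - a)" by simp
      let ?P = "int (n * N)"
      have "?P ^ m = ?P ^ a * ?P ^ (m - a)" by (subst a) (rule power_add)
      moreover have "b ^ m = b ^ a * b ^ (m - a)" by (subst a) (rule power_add)
      ultimately show "(?P ^ a * b ^ Suc a) * (?P ^ (m - a) * b ^ Suc (m - a)) = ?P ^ m * b ^ Suc l"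
        by (simp add: Suc)
    qed
    also have "\<dots> = int (Suc m) * int (card (E `` {v})) * (int (n * N) ^ m * b ^ Suc l)" by simp
    also have "\<dots> \<le> (int N * int n) * (int (n * N) ^ m * b ^ Suc l)"
      by (intro mult_right_mono mult_mono) (use Suc less.prems cn b in auto)
    also have "\<dots> = int (n * N) ^ l * b ^ Suc l" by (simp add: Suc algebra_simps)
    finally show ?thesis .
  qed
qed

lemma card_walks_le:
  assumes "E \<subseteq> {..<n} \<times> {..<n}" and "l \<le> N"
  shows "card (walks E l v) \<le> (n * N) ^ l"
proof -
  have 1: "wprod (\<lambda>_. 1) t = 1" for t by (induction t) auto
  have "walk_sum E (\<lambda>_. 1) l v \<le> int (n * N) ^ l * 1 ^ Suc l"
    by (rule walk_sum_le) (use assms in auto)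
  then have "int (card (walks E l v)) \<le> int ((n * N) ^ l)" by (simp add: walk_sum_def 1)
  then show ?thesis by linarith
qed

text \<open>Avoiding a set of vertices becomes a property of the leaf weights, so the dynamic
  program handles each term of the inclusion--exclusion without change.\<close>

lemma wprod_restrict:
  "wprod (\<lambda>v. if v \<in> R then 0 else e v) t = of_bool (nodes t \<inter> R = {}) * wprod e t"
  by (induction t) (auto simp: of_bool_def)

lemma wprod_powers:
  "wprod (\<lambda>v. if v \<in> A then b ^ c v else 0) t = of_bool (nodes t \<subseteq> A) * b ^ wsum c t"
  by (induction t) (auto simp: power_add)

lemma finite_nodes [simp]: "finite (nodes t)"
  by (induction t) auto

lemma root_in_nodes [simp]: "wroot t \<in> nodes t"
  by (induction t) auto

text \<open>\<open>wsum\<close> counts repeated vertices again and again, \<open>nodes\<close> once.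
  This inequality is the only loss in passing from walks to vertex sets.\<close>

lemma sum_nodes_le: "sum c (nodes t) \<le> wsum c t"
proof (induction t)
  case (Join s t)
  have "sum c (nodes s \<union> nodes t) \<le> sum c (nodes s) + sum c (nodes t)"
    by (simp add: sum_Un_nat)
  with Join show ?case by simp
qed simp

lemma wsum_linear: "wsum (\<lambda>v. a v * m + b v) t = wsum a t * m + wsum b t"
  by (induction t) (auto simp: algebra_simps)

lemma wsum_le: "(\<And>v. c v \<le> K) \<Longrightarrow> wsum c t \<le> Suc (wlen t) * K"
proof (induction t)
  case (Join s t)
  then show ?case using add_mono[of "wsum c s" "Suc (wlen s) * K" "wsum c t" "Suc (wlen t) * K"]
    by (simp add: algebra_simps)
qed simp

section \<open>Branching walks against connected vertex sets\<close>

lemma walk_connected: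
  assumes "valid E t" "v \<in> nodes t" "sym E"
  shows "(wroot t, v) \<in> (Restr E (nodes t))\<^sup>*"
  using assms
proof (induction t)
  case (Join s t)
  show ?case
  proof (cases "v \<in> nodes s")
    case True
    then show ?thesis using Join by (auto intro: rtrancl_Restr_mono)
  next
    case False
    then have "(wroot t, v) \<in> (Restr E (nodes (Join s t)))\<^sup>*"
      using Join by (auto intro: rtrancl_Restr_mono)
    moreover have "(wroot s, wroot t) \<in> Restr E (nodes (Join s t))" using Join by auto
    ultimately show ?thesis by (metis converse_rtrancl_into_rtrancl wroot.simps(2))
  qed
qed simp

lemma walk_attach:
  assumes "valid E t" "y \<in> nodes t" "(y, u) \<in> E"
  shows "\<exists>t'. valid E t' \<and> wroot t' = wroot t \<and> nodes t' = insert u (nodes t) \<and>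
    wlen t' = Suc (wlen t) \<and> (\<forall>c. wsum c t' = wsum c t + c u)"
  using assms
proof (induction t)
  case (Leaf v)
  then show ?case by (intro exI[of _ "Join (Leaf v) (Leaf u)"]) auto
next
  case (Join s t)
  show ?case
  proof (cases "y \<in> nodes s")
    case True
    with Join obtain s' where "valid E s' \<and> wroot s' = wroot s \<and> nodes s' = insert u (nodes s) \<and>
        wlen s' = Suc (wlen s) \<and> (\<forall>c. wsum c s' = wsum c s + c u)" by auto
    then show ?thesis using Join.prems by (intro exI[of _ "Join s' t"]) auto
  next
    case False
    with Join obtain t' where "valid E t' \<and> wroot t' = wroot t \<and> nodes t' = insert u (nodes t) \<and>
        wlen t' = Suc (wlen t) \<and> (\<forall>c. wsum c t' = wsum c t + c u)" by auto
    then show ?thesis using Join.prems by (intro exI[of _ "Join s t'"]) auto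
  qed
qed

text \<open>The walk grows along an edge that leaves the vertices reached so far, hence never
  repeats a vertex, and its cost is exactly that of the set. This makes the minimum over walks
  attained by genuine solutions.\<close>

lemma spanning_walk:
  assumes "finite X" "r \<in> X" "conn E X"
  shows "\<exists>t\<in>walks E (card X - 1) r. nodes t = X \<and> (\<forall>c. wsum c t = sum c X)"
proof -
  have "\<exists>t\<in>walks E l r. nodes t \<subseteq> X \<and> card (nodes t) = Suc l \<and> (\<forall>c. wsum c t = sum c (nodes t))"
    if "l < card X" for l
    using that
  proof (induction l)
    case 0
    then show ?case using assms by (intro bexI[of _ "Leaf r"]) (auto simp: walks_def)
  next
    case (Suc l)
    then obtain t where t: "t \<in> walks E l r" "nodes t \<subseteq> X" "card (nodes t) = Suc l"
      "\<And>c. wsum c t = sum c (nodes t)" by auto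
    then have "nodes t \<noteq> X" using Suc.prems by auto
    then obtain v where "v \<in> X" "v \<notin> nodes t" using t(2) by blast
    moreover have "r \<in> nodes t" using t(1) root_in_nodes by (auto simp: walks_def)
    moreover have "(r, v) \<in> (Restr E X)\<^sup>*" using assms \<open>v \<in> X\<close> by (auto simp: conn_def)
    ultimately have "\<exists>y u. (y, u) \<in> Restr E X \<and> y \<in> nodes t \<and> u \<notin> nodes t"
      by (intro rtrancl_exit)
    then obtain y u where yu: "(y, u) \<in> E" "u \<in> X" "y \<in> nodes t" "u \<notin> nodes t" by blast
    have t1: "valid E t" "wroot t = r" "wlen t = l" using t(1) by (simp_all add: walks_def)
    obtain t' where t': "valid E t'" "wroot t' = r" "nodes t' = insert u (nodes t)" "wlen t' = Suc l"
      "\<And>c. wsum c t' = wsum c t + c u"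
      using walk_attach[OF t1(1) yu(3,1)] t1 by metis
    show ?case using t(2-4) t' yu by (intro bexI[of _ t']) (simp_all add: walks_def)
  qed
  moreover have card: "0 < card X" using assms by (auto simp: card_gt_0_iff)
  moreover from card have "card X - 1 < card X" by simp
  ultimately obtain t where t: "t \<in> walks E (card X - 1) r" "nodes t \<subseteq> X"
    "card (nodes t) = Suc (card X - 1)" "\<forall>c. wsum c t = sum c (nodes t)" by blast
  then have "card (nodes t) = card X" using card by simp
  then have "nodes t = X" using t assms by (simp add: card_subset_eq)
  with t show ?thesis by blast
qed

section \<open>Reading off exponents\<close>

text \<open>Fewer than \<open>B\<close> powers with exponents below \<open>e\<close> stay below
  \<open>B ^ e\<close>, and powers with exponents above \<open>e\<close> are multiples of
  \<open>B ^ Suc e\<close>. So neither side disturbs the digit at \<open>e\<close>, which is the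
  number of elements with this exponent.\<close>

lemma sum_powers_digit:
  fixes B :: int
  assumes "finite X" "int (card X) < B"
  shows "(\<Sum>x\<in>X. B ^ c x) div B ^ e mod B = int (card {x \<in> X. c x = e})"
proof -
  have B: "0 < B" using assms(2) by linarith
  let ?lo = "\<Sum>x\<in>{x \<in> X. c x < e}. B ^ c x" and ?hi = "\<Sum>x\<in>{x \<in> X. c x > e}. B ^ (c x - Suc e)"
  let ?N = "int (card {x \<in> X. c x = e})"
  have "(\<Sum>x\<in>X. B ^ c x) = (\<Sum>x\<in>{x \<in> X. c x < e} \<union> {x \<in> X. c x = e} \<union> {x \<in> X. c x > e}. B ^ c x)"
    by (rule sum.cong) auto
  also have "\<dots> = ?lo + (\<Sum>x\<in>{x \<in> X. c x = e}. B ^ c x) + (\<Sum>x\<in>{x \<in> X. c x > e}. B ^ c x)"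
    using assms(1) by (subst sum.union_disjoint; (subst sum.union_disjoint)?) auto
  also have "(\<Sum>x\<in>{x \<in> X. c x = e}. B ^ c x) = ?N * B ^ e" by simp
  also have "(\<Sum>x\<in>{x \<in> X. c x > e}. B ^ c x) = ?hi * B * B ^ e"
    unfolding sum_distrib_right
  proof (rule sum.cong)
    fix x assume "x \<in> {x \<in> X. e < c x}"
    then have "c x = (c x - Suc e) + 1 + e" by simp
    then have "B ^ c x = B ^ ((c x - Suc e) + 1 + e)" by simp
    then show "B ^ c x = B ^ (c x - Suc e) * B * B ^ e" by (simp only: power_add power_one_right)
  qed simp
  finally have eq: "(\<Sum>x\<in>X. B ^ c x) = ?lo + (?N + ?hi * B) * B ^ e" by (simp add: algebra_simps)
  have lo: "0 \<le> ?lo" "?lo < B ^ e"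
  proof -
    show "0 \<le> ?lo" using B by (intro sum_nonneg) auto
    show "?lo < B ^ e"
    proof (cases e)
      case (Suc d)
      have "?lo \<le> (\<Sum>x\<in>{x \<in> X. c x < e}. B ^ d)"
        using B Suc by (intro sum_mono power_increasing) auto
      also have "\<dots> = int (card {x \<in> X. c x < e}) * B ^ d" by simp
      also have "\<dots> \<le> int (card X) * B ^ d"
        using B assms(1) by (intro mult_right_mono) (auto intro: card_mono)
      also have "\<dots> < B * B ^ d" using B assms(2) by (intro mult_strict_right_mono) auto
      finally show ?thesis using Suc by simp
    qed simp
  qed
  have N: "0 \<le> ?N" "?N < B"
    using assms card_mono[of X "{x \<in> X. c x = e}"] by auto
  have "(\<Sum>x\<in>X. B ^ c x) div B ^ e = ?N + ?hi * B"
    unfolding eq using lo B by simp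
  then show ?thesis using N by simp
qed

lemma sum_involution:
  fixes g :: "'a \<Rightarrow> int"
  assumes "\<And>x. x \<in> X \<Longrightarrow> f x \<in> X" "\<And>x. x \<in> X \<Longrightarrow> f (f x) = x" "\<And>x. x \<in> X \<Longrightarrow> g (f x) = - g x"
  shows "sum g X = 0"
proof -
  have "sum g X = sum (\<lambda>x. g (f x)) X"
    by (rule sum.reindex_bij_witness[of _ f f]) (simp_all add: assms(1,2))
  also have "\<dots> = - sum g X" using assms(3) by (simp add: sum_negf)
  finally show ?thesis by simp
qed

section \<open>Colourings along a spanning tree\<close>

text \<open>The list \<open>l\<close> enumerates the current cover and starts with the prefix as its
  first \<open>j\<close> entries. The parents \<open>pa\<close> are meaningful only from position
  \<open>j\<close> on: the connected prefix acts as one contracted root of the spanning tree. Below,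
  \<open>nd\<close> and \<open>pr\<close> count positions from \<open>j\<close>.\<close>

locale tree_order =
  fixes E :: "(nat \<times> nat) set" and n :: nat and l :: "nat list" and j :: nat and pa :: "nat \<Rightarrow> nat"
  assumes E_sub: "E \<subseteq> {..<n} \<times> {..<n}" and sym_E: "sym E"
    and l: "distinct l" "set l \<subseteq> {..<n}" and j: "0 < j" "j \<le> length l"
    and pa: "\<And>i. j \<le> i \<Longrightarrow> i < length l \<Longrightarrow> pa i \<in> set (take i l) \<and> (pa i, l ! i) \<in> E"
    and conn_P: "conn E (set (take j l))"
begin

definition m :: nat where "m = length l - j"
definition P :: "nat set" where "P = set (take j l)"
definition C :: "nat set" where "C = set l"
definition r :: nat where "r = l ! 0"
definition nd :: "nat \<Rightarrow> nat" where "nd i = l ! (j + i)"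
definition pr :: "nat \<Rightarrow> nat" where "pr i = pa (j + i)"

definition before :: "nat \<Rightarrow> nat set" where "before y = set (take (j + y) l)"

lemma before_0: "before 0 = P" by (simp add: P_def before_def)

lemma before_m: "before m = C" using j by (simp add: m_def C_def before_def)

lemma before_Suc: "y < m \<Longrightarrow> before (Suc y) = insert (nd y) (before y)"
  by (simp add: m_def nd_def before_def take_Suc_conv_app_nth)

lemma before_mono: "x \<le> y \<Longrightarrow> before x \<subseteq> before y"
  by (simp add: before_def set_take_subset_set_take)

lemma nd_notin: "y < m \<Longrightarrow> nd y \<notin> before y"
  using l(1) by (auto simp: m_def nd_def before_def in_set_conv_nth nth_eq_iff_index_eq)

lemma nd_in: "y < m \<Longrightarrow> nd y \<in> C" by (simp add: m_def nd_def C_def)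

lemma pr_in: "y < m \<Longrightarrow> pr y \<in> before y" using pa[of "j + y"] by (simp add: pr_def m_def before_def)

lemma pr_in_C: "y < m \<Longrightarrow> pr y \<in> C" using pr_in by (metis C_def before_def in_set_takeD)

lemma pr_nd: "y < m \<Longrightarrow> (pr y, nd y) \<in> E" using pa[of "j + y"] by (simp add: pr_def nd_def m_def)

lemma P_sub_C: "P \<subseteq> C" by (simp add: P_def C_def set_take_subset)

lemma r_in_P: "r \<in> P"
  using j by (auto simp: P_def r_def in_set_conv_nth intro!: exI[of _ 0])

lemma nd_notin_P: "y < m \<Longrightarrow> nd y \<notin> P"
  using nd_notin before_mono[of 0 y] before_0 by auto

lemma nd_inj: "x < m \<Longrightarrow> y < m \<Longrightarrow> nd x = nd y \<Longrightarrow> x = y"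
  using l(1) by (auto simp: m_def nd_def nth_eq_iff_index_eq)

text \<open>Parents precede their children in \<open>l\<close>, so induction along the list is
  induction along the tree, with all of \<open>P\<close> as base case.\<close>

lemma C_induct [consumes 1, case_names P nd]:
  assumes "u \<in> C" and "\<And>u. u \<in> P \<Longrightarrow> Q u" and "\<And>y. y < m \<Longrightarrow> Q (pr y) \<Longrightarrow> Q (nd y)"
  shows "Q u"
proof -
  have "\<forall>u\<in>before y. Q u" if "y \<le> m" for y
    using that
  proof (induction y)
    case 0
    then show ?case using assms(2) by (simp add: before_0)
  next
    case (Suc y)
    then show ?case using before_Suc[of y] assms(3)[of y] pr_in[of y] by auto
  qed
  then show ?thesis using assms(1) before_m by blast
qed

text \<open>
  Colour 0 stands for a vertex outside the cover, and 1 and 2 for the two sides of a cut.  One bit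
  per vertex suffices, since the colour of the parent rules out one of the three values: edges
  with both ends outside do not occur, and tree edges do not cross the cut.
\<close>

primrec cols :: "nat \<Rightarrow> nat \<Rightarrow> nat \<Rightarrow> int" where
  "cols M 0 = (\<lambda>_. 1)"
| "cols M (Suc y) = (cols M y)(nd y :=
    (if cols M y (pr y) = 0 then (if bit M y then 2 else 1) else (if bit M y then cols M y (pr y) else 0)))"

text \<open>A new piece starts exactly at a vertex whose parent has colour 0, and its bit then
  selects the side. The product is thus -1 to the number of pieces on side 2; the piece of
  \<open>P\<close> always lies on side 1.\<close>

primrec sgs :: "nat \<Rightarrow> nat \<Rightarrow> int" where
  "sgs M 0 = 1"
| "sgs M (Suc y) = sgs M y * (if cols M y (pr y) = 0 \<and> bit M y then - 1 else 1)"

definition col :: "nat \<Rightarrow> nat \<Rightarrow> int" where "col M = cols M m"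

lemma cols_stable: "x \<le> y \<Longrightarrow> y \<le> m \<Longrightarrow> u \<in> before x \<Longrightarrow> cols M y u = cols M x u"
proof (induction y rule: dec_induct)
  case (step y)
  moreover have "nd y \<notin> before x" using nd_notin[of y] before_mono[of x y] step by auto
  ultimately show ?case by auto
qed simp

lemma cols_eq: "y \<le> m \<Longrightarrow> u \<in> before y \<Longrightarrow> cols M y u = col M u"
  using cols_stable[of y m u M] by (simp add: col_def)

lemma col_P: "u \<in> P \<Longrightarrow> col M u = 1"
  using cols_eq[of 0 u M] by (simp add: before_0)

lemma col_nd:
  assumes "y < m"
  shows "col M (nd y) =
    (if col M (pr y) = 0 then (if bit M y then 2 else 1) else (if bit M y then col M (pr y) else 0))"
proof -
  have "col M (nd y) = cols M (Suc y) (nd y)"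
    using assms by (intro cols_eq[symmetric]) (auto simp: before_Suc)
  then show ?thesis using cols_eq[of y "pr y" M] pr_in[OF assms] assms by simp
qed

lemma col_range: "u \<in> C \<Longrightarrow> col M u \<in> {0, 1, 2}"
proof (induction u rule: C_induct)
  case (nd y)
  then show ?case using pr_in_C[of y] by (auto simp: col_nd)
qed (simp add: col_P)

lemma sgs_eq: "y \<le> m \<Longrightarrow> sgs M y = (\<Prod>i<y. if col M (pr i) = 0 \<and> bit M i then - 1 else 1)"
proof (induction y)
  case (Suc y)
  then show ?case using cols_eq[of y "pr y" M] pr_in[of y] by (simp add: mult.commute)
qed simp

section \<open>Pieces of a colouring and their sides\<close>

definition used :: "nat \<Rightarrow> nat set" where "used M = {u \<in> C. col M u \<noteq> 0}"

definition side :: "nat \<Rightarrow> nat set" where "side M = {u \<in> C. col M u = 2}"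

primrec tops :: "nat set \<Rightarrow> nat \<Rightarrow> nat \<Rightarrow> nat" where
  "tops A 0 = (\<lambda>_. r)"
| "tops A (Suc y) = (tops A y)(nd y := (if pr y \<in> A then tops A y (pr y) else nd y))"

text \<open>The representative of the tree component of a vertex in \<open>A\<close>, all of \<open>P\<close> being one piece.\<close>

definition top_of :: "nat set \<Rightarrow> nat \<Rightarrow> nat" where "top_of A = tops A m"

lemma tops_stable: "x \<le> y \<Longrightarrow> y \<le> m \<Longrightarrow> u \<in> before x \<Longrightarrow> tops A y u = tops A x u"
proof (induction y rule: dec_induct)
  case (step y)
  moreover have "nd y \<notin> before x" using nd_notin[of y] before_mono[of x y] step by auto
  ultimately show ?case by auto
qed simp

lemma tops_eq: "y \<le> m \<Longrightarrow> u \<in> before y \<Longrightarrow> tops A y u = top_of A u"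
  using tops_stable[of y m u A] by (simp add: top_of_def)

lemma top_of_P: "u \<in> P \<Longrightarrow> top_of A u = r"
  using tops_eq[of 0 u A] by (simp add: before_0)

lemma top_of_nd:
  assumes "y < m"
  shows "top_of A (nd y) = (if pr y \<in> A then top_of A (pr y) else nd y)"
proof -
  have "top_of A (nd y) = tops A (Suc y) (nd y)"
    using assms by (intro tops_eq[symmetric]) (auto simp: before_Suc)
  then show ?thesis using tops_eq[of y "pr y" A] pr_in[OF assms] assms by simp
qed

definition hits :: "nat set \<Rightarrow> nat set \<Rightarrow> bool" where
  "hits A S \<longleftrightarrow> (\<forall>i<m. nd i \<in> A \<longrightarrow> pr i \<notin> A \<longrightarrow> (\<exists>u\<in>S \<inter> A. top_of A u = nd i))"

lemma col_flip:
  assumes i: "i < m" "pr i \<notin> used M" and "u \<in> C"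
  shows "col (flip_bit i M) u =
    (if col M u \<noteq> 0 \<and> top_of (used M) u = nd i then 3 - col M u else col M u)"
  using \<open>u \<in> C\<close>
proof (induction u rule: C_induct)
  case (P u)
  then show ?case using nd_notin_P[OF i(1)] r_in_P by (auto simp: col_P top_of_P)
next
  case (nd y)
  have C: "pr y \<in> C" "pr i \<in> C" using nd(1) i pr_in_C by auto
  then have c0: "col M (pr i) = 0" using i(2) by (simp add: used_def)
  show ?case
  proof (cases "y = i")
    case True
    then show ?thesis using nd i c0 C by (auto simp: col_nd top_of_nd bit_flip_bit_iff)
  next
    case False
    then have ne: "nd y \<noteq> nd i" using nd_inj nd(1) i(1) by blast
    have b: "bit (flip_bit i M) y = bit M y" using False by (simp add: bit_flip_bit_iff)
    show ?thesis
    proof (cases "col M (pr y) = 0")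
      case True
      then show ?thesis using nd C ne b by (simp add: col_nd top_of_nd used_def)
    next
      case nz: False
      then have "3 - col M (pr y) \<noteq> 0" using col_range[OF C(1), of M] by auto
      then show ?thesis using nd C ne b nz by (auto simp: col_nd top_of_nd used_def)
    qed
  qed
qed

lemma used_flip:
  assumes "i < m" "pr i \<notin> used M"
  shows "used (flip_bit i M) = used M"
proof -
  have "col (flip_bit i M) u = 0 \<longleftrightarrow> col M u = 0" if "u \<in> C" for u
    using col_flip[OF assms that] col_range[OF that, of M] by auto
  then show ?thesis by (auto simp: used_def)
qed

text \<open>Since the set of used vertices is unchanged, only the factor of the index
  \<open>i\<close> itself changes its sign.\<close>

lemma sgs_flip:
  assumes i: "i < m" "pr i \<notin> used M"
  shows "sgs (flip_bit i M) m = - sgs M m"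
proof -
  have z: "col (flip_bit i M) (pr y) = 0 \<longleftrightarrow> col M (pr y) = 0" if "y < m" for y
    using used_flip[OF i] pr_in_C[OF that] by (auto simp: used_def)
  let ?g = "\<lambda>M y. if col M (pr y) = 0 \<and> bit M y then - 1 else (1::int)"
  have "(\<Prod>y\<in>{..<m} - {i}. ?g (flip_bit i M) y) = (\<Prod>y\<in>{..<m} - {i}. ?g M y)"
    by (rule prod.cong) (auto simp: z bit_flip_bit_iff)
  moreover have "?g (flip_bit i M) i = - ?g M i"
  proof -
    have "col M (pr i) = 0" using i pr_in_C by (simp add: used_def)
    then show ?thesis using z[OF i(1)] by (simp add: bit_flip_bit_iff)
  qed
  ultimately show ?thesis using i(1)
    by (simp add: sgs_eq prod.remove[of "{..<m}" i])
qed

text \<open>The colour is constant along a piece, hence equal to that of its representative; the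
  piece of \<open>P\<close> has colour 1.\<close>

lemma top_of_cases:
  assumes "u \<in> C" "u \<in> used M"
  shows "top_of (used M) u = r \<and> col M u = 1 \<or>
    (\<exists>i<m. top_of (used M) u = nd i \<and> nd i \<in> used M \<and> pr i \<notin> used M \<and> col M u = col M (nd i))"
  using assms
proof (induction u rule: C_induct)
  case (nd y)
  show ?case
  proof (cases "pr y \<in> used M")
    case True
    then have "col M (nd y) = col M (pr y)" using nd by (auto simp: col_nd used_def split: if_splits)
    with nd True show ?thesis by (simp add: top_of_nd)
  next
    case False
    then show ?thesis using nd by (auto simp: top_of_nd)
  qed
qed (simp add: col_P top_of_P)

lemma side_sub_used: "side M \<subseteq> used M" by (auto simp: side_def used_def)

text \<open>A vertex on side 2 would put its entire piece there. That piece is not the one of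
  \<open>P\<close>, so \<open>S\<close> meets it, contrary to \<open>S\<close> avoiding side
  2.\<close>

lemma side_empty:
  assumes "hits (used M) S" "S \<inter> side M = {}"
  shows "side M = {}"
proof (rule ccontr)
  assume "side M \<noteq> {}"
  then obtain u where u: "u \<in> C" "col M u = 2" by (auto simp: side_def)
  then obtain i where i: "i < m" "nd i \<in> used M" "pr i \<notin> used M" "col M (nd i) = 2"
    using top_of_cases[of u M] by (auto simp: used_def)
  with assms(1) obtain v where v: "v \<in> S" "v \<in> used M" "top_of (used M) v = nd i"
    by (auto simp: hits_def)
  then have "v \<in> C" by (simp add: used_def)
  have "nd i \<noteq> r" using nd_notin_P[OF i(1)] r_in_P by auto
  then have "col M v = 2" using top_of_cases[OF \<open>v \<in> C\<close> v(2)] v(3) i(4) by auto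
  then show False using v \<open>v \<in> C\<close> assms(2) by (auto simp: side_def)
qed

lemma sgs_side_empty: "side M = {} \<Longrightarrow> sgs M m = 1"
  unfolding sgs_eq[OF le_refl]
proof (intro prod.neutral ballI)
  fix i assume *: "side M = {}" "i \<in> {..<m}"
  then have "nd i \<in> C" "col M (nd i) \<noteq> 2" using nd_in by (auto simp: side_def)
  then show "(if col M (pr i) = 0 \<and> bit M i then - 1 else 1) = (1::int)"
    using * by (auto simp: col_nd)
qed

text \<open>The numbers below \<open>2 ^ m\<close> are those equal to their truncation to
  \<open>m\<close> bits, and this is not affected by flipping one of these bits.\<close>

lemma flip_bit_less: "i < m \<Longrightarrow> M < 2 ^ m \<Longrightarrow> flip_bit i M < (2::nat) ^ m"
  unfolding take_bit_nat_eq_self_iff[symmetric]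
  by (rule bit_eqI) (metis bit_flip_bit_iff bit_take_bit_iff)

text \<open>
  Inclusion--exclusion over the tree components: switching the side of a component that \<open>S\<close> misses
  is a sign reversing involution.
\<close>

lemma sum_colourings:
  "(\<Sum>M<2 ^ m. sgs M m * f (used M) * of_bool (S \<inter> side M = {})) =
    (\<Sum>M\<in>{M. M < 2 ^ m \<and> side M = {} \<and> hits (used M) S}. (f (used M) :: int))"
proof -
  let ?g = "\<lambda>M. sgs M m * f (used M) * of_bool (S \<inter> side M = {})"
  let ?H = "{M. M < 2 ^ m \<and> hits (used M) S}" and ?N = "{M. M < 2 ^ m \<and> \<not> hits (used M) S}"
  have "(\<Sum>M<2 ^ m. ?g M) = sum ?g (?H \<union> ?N)" by (rule sum.cong) auto
  also have "\<dots> = sum ?g ?H + sum ?g ?N" by (rule sum.union_disjoint) auto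
  also have "sum ?g ?N = 0"
  proof (rule sum_involution)
    let ?Q = "\<lambda>A i. i < m \<and> nd i \<in> A \<and> pr i \<notin> A \<and> \<not> (\<exists>u\<in>S \<inter> A. top_of A u = nd i)"
    \<comment> \<open>The least missed piece depends only on the used vertices, which the flip
      preserves. Hence the same index is chosen after the flip, and the map is an
      involution.\<close>
    define I where "I A = (LEAST i. ?Q A i)" for A
    let ?f = "\<lambda>M. flip_bit (I (used M)) M"
    fix M assume "M \<in> ?N"
    then have M: "M < 2 ^ m" "\<not> hits (used M) S" by auto
    then have "\<exists>i. ?Q (used M) i" by (auto simp: hits_def)
    then have "?Q (used M) (I (used M))" unfolding I_def by (rule LeastI_ex)
    then have i: "I (used M) < m" "pr (I (used M)) \<notin> used M"
      and miss: "\<And>u. u \<in> S \<Longrightarrow> u \<in> used M \<Longrightarrow> top_of (used M) u \<noteq> nd (I (used M))" by auto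
    note A = used_flip[OF i]
    show "?f M \<in> ?N" using M A i flip_bit_less by simp
    show "?f (?f M) = M" unfolding A by (rule bit_eqI) (auto simp: bit_flip_bit_iff)
    have "u \<in> side (?f M) \<longleftrightarrow> u \<in> side M" if "u \<in> S" for u
    proof (cases "u \<in> C")
      case True
      then have "col M u \<noteq> 0 \<longleftrightarrow> u \<in> used M" by (simp add: used_def)
      then have "col (?f M) u = col M u" using miss[OF that] col_flip[OF i True] by auto
      then show ?thesis by (simp add: side_def)
    qed (simp add: side_def)
    then have "S \<inter> side (?f M) = S \<inter> side M" by blast
    then show "?g (?f M) = - ?g M" using sgs_flip[OF i] A by simp
  qed
  \<comment> \<open>If \<open>S\<close> meets every piece, avoiding side 2 means that side 2 is
    empty, and then the sign is 1: no negative terms are left.\<close>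
  also have "sum ?g ?H = (\<Sum>M\<in>{M. M < 2 ^ m \<and> side M = {} \<and> hits (used M) S}. f (used M))"
    by (rule sum.mono_neutral_cong_right) (use side_empty sgs_side_empty in auto)
  finally show ?thesis by simp
qed

lemma ex_mask: "\<exists>M<2 ^ y :: nat. \<forall>i<y. bit M i \<longleftrightarrow> g i"
proof (induction y)
  case (Suc y)
  then obtain M :: nat where M: "M < 2 ^ y" "\<forall>i<y. bit M i \<longleftrightarrow> g i" by blast
  have n: "\<not> bit M i" if "i \<ge> y" for i
    using M(1) that by (metis bit_take_bit_iff leD take_bit_nat_eq_self)
  show ?case
  proof (cases "g y")
    case True
    have "set_bit y M < 2 ^ Suc y" using M(1) n[of y] by (simp add: set_bit_eq)
    then show ?thesis using M True by (intro exI[of _ "set_bit y M"]) (auto simp: bit_set_bit_iff less_Suc_eq)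
  next
    case False
    then show ?thesis using M n[of y] by (intro exI[of _ M]) (auto simp: less_Suc_eq)
  qed
qed simp

text \<open>The trace of a vertex cover on \<open>C\<close> satisfies the hypothesis, because the
  tree edges are edges of the graph. So the masks reach every relevant set \<open>A\<close>, with
  all its pieces on side 1.\<close>

lemma ex_colouring:
  assumes A: "P \<subseteq> A" "A \<subseteq> C" and ind: "\<And>i. i < m \<Longrightarrow> pr i \<notin> A \<Longrightarrow> nd i \<in> A"
  shows "\<exists>M<2 ^ m. used M = A \<and> side M = {}"
proof -
  \<comment> \<open>Below a parent in \<open>A\<close> the bit decides whether the vertex is used.
    Below a parent outside \<open>A\<close> the vertex is used anyway, and bit 0 puts it on side
    1.\<close>
  obtain M :: nat where M: "M < 2 ^ m" "\<And>i. i < m \<Longrightarrow> bit M i \<longleftrightarrow> pr i \<in> A \<and> nd i \<in> A"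
    using ex_mask[of m "\<lambda>i. pr i \<in> A \<and> nd i \<in> A"] by auto
  have "col M u = of_bool (u \<in> A)" if "u \<in> C" for u
    using that
  proof (induction u rule: C_induct)
    case (P u)
    then show ?case using A by (auto simp: col_P)
  next
    case (nd y)
    then show ?case using M(2)[of y] ind[of y] by (auto simp: col_nd)
  qed
  then have "used M = A" "side M = {}" using A by (auto simp: used_def side_def)
  with M(1) show ?thesis by blast
qed

text \<open>Within a piece the tree edges give the path. The piece of \<open>P\<close> consists of
  several vertices not joined by recorded tree edges; there the connectivity of the prefix is
  used.\<close>

lemma top_of_linked:
  assumes "P \<subseteq> A" "A \<subseteq> C" "u \<in> C" "u \<in> A"
  shows "top_of A u \<in> A \<and> (top_of A u, u) \<in> (Restr E A)\<^sup>* \<and>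
    (top_of A u = r \<or> (\<exists>i<m. top_of A u = nd i \<and> pr i \<notin> A))"
  using assms(3,4)
proof (induction u rule: C_induct)
  case (P u)
  then have "(r, u) \<in> (Restr E P)\<^sup>*" using conn_P r_in_P unfolding P_def conn_def by blast
  then show ?case using P assms(1) r_in_P rtrancl_Restr_mono by (auto simp: top_of_P)
next
  case (nd y)
  show ?case
  proof (cases "pr y \<in> A")
    case True
    then have "(pr y, nd y) \<in> Restr E A" using pr_nd[OF nd(1)] nd(3) by auto
    then show ?thesis using nd True
      by (auto simp: top_of_nd intro: rtrancl_into_rtrancl)
  next
    case False
    then show ?thesis using nd by (auto simp: top_of_nd)
  qed
qed

end

section \<open>Counting connected vertex covers\<close>

definition is_sol :: "(nat \<times> nat) set \<Rightarrow> nat set \<Rightarrow> nat set \<Rightarrow> nat set \<Rightarrow> bool" where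
  "is_sol E P D X \<longleftrightarrow> P \<subseteq> X \<and> X \<subseteq> D \<and> conn E X \<and> covers E X"

text \<open>The value -1 for the lack of a solution cannot be confused with a weight. The bound is
  strict because it is used with the prefix length added to the budget, and a solution shares the
  root with the prefix.\<close>

definition is_min :: "(nat set \<Rightarrow> bool) \<Rightarrow> (nat \<Rightarrow> nat) \<Rightarrow> nat \<Rightarrow> int \<Rightarrow> bool" where
  "is_min S w k z \<longleftrightarrow>
    (if \<exists>X. S X \<and> card X < k
     then \<exists>X. S X \<and> card X < k \<and> z = int (weight w X) \<and> (\<forall>Y. S Y \<and> card Y < k \<longrightarrow> weight w X \<le> weight w Y)
     else z = -1)"

text \<open>The bound on \<open>B\<close> counts the possible objects: \<open>2 ^ m\<close>
  colourings, \<open>n\<close> lengths of walks, and at most \<open>(n * n) ^ (n - 1)\<close> walks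
  of one length from the root.\<close>

locale cover_search = tree_order +
  fixes D :: "nat set" and w :: "nat \<Rightarrow> nat" and B :: int
  assumes D: "D \<subseteq> {..<n}" and cover_C: "covers E C"
    and B: "int (2 ^ m * (n * (n * n) ^ (n - 1))) < B"
begin

text \<open>
  An exponent encodes a weight and a size, as quotient and remainder of the division by \<open>mz\<close>.  The
  size of a walk counts repeated vertices, so together with \<open>A\<close> and the forced vertices it is only
  below \<open>2 * n + 1\<close>.
\<close>

definition mz :: nat where "mz = 2 * n + 1"

definition cost :: "nat \<Rightarrow> nat" where "cost v = w v * mz + 1"

definition forced :: "nat set \<Rightarrow> nat set" where
  "forced A = {v. v < n \<and> v \<notin> C \<and> (\<exists>u\<in>C - A. (v, u) \<in> E)}"

text \<open>The first condition and \<open>forced\<close> together say that all edges are covered,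
  since \<open>C\<close> is a cover. The last one attaches every forced vertex directly to
  \<open>A\<close>, so the walk has to meet only the pieces of \<open>A\<close>.\<close>

definition good :: "nat set \<Rightarrow> bool" where
  "good A \<longleftrightarrow> (\<forall>u\<in>C - A. \<forall>v\<in>C - A. (u, v) \<notin> E) \<and> A \<subseteq> D \<and> forced A \<subseteq> D \<and>
    (\<forall>v\<in>forced A. \<exists>u\<in>A. (v, u) \<in> E)"

text \<open>The vertices of \<open>A\<close> and the forced ones belong to the solution whether or
  not the walk visits them, so their costs are paid once, in front of the walk sum.\<close>

definition lead :: "nat set \<Rightarrow> int" where
  "lead A = (if good A then \<Prod>v\<in>A \<union> forced A. B ^ cost v else 0)"

text \<open>Vertices already paid for by \<open>lead\<close> may be visited at exponent 0; a further
  vertex outside \<open>C\<close> pays on each visit. The remaining value 0 excludes the vertices of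
  \<open>C - A\<close> and those not allowed by \<open>D\<close>.\<close>

definition leaf :: "nat set \<Rightarrow> nat \<Rightarrow> int" where
  "leaf A v = (if v \<in> A \<union> forced A then 1 else if v \<in> D - C then B ^ cost v else 0)"

definition leaf_of :: "nat \<Rightarrow> nat \<Rightarrow> int" where
  "leaf_of M v = (if v \<in> side M then 0 else leaf (used M) v)"

definition total :: int where
  "total = (\<Sum>M<2 ^ m. sgs M m * lead (used M) * (\<Sum>i<n. walk_sum E (leaf_of M) i r))"

definition free_cost :: "(nat \<Rightarrow> nat) \<Rightarrow> nat set \<Rightarrow> nat \<Rightarrow> nat" where
  "free_cost c A v = (if v \<in> A \<union> forced A then 0 else c v)"

text \<open>The pairs of a colouring and a walk that survive the cancellation. Walks with fewer than
  \<open>n\<close> joins are enough to span any connected vertex set.\<close>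

definition objects :: "(nat \<times> walk) set" where
  "objects = {(M, t). M < 2 ^ m \<and> side M = {} \<and> good (used M) \<and> hits (used M) (nodes t) \<and>
    t \<in> (\<Union>i<n. walks E i r) \<and> nodes t \<subseteq> used M \<union> forced (used M) \<union> (D - C)}"

definition cst :: "nat \<times> walk \<Rightarrow> nat" where
  "cst = (\<lambda>(M, t). (\<Sum>v\<in>used M \<union> forced (used M). cost v) + wsum (free_cost cost (used M)) t)"

lemma C_sub: "C \<subseteq> {..<n}" using l by (simp add: C_def)

lemma finite_E: "finite E" using E_sub finite_subset by fastforce

lemma used_sub_C: "used M \<subseteq> C" by (auto simp: used_def)

lemma P_sub_used: "P \<subseteq> used M" using P_sub_C by (auto simp: used_def col_P)

lemma r_less: "r < n" using r_in_P P_sub_C C_sub by auto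

lemma fin_used: "finite (used M \<union> forced (used M))" "used M \<union> forced (used M) \<subseteq> {..<n}"
  using used_sub_C C_sub by (auto simp: forced_def intro: finite_subset[of _ "{..<n}"])

lemma finite_walks_upto: "finite (\<Union>i<n. walks E i r)"
  using finite_walks[OF finite_E] by auto

lemma leaf_eq:
  "leaf A = (\<lambda>v. if v \<in> A \<union> forced A \<union> (D - C) then B ^ free_cost cost A v else 0)"
  by (auto simp: leaf_def free_cost_def fun_eq_iff)

lemma wprod_leaf:
  "wprod (leaf A) t =
    of_bool (nodes t \<subseteq> A \<union> forced A \<union> (D - C)) * B ^ wsum (free_cost cost A) t"
  unfolding leaf_eq wprod_powers ..

lemma total_eq: "total = (\<Sum>x\<in>objects. B ^ cst x)"
proof -
  let ?W = "\<Union>i<n. walks E i r"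
  have W: "(\<Sum>i<n. walk_sum E e i r) = (\<Sum>t\<in>?W. wprod e t)" for e
    unfolding walk_sum_def
    by (rule sum.UNION_disjoint[symmetric]) (auto simp: finite_walks[OF finite_E], auto simp: walks_def)
  have "total = (\<Sum>M<2 ^ m. \<Sum>t\<in>?W. sgs M m * lead (used M) * wprod (leaf_of M) t)"
    unfolding total_def by (simp add: W sum_distrib_left)
  \<comment> \<open>The order of summation is exchanged because the cancellation takes place for
    each fixed walk, among the colourings.\<close>
  also have "\<dots> = (\<Sum>t\<in>?W. \<Sum>M<2 ^ m. sgs M m * lead (used M) * wprod (leaf_of M) t)"
    by (rule sum.swap)
  also have "\<dots> = (\<Sum>t\<in>?W. \<Sum>M<2 ^ m. sgs M m * (lead (used M) * wprod (leaf (used M)) t) *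
      of_bool (nodes t \<inter> side M = {}))"
    by (intro sum.cong refl)
      (simp add: leaf_of_def[abs_def] wprod_restrict mult_ac)
  also have "\<dots> = (\<Sum>t\<in>?W. \<Sum>M\<in>{M. M < 2 ^ m \<and> side M = {} \<and> hits (used M) (nodes t)}.
      lead (used M) * wprod (leaf (used M)) t)"
    by (intro sum.cong refl sum_colourings)
  also have "\<dots> = (\<Sum>t\<in>?W. \<Sum>M\<in>{M. (M, t) \<in> objects}. B ^ cst (M, t))"
  proof (rule sum.cong[OF refl], rule sum.mono_neutral_cong_right)
    fix t M assume "t \<in> ?W" "M \<in> {M. (M, t) \<in> objects}"
    then have g: "good (used M)" "nodes t \<subseteq> used M \<union> forced (used M) \<union> (D - C)"
      by (auto simp: objects_def)
    have "(\<Prod>v\<in>used M \<union> forced (used M). B ^ cost v) = B ^ (\<Sum>v\<in>used M \<union> forced (used M). cost v)"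
      by (simp add: power_sum)
    then show "lead (used M) * wprod (leaf (used M)) t = B ^ cst (M, t)"
      using g by (simp add: lead_def wprod_leaf cst_def power_add)
  next
    fix t assume "t \<in> ?W"
    then show "\<forall>M\<in>{M. M < 2 ^ m \<and> side M = {} \<and> hits (used M) (nodes t)} - {M. (M, t) \<in> objects}.
        lead (used M) * wprod (leaf (used M)) t = 0"
      by (auto simp: objects_def lead_def wprod_leaf)
  qed (auto simp: objects_def)
  also have "\<dots> = (\<Sum>(t, M)\<in>(SIGMA t:?W. {M. (M, t) \<in> objects}). B ^ cst (M, t))"
  proof (rule sum.Sigma)
    have "{M. (M, t) \<in> objects} \<subseteq> {..<2 ^ m}" for t by (auto simp: objects_def)
    then show "\<forall>t\<in>?W. finite {M. (M, t) \<in> objects}" using finite_subset by blast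
  qed (rule finite_walks_upto)
  also have "\<dots> = (\<Sum>x\<in>objects. B ^ cst x)"
    by (rule sum.reindex_bij_witness[of _ "\<lambda>(M, t). (t, M)" "\<lambda>(t, M). (M, t)"])
      (auto simp: objects_def)
  finally show ?thesis .
qed

lemma objects_sub: "objects \<subseteq> {..<2 ^ m} \<times> (\<Union>i<n. walks E i r)"
  by (auto simp: objects_def)

lemma finite_objects: "finite objects"
  using objects_sub by (rule finite_subset) (use finite_walks_upto in auto)

lemma card_objects: "int (card objects) < B"
proof -
  have "card objects \<le> card ({..<2 ^ m :: nat} \<times> (\<Union>i<n. walks E i r))"
    by (intro card_mono objects_sub) (use finite_walks_upto in auto)
  also have "\<dots> \<le> 2 ^ m * (\<Sum>i<n. card (walks E i r))"
    using card_UN_le[of "{..<n}" "\<lambda>i. walks E i r"] by (simp add: card_cartesian_product)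
  also have "(\<Sum>i<n. card (walks E i r)) \<le> (\<Sum>i<n. (n * n) ^ (n - 1))"
  proof (rule sum_mono)
    fix i assume "i \<in> {..<n}"
    then have "card (walks E i r) \<le> (n * n) ^ i" "1 \<le> n * n" "i \<le> n - 1"
      by (auto intro!: card_walks_le[OF E_sub])
    then show "card (walks E i r) \<le> (n * n) ^ (n - 1)"
      using power_increasing[of i "n - 1" "n * n"] by linarith
  qed
  finally have "card objects \<le> 2 ^ m * (n * (n * n) ^ (n - 1))" by simp
  then have "int (card objects) \<le> int (2 ^ m * (n * (n * n) ^ (n - 1)))" by (rule of_nat_mono)
  with B show ?thesis by linarith
qed

lemma digit_iff: "total div B ^ e mod B \<noteq> 0 \<longleftrightarrow> (\<exists>x\<in>objects. cst x = e)"
  unfolding total_eq sum_powers_digit[OF finite_objects card_objects]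
  using finite_objects by auto

abbreviation sol :: "nat set \<Rightarrow> bool" where "sol \<equiv> is_sol E P D"

text \<open>The solution is read off as \<open>A\<close>, the forced vertices and the vertices of
  the walk. Only inequalities can be expected, as the exponent counts repeated vertices of the walk
  repeatedly.\<close>

lemma object_sol:
  assumes "(M, t) \<in> objects"
  shows "\<exists>X. sol X \<and> weight w X \<le> cst (M, t) div mz \<and> card X \<le> cst (M, t) mod mz"
proof -
  define A where "A = used M"
  define F where "F = forced A"
  have t: "good A" "hits A (nodes t)" "valid E t" "wroot t = r" "wlen t < n" "nodes t \<subseteq> A \<union> F \<union> (D - C)"
    using assms by (auto simp: objects_def walks_def A_def F_def)
  have A: "P \<subseteq> A" "A \<subseteq> C" using P_sub_used used_sub_C by (auto simp: A_def)
  have AF: "finite (A \<union> F)" "A \<union> F \<subseteq> {..<n}" using fin_used[of M] by (simp_all add: A_def F_def)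
  define X where "X = A \<union> F \<union> nodes t"
  have sub: "P \<subseteq> X" "X \<subseteq> D" using A t unfolding X_def good_def F_def by auto
  have node: "(r, u) \<in> (Restr E X)\<^sup>*" if "u \<in> nodes t" for u
    using walk_connected[OF t(3) that sym_E] t(4) rtrancl_Restr_mono[of r u E "nodes t" X]
    by (auto simp: X_def)
  \<comment> \<open>The path from \<open>r\<close> to \<open>u\<close> first follows the walk to a
    vertex \<open>v\<close> in the piece of \<open>u\<close>, then goes inside \<open>A\<close> to
    the representative of this piece and on to \<open>u\<close>.\<close>
  have inA: "(r, u) \<in> (Restr E X)\<^sup>*" if u: "u \<in> A" for u
  proof -
    have C: "u \<in> C" using u A by auto
    note top = top_of_linked[OF A C u]
    have X: "(top_of A u, u) \<in> (Restr E X)\<^sup>*"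
      using top rtrancl_Restr_mono[of _ _ E A X] by (auto simp: X_def)
    show ?thesis
    proof (cases "top_of A u = r")
      case True
      with X show ?thesis by simp
    next
      case False
      then obtain i where i: "i < m" "top_of A u = nd i" "pr i \<notin> A" using top by auto
      then obtain v where v: "v \<in> nodes t" "v \<in> A" "top_of A v = nd i"
        using t(2) top by (auto simp: hits_def)
      have "v \<in> C" using v A by auto
      then have "(top_of A v, v) \<in> (Restr E X)\<^sup>*"
        using top_of_linked[OF A _ v(2)] rtrancl_Restr_mono[of _ _ E A X] by (auto simp: X_def)
      then have "(v, top_of A u) \<in> (Restr E X)\<^sup>*"
        using sym_rtrancl_Restr[OF sym_E] v i by metis
      with node[OF v(1)] X show ?thesis by (meson rtrancl_trans)
    qed
  qed
  have inF: "(r, u) \<in> (Restr E X)\<^sup>*" if u: "u \<in> F" for u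
  proof -
    obtain a where "a \<in> A" "(u, a) \<in> E" using t(1) u by (auto simp: good_def F_def)
    then have "(a, u) \<in> Restr E X" using u symD[OF sym_E] by (auto simp: X_def)
    with inA[OF \<open>a \<in> A\<close>] show ?thesis by (rule rtrancl_into_rtrancl)
  qed
  have "r \<in> X" using r_in_P sub by auto
  then have conn: "conn E X"
    using node inA inF by (auto simp: conn_iff_root[OF sym_E] X_def)
  \<comment> \<open>One end in \<open>C\<close> is enough: if it is missing from \<open>A\<close>,
    the other end is in \<open>A\<close> by independence, or it lies outside \<open>C\<close> and is
    forced.\<close>
  have half: "u \<in> X \<or> v \<in> X" if "(u, v) \<in> E" "u \<in> C" for u v
  proof (cases "u \<in> A")
    case False
    show ?thesis
    proof (cases "v \<in> C")
      case True
      then have "v \<in> A" using t(1) that False by (auto simp: good_def)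
      then show ?thesis by (simp add: X_def)
    next
      case v: False
      then have "v \<in> F" using that False E_sub symD[OF sym_E] by (auto simp: F_def forced_def)
      then show ?thesis by (simp add: X_def)
    qed
  qed (simp add: X_def)
  have cov: "covers E X" unfolding covers_def
  proof clarify
    fix u v assume uv: "(u, v) \<in> E" "v \<notin> X"
    then consider "u \<in> C" | "v \<in> C" using cover_C by (auto simp: covers_def)
    then show "u \<in> X"
      using half[of u v] half[of v u] uv symD[OF sym_E] by cases auto
  qed
  let ?N = "nodes t - (A \<union> F)"
  have X: "X = (A \<union> F) \<union> ?N" "(A \<union> F) \<inter> ?N = {}" by (auto simp: X_def)
  \<comment> \<open>Used both for \<open>w\<close> and for the constant 1, that is, for weight and
    cardinality at once.\<close>
  have split: "(\<Sum>v\<in>A \<union> F. f v) + sum (free_cost f A) (nodes t) = sum f X" for f :: "nat \<Rightarrow> nat"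
  proof -
    have "sum (free_cost f A) (nodes t) = sum f ?N"
      by (rule sum.mono_neutral_cong_right) (auto simp: free_cost_def F_def)
    moreover have "sum f X = (\<Sum>v\<in>A \<union> F. f v) + sum f ?N"
      by (subst X(1), rule sum.union_disjoint) (use AF X in auto)
    ultimately show ?thesis by simp
  qed
  let ?a = "wsum (free_cost w A) t" and ?b = "wsum (free_cost (\<lambda>_. 1) A) t"
  have "free_cost cost A = (\<lambda>v. free_cost w A v * mz + free_cost (\<lambda>_. 1) A v)"
    by (auto simp: free_cost_def cost_def fun_eq_iff)
  then have "wsum (free_cost cost A) t = ?a * mz + ?b" by (simp add: wsum_linear)
  moreover have "(\<Sum>v\<in>A \<union> F. cost v) = (\<Sum>v\<in>A \<union> F. w v) * mz + card (A \<union> F)"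
    by (simp add: cost_def sum_Suc sum_distrib_right)
  ultimately have c: "cst (M, t) = ((\<Sum>v\<in>A \<union> F. w v) + ?a) * mz + (card (A \<union> F) + ?b)"
    by (simp add: cst_def A_def F_def algebra_simps)
  have "card (A \<union> F) \<le> card {..<n}" by (rule card_mono) (use AF in auto)
  moreover have "?b \<le> Suc (wlen t) * 1" by (rule wsum_le) (simp add: free_cost_def)
  \<comment> \<open>At most \<open>n\<close> vertices are prepaid and the walk has at most
    \<open>n\<close> leaves, so the size part is at most \<open>2 * n\<close> and does not spill
    over into the weight part.\<close>
  ultimately have lt: "card (A \<union> F) + ?b < mz" using t(5) by (simp add: mz_def)
  have "0 < mz" by (simp add: mz_def)
  then have dm: "cst (M, t) div mz = (\<Sum>v\<in>A \<union> F. w v) + ?a" "cst (M, t) mod mz = card (A \<union> F) + ?b"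
    unfolding c using lt by (simp_all add: add.commute)
  have "weight w X \<le> cst (M, t) div mz"
    unfolding dm weight_def split[of w, symmetric] by (simp add: sum_nodes_le)
  moreover have "card X \<le> cst (M, t) mod mz"
    unfolding dm card_eq_sum split[of "\<lambda>_. 1", symmetric] by (simp add: sum_nodes_le)
  ultimately show ?thesis using sub conn cov unfolding is_sol_def by blast
qed

text \<open>The mask codes the trace of \<open>X\<close> on \<open>C\<close>, and a spanning walk of
  \<open>X\<close> connects its pieces without repeating vertices. Each vertex is then paid exactly
  once, either in \<open>lead\<close> or in the walk.\<close>

lemma sol_object:
  assumes "sol X"
  shows "\<exists>x\<in>objects. cst x = weight w X * mz + card X"
proof -
  have X: "P \<subseteq> X" "X \<subseteq> D" "conn E X" "covers E X" using assms by (auto simp: is_sol_def)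
  have fin: "finite X" "card X \<le> n"
    using X(2) D finite_subset[of X "{..<n}"] card_mono[of "{..<n}" X] by auto
  define A where "A = X \<inter> C"
  have A: "P \<subseteq> A" "A \<subseteq> C" using X P_sub_C by (auto simp: A_def)
  obtain M where M: "M < 2 ^ m" "used M = A" "side M = {}"
  proof -
    have "nd i \<in> A" if "i < m" "pr i \<notin> A" for i
      using that pr_nd[of i] X(4) nd_in[of i] pr_in_C[of i] by (auto simp: A_def covers_def)
    then show thesis using ex_colouring[OF A] that by blast
  qed
  have r: "r \<in> X" using r_in_P X by auto
  then have "0 < card X" using fin(1) by (auto simp: card_gt_0_iff)
  obtain t where t: "t \<in> walks E (card X - 1) r" "nodes t = X" "\<And>c. wsum c t = sum c X"
    using spanning_walk[OF fin(1) r X(3)] by blast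
  have F: "forced A \<subseteq> X" using X(4) by (auto simp: forced_def A_def covers_def)
  have good: "good A" unfolding good_def
  proof (intro conjI ballI)
    fix v assume v: "v \<in> forced A"
    then have "v \<notin> C" "v \<in> X" using F by (auto simp: forced_def)
    \<comment> \<open>A forced \<open>v\<close> is reached inside \<open>X\<close> over a last edge.
      Since \<open>v\<close> is outside the cover \<open>C\<close>, the other end of this edge is in
      \<open>C\<close>, hence in \<open>A\<close>.\<close>
    then have "(r, v) \<in> (Restr E X)\<^sup>*" "r \<noteq> v" using X(3) r r_in_P P_sub_C by (auto simp: conn_def)
    then obtain y where "(y, v) \<in> E" "y \<in> X" by (auto elim: rtranclE)
    then show "\<exists>u\<in>A. (v, u) \<in> E"
      using \<open>v \<notin> C\<close> cover_C symD[OF sym_E] by (auto simp: covers_def A_def)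
  next
    fix u v assume "u \<in> C - A" "v \<in> C - A"
    then show "(u, v) \<notin> E" using X(4) by (auto simp: A_def covers_def)
  qed (use A F X in \<open>auto simp: A_def\<close>)
  have hits: "hits A (nodes t)"
    unfolding hits_def t(2)
  proof (intro allI impI)
    fix i assume "i < m" "nd i \<in> A" "pr i \<notin> A"
    then show "\<exists>u\<in>X \<inter> A. top_of A u = nd i"
      by (intro bexI[of _ "nd i"]) (auto simp: top_of_nd A_def)
  qed
  have "(M, t) \<in> objects"
    unfolding objects_def using M good hits t X \<open>0 < card X\<close> fin(2)
    by (auto simp: A_def)
  moreover have "cst (M, t) = sum cost X"
  proof -
    have sub: "A \<union> forced A \<subseteq> X" using F by (auto simp: A_def)
    have "sum (free_cost cost A) X = sum cost (X - (A \<union> forced A))"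
      by (rule sum.mono_neutral_cong_right) (use fin in \<open>auto simp: free_cost_def\<close>)
    then show ?thesis
      using sum.subset_diff[OF sub fin(1), of cost] by (simp add: cst_def M(2) t(3))
  qed
  ultimately show ?thesis
    by (intro bexI[of _ "(M, t)"]) (simp_all add: cost_def weight_def sum_Suc sum_distrib_right)
qed

text \<open>Only exponents of actual solutions matter, so the search may stop at a bound for these.\<close>

lemma is_min_digits:
  assumes bd: "(\<Sum>v<n. w v) * mz + mz \<le> bd"
    and Z: "Z = {e. e < bd \<and> total div B ^ e mod B \<noteq> 0 \<and> e mod mz < k}"
    and z: "z = (if Z = {} then -1 else int (Min Z div mz))"
  shows "is_min sol w k z"
proof -
  have fin: "finite Z" unfolding Z by simp
  have in_Z: "weight w X * mz + card X \<in> Z" if "sol X" "card X < k" for X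
  proof -
    have X: "X \<subseteq> {..<n}" using that(1) D by (auto simp: is_sol_def)
    then have "card X \<le> n" using card_mono[of "{..<n}" X] by simp
    then have lt: "card X < mz" by (simp add: mz_def)
    have "weight w X \<le> (\<Sum>v<n. w v)" unfolding weight_def by (rule sum_mono2) (use X in auto)
    then have "weight w X * mz + card X < bd"
      using bd lt mult_le_mono1[of "weight w X" "\<Sum>v<n. w v" mz] by linarith
    then show ?thesis using sol_object[OF that(1)] that(2) lt digit_iff by (auto simp: Z)
  qed
  have of_Z: "\<exists>X. sol X \<and> card X < k \<and> weight w X \<le> e div mz" if "e \<in> Z" for e
  proof -
    have "\<exists>x\<in>objects. cst x = e" "e mod mz < k" using that digit_iff by (auto simp: Z)
    then obtain M t where "(M, t) \<in> objects" "cst (M, t) = e" by auto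
    then show ?thesis using object_sol[of M t] \<open>e mod mz < k\<close> by (meson order_le_less_trans)
  qed
  show ?thesis
  proof (cases "Z = {}")
    case True
    then show ?thesis using in_Z z by (auto simp: is_min_def)
  next
    case False
    then have "Min Z \<in> Z" using fin by simp
    then obtain X where X: "sol X" "card X < k" "weight w X \<le> Min Z div mz" using of_Z by blast
    \<comment> \<open>The weight is the quotient part of the exponent and \<open>div\<close> is
      monotone, so the smallest admissible exponent also has the smallest weight.\<close>
    have le: "Min Z div mz \<le> weight w Y" if "sol Y" "card Y < k" for Y
    proof -
      have "Min Z \<le> weight w Y * mz + card Y" using in_Z[OF that] fin by simp
      then have "Min Z div mz \<le> (weight w Y * mz + card Y) div mz" by (rule div_le_mono)
      moreover have "card Y < mz"
        using card_mono[of "{..<n}" Y] that(1) D by (force simp: is_sol_def mz_def)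
      ultimately show ?thesis by (simp only: div_mult_self3 div_less add_0_right)
    qed
    have "z = int (weight w X)" using z False le[OF X(1,2)] X(3) by simp
    moreover have "weight w X \<le> weight w Y" if "sol Y" "card Y < k" for Y
      using le[OF that] X(3) by simp
    ultimately show ?thesis using X unfolding is_min_def by auto
  qed
qed

end

section \<open>The program\<close>

lemma in_names [simp]:
  "''n'' \<in> names" "''k'' \<in> names" "''weight'' \<in> names" "''adj'' \<in> names" "''found'' \<in> names"
  "''sol'' \<in> names" "''best'' \<in> names" "''target'' \<in> names" "''res'' \<in> names" "''ok'' \<in> names"
  "''r'' \<in> names" "''len'' \<in> names" "''num'' \<in> names" "''j'' \<in> names" "''z'' \<in> names"
  "''ord'' \<in> names" "''lst'' \<in> names" "''par'' \<in> names" "''mark'' \<in> names" "''c'' \<in> names"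
  "''d'' \<in> names" "''two'' \<in> names" "''q'' \<in> names" "''mask'' \<in> names" "''x'' \<in> names"
  "''y'' \<in> names" "''p'' \<in> names" "''a'' \<in> names" "''col'' \<in> names" "''e'' \<in> names"
  "''h0'' \<in> names" "''h1'' \<in> names" "''f'' \<in> names" "''acc'' \<in> names" "''tot'' \<in> names"
  "''pw'' \<in> names" "''bs'' \<in> names" "''mz'' \<in> names" "''ws'' \<in> names" "''lim'' \<in> names"
  "''i'' \<in> names" "''v'' \<in> names" "''u'' \<in> names" "''g'' \<in> names" "''t'' \<in> names" "''o'' \<in> names"
  by (simp_all add: names_def)

text \<open>
  The arrays \<open>c\<close> and \<open>d\<close> hold the current cover and the vertices that a solution may use, \<open>ord\<close> an
  order of the component of the root \<open>r\<close>, \<open>lst\<close> and \<open>par\<close> a spanning tree order of \<open>c\<close> after the first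
  \<open>j\<close> entries of \<open>ord\<close> with the parents, \<open>col\<close> the colours encoded by the bits of \<open>mask\<close>, and \<open>e\<close> the
  weights of the leaves of walks.  Cell \<open>i * n + v\<close> of \<open>f\<close> is for walks from \<open>v\<close> with \<open>i + 1\<close> leaves.  The
  counter of a loop over pairs is divided by \<open>n\<close>.
\<close>

definition init_prog :: program where
  "init_prog =
    (''bs'' ::= Const 1 ;;
     for_loop ''i'' (var ''n'')
       (''bs'' ::= Mul (var ''bs'') (Add (Mul (Const 2) (Mul (var ''n'') (var ''n''))) (Const 1))) ;;
     ''mz'' ::= Add (Mul (Const 2) (var ''n'')) (Const 1) ;;
     ''ws'' ::= Const 0 ;;
     for_loop ''i'' (var ''n'') (''ws'' ::= Add (var ''ws'') (Read ''weight'' (var ''i''))) ;;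
     ''lim'' ::= Add (Mul (var ''ws'') (var ''mz'')) (var ''mz'') ;;
     for_loop ''v'' (var ''n'')
       (Write ''pw'' (var ''v'') (Const 1) ;;
        for_loop ''i'' (Add (Mul (Read ''weight'' (var ''v'')) (var ''mz'')) (Const 1))
          (Write ''pw'' (var ''v'') (Mul (Read ''pw'' (var ''v'')) (var ''bs'')))))"

text \<open>The counter stands for a list position \<open>u\<close> and a candidate
  \<open>v\<close>. A vertex appended while position \<open>u\<close> is processed comes to a later
  position, so a single pass over all pairs is a complete breadth-first search.\<close>

definition grow_step :: program where
  "grow_step =
    (''u'' ::= Div (var ''i'') (var ''n'') ;; ''v'' ::= Mod (var ''i'') (var ''n'') ;;
     Cond (And (Less (var ''u'') (var ''len''))
         (And (Equal (Read ''mark'' (var ''v'')) (Const 0))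
         (And (Equal (Read ''c'' (var ''v'')) (Const 1))
           (Equal (Read ''adj'' (Add (Mul (Read ''lst'' (var ''u'')) (var ''n'')) (var ''v''))) (Const 1)))))
       (Write ''lst'' (var ''len'') (var ''v'') ;;
        Write ''par'' (var ''len'') (Read ''lst'' (var ''u'')) ;;
        Write ''mark'' (var ''v'') (Const 1) ;;
        ''len'' ::= Add (var ''len'') (Const 1))
       Skip)"

definition grow_prog :: program where
  "grow_prog =
    (for_loop ''v'' (var ''n'') (Write ''mark'' (var ''v'') (Const 0)) ;;
     for_loop ''i'' (var ''j'')
       (Write ''lst'' (var ''i'') (Read ''ord'' (var ''i'')) ;;
        Write ''mark'' (Read ''ord'' (var ''i'')) (Const 1)) ;;
     ''len'' ::= var ''j'' ;;
     for_loop ''i'' (Mul (var ''n'') (var ''n'')) grow_step)"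

definition decode_body :: program where
  "decode_body =
      (''v'' ::= Read ''lst'' (Add (var ''j'') (var ''i'')) ;;
        ''a'' ::= Read ''col'' (Read ''par'' (Add (var ''j'') (var ''i''))) ;;
        ''o'' ::= Mod (var ''x'') (Const 2) ;;
        ''x'' ::= Div (var ''x'') (Const 2) ;;
        Cond (Equal (var ''a'') (Const 0))
          (Cond (Equal (var ''o'') (Const 0))
            (Write ''col'' (var ''v'') (Const 1))
            (Write ''col'' (var ''v'') (Const 2) ;; ''p'' ::= Sub (Const 0) (var ''p'')))
          (Cond (Equal (var ''o'') (Const 0))
            (Write ''col'' (var ''v'') (Const 0))
            (Write ''col'' (var ''v'') (var ''a''))))"

definition decode_prog :: program where
  "decode_prog =
    (''p'' ::= Const 1 ;;
     ''x'' ::= var ''mask'' ;;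
     for_loop ''i'' (var ''j'') (Write ''col'' (Read ''lst'' (var ''i'')) (Const 1)) ;;
     for_loop ''i'' (Sub (var ''len'') (var ''j'')) decode_body)"

definition near_prog :: program where
  "near_prog = for_loop ''u'' (var ''n'')
         (Cond (And (Equal (Read ''adj'' (Add (Mul (var ''v'') (var ''n'')) (var ''u''))) (Const 1))
             (Equal (Read ''c'' (var ''u'')) (Const 1)))
           (Cond (Equal (Read ''col'' (var ''u'')) (Const 0)) (''h0'' ::= Const 1) (''h1'' ::= Const 1))
           Skip)"

text \<open>A failure of \<open>good\<close> is recorded as a factor 0 in \<open>p\<close>. For a
  used cover vertex, 2 minus its colour is 1 on side 1 and 0 on the avoided side 2.\<close>

definition judge_prog :: program where
  "judge_prog =
       Cond (Equal (Read ''c'' (var ''v'')) (Const 1))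
         (Cond (Equal (Read ''col'' (var ''v'')) (Const 0))
           (Write ''e'' (var ''v'') (Const 0) ;;
            Cond (Equal (var ''h0'') (Const 1)) (''p'' ::= Const 0) Skip)
           (Write ''e'' (var ''v'') (Sub (Const 2) (Read ''col'' (var ''v''))) ;;
            ''p'' ::= Mul (var ''p'') (Mul (Read ''pw'' (var ''v'')) (Read ''d'' (var ''v'')))))
         (Cond (Equal (var ''h0'') (Const 1))
           (Write ''e'' (var ''v'') (Const 1) ;;
            ''p'' ::= Mul (var ''p'')
              (Mul (Read ''pw'' (var ''v'')) (Mul (Read ''d'' (var ''v'')) (var ''h1''))))
           (Write ''e'' (var ''v'') (Mul (Read ''d'' (var ''v'')) (Read ''pw'' (var ''v'')))))"

definition classify_prog :: program where
  "classify_prog = for_loop ''v'' (var ''n'') (''h0'' ::= Const 0 ;; ''h1'' ::= Const 0 ;; near_prog ;; judge_prog)"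

text \<open>The convolution with one counter for the split and the child. For walks without joins
  the range is empty, so that \<open>acc\<close> keeps the leaf weight with which it starts.\<close>

definition add_prog :: program where
  "add_prog =
        for_loop ''g'' (Mul (var ''n'') (var ''u''))
          (''acc'' ::= Add (var ''acc'')
             (Mul (Mul
               (Read ''adj'' (Add (Mul (var ''v'') (var ''n'')) (Mod (var ''g'') (var ''n''))))
               (Read ''f'' (Add (Mul (Div (var ''g'') (var ''n'')) (var ''n'')) (var ''v''))))
               (Read ''f'' (Add
                 (Mul (Sub (Sub (var ''u'') (Const 1)) (Div (var ''g'') (var ''n''))) (var ''n''))
                 (Mod (var ''g'') (var ''n''))))))"

definition table_body :: program where
  "table_body =
       (''u'' ::= Div (var ''y'') (var ''n'') ;; ''v'' ::= Mod (var ''y'') (var ''n'') ;;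
        Cond (Equal (var ''u'') (Const 0)) (''acc'' ::= Read ''e'' (var ''v'')) (''acc'' ::= Const 0) ;;
        add_prog ;;
        Write ''f'' (var ''y'') (var ''acc''))"

definition count_prog :: program where
  "count_prog =
    (for_loop ''y'' (Mul (var ''n'') (var ''n'')) table_body ;;
     ''tot'' ::= Const 0 ;;
     for_loop ''g'' (var ''n'')
       (''tot'' ::= Add (var ''tot'') (Read ''f'' (Add (Mul (var ''g'') (var ''n'')) (var ''r'')))))"

definition mask_body :: program where
  "mask_body = (decode_prog ;; classify_prog ;; count_prog ;;
        ''q'' ::= Add (var ''q'') (Mul (var ''p'') (var ''tot'')))"

definition masks_prog :: program where
  "masks_prog =
    (''two'' ::= Const 1 ;;
     for_loop ''i'' (Sub (var ''len'') (var ''j'')) (''two'' ::= Mul (var ''two'') (Const 2)) ;;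
     ''q'' ::= Const 0 ;;
     for_loop ''mask'' (var ''two'') mask_body)"

text \<open>Digits are removed from the low end, so the first admissible nonzero digit has the
  smallest exponent; afterwards \<open>res\<close> is no longer negative and is left alone.\<close>

definition scan_prog :: program where
  "scan_prog =
    (''res'' ::= Const (-1) ;;
     for_loop ''i'' (var ''lim'')
       (Cond (And (Less (var ''res'') (Const 0))
           (And (Neg (Equal (Mod (var ''q'') (var ''bs'')) (Const 0)))
             (Less (Mod (var ''i'') (var ''mz'')) (Add (var ''k'') (var ''j'')))))
         (''res'' ::= Div (var ''i'') (var ''mz''))
         Skip ;;
        ''q'' ::= Div (var ''q'') (var ''bs'')))"

definition min_prog :: program where
  "min_prog = (masks_prog ;; scan_prog)"

definition reduce_prog :: program where
  "reduce_prog = for_loop ''z'' (var ''n'')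
          (Write ''d'' (var ''z'') (Const 0) ;;
           min_prog ;;
           Cond (Equal (var ''res'') (var ''target'')) Skip (Write ''d'' (var ''z'') (Const 1)))"

definition compress_prog :: program where
  "compress_prog =
    (grow_prog ;;
     for_loop ''v'' (var ''n'') (Write ''d'' (var ''v'') (Const 1)) ;;
     min_prog ;;
     ''target'' ::= var ''res'' ;;
     Cond (Less (var ''target'') (Const 0))
       (''ok'' ::= Const 0)
       (reduce_prog ;; for_loop ''v'' (var ''n'') (Write ''c'' (var ''v'') (Read ''d'' (var ''v'')))))"

definition reach_prog :: program where
  "reach_prog =
    (Write ''ord'' (Const 0) (var ''r'') ;;
     ''j'' ::= Const 1 ;;
     for_loop ''v'' (var ''n'') (Write ''c'' (var ''v'') (Const 1)) ;;
     grow_prog ;;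
     ''num'' ::= var ''len'' ;;
     for_loop ''i'' (var ''num'') (Write ''ord'' (var ''i'') (Read ''lst'' (var ''i''))) ;;
     for_loop ''v'' (var ''n'') (Write ''c'' (var ''v'') (Read ''mark'' (var ''v''))) ;;
     ''ok'' ::= Const 1 ;;
     for_loop ''i'' (Mul (var ''n'') (var ''n''))
       (Cond (And (Equal (Read ''adj'' (var ''i'')) (Const 1))
           (Equal (Read ''c'' (Div (var ''i'') (var ''n''))) (Const 0)))
         (''ok'' ::= Const 0) Skip))"

definition descend_prog :: program where
  "descend_prog = for_loop ''t'' (var ''num'')
       (Cond (Equal (var ''ok'') (Const 1))
         (''j'' ::= Sub (var ''num'') (var ''t'') ;; compress_prog) Skip)"

definition root_prog :: program where
  "root_prog =
    (reach_prog ;;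
     descend_prog ;;
     Cond (And (Equal (var ''ok'') (Const 1))
         (Neg (And (Equal (var ''found'') (Const 1)) (Neg (Less (var ''target'') (var ''best''))))))
       (''found'' ::= Const 1 ;; ''best'' ::= var ''target'' ;;
        for_loop ''v'' (var ''n'') (Write ''sol'' (var ''v'') (Read ''c'' (var ''v''))))
       Skip)"

definition main_prog :: program where
  "main_prog = (init_prog ;; for_loop ''r'' (var ''n'') root_prog)"

lemmas grow_defs = grow_prog_def grow_step_def

lemmas decode_defs = decode_prog_def decode_body_def

lemmas classify_defs = classify_prog_def near_prog_def judge_prog_def

lemmas count_defs = count_prog_def table_body_def add_prog_def

lemmas min_defs = min_prog_def masks_prog_def mask_body_def scan_prog_def decode_defs classify_defs count_defs

lemmas compress_defs = compress_prog_def reduce_prog_def grow_defs min_defs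

lemmas root_defs = compress_defs reach_prog_def descend_prog_def

text \<open>The grouping of the sum follows the sequence of subprograms, so that
  \<open>wpt_Seq\<close> can split the budget without arithmetic.\<close>

definition mask_time :: "nat \<Rightarrow> nat" where
  "mask_time n = (13 * n + 6) + ((n * (n * 5 + 11) + 2) + ((n * n * (n * n * 3 + 9) + 3 * n + 5) + 1))"

definition reach_time :: "nat \<Rightarrow> nat" where
  "reach_time n = 2 + ((n * 3 + 2) + ((10 * (n * n) + 10 * n + 10) + (1 + ((n * 3 + 2) + ((n * 3 + 2) +
    (1 + (n * n * 4 + 2)))))))"

section \<open>Rules for time-bounded execution\<close>

text \<open>With a step budget as an argument the rules become rewrite rules that subtract from the
  budget, and straight-line code is verified by simplification.\<close>

definition wpt :: "nat \<Rightarrow> program \<Rightarrow> nat \<Rightarrow> (store \<Rightarrow> bool) \<Rightarrow> store \<Rightarrow> bool" where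
  "wpt b P c R s \<longleftrightarrow> wp b P (\<lambda>t s'. t \<le> c \<and> R s') s"

lemma wp_shift:
  "wp b Q (\<lambda>t s'. a + t \<le> c \<and> R s') s \<longleftrightarrow> a \<le> c \<and> wp b Q (\<lambda>t s'. t \<le> c - a \<and> R s') s"
proof -
  have eq: "a + t \<le> c \<longleftrightarrow> a \<le> c \<and> t \<le> c - a" for t by auto
  show ?thesis unfolding wp_def eq by blast
qed

lemma wpt_Skip: "bounded b s \<Longrightarrow> wpt b Skip c R s \<longleftrightarrow> 1 \<le> c \<and> R s"
  by (simp add: wpt_def wp_Skip)

lemma wpt_Write:
  assumes "bounded b s" "x \<in> names" "nat (expr_val s a) < b" "\<bar>expr_val s e\<bar> < 2 ^ b"
  shows "wpt b (Write x a e) c R s \<longleftrightarrow> 1 \<le> c \<and> R (store_upd x (nat (expr_val s a)) (expr_val s e) s)"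
  using assms by (simp add: wpt_def wp_Write bounded_upd)

lemma wpt_Write_Seq:
  assumes "bounded b s" "x \<in> names" "nat (expr_val s a) < b" "\<bar>expr_val s e\<bar> < 2 ^ b"
  shows "wpt b (Write x a e ;; Q) c R s \<longleftrightarrow>
    1 \<le> c \<and> wpt b Q (c - 1) R (store_upd x (nat (expr_val s a)) (expr_val s e) s)"
  using assms by (simp add: wpt_def wp_Seq wp_Write bounded_upd wp_shift[of _ _ 1, simplified])

lemma wpt_Cond:
  "wpt b (Cond t P Q) c R s \<longleftrightarrow>
    1 \<le> c \<and> (if test_val s t then wpt b P (c - 1) R s else wpt b Q (c - 1) R s)"
  using wp_shift[of b P 1 c R s] wp_shift[of b Q 1 c R s] by (simp add: wpt_def wp_Cond)

lemma wpt_Cond_Seq: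
  "wpt b (Cond t P Q ;; S) c R s \<longleftrightarrow>
    1 \<le> c \<and> (if test_val s t then wpt b (P ;; S) (c - 1) R s else wpt b (Q ;; S) (c - 1) R s)"
  using wp_shift[of b "P ;; S" 1 c R s] wp_shift[of b "Q ;; S" 1 c R s]
  by (simp add: wpt_def wp_Cond wp_Seq)

lemma wpt_Skip_Seq: "bounded b s \<Longrightarrow> wpt b (Skip ;; Q) c R s \<longleftrightarrow> 1 \<le> c \<and> wpt b Q (c - 1) R s"
  by (simp add: wpt_def wp_Seq wp_Skip wp_shift[of _ _ 1, simplified])

lemma wpt_Seq_assoc: "wpt b ((P ;; Q) ;; S) c R s \<longleftrightarrow> wpt b (P ;; Q ;; S) c R s"
proof -
  have "wp b (P ;; Q) R = wp b P (\<lambda>t1. wp b Q (\<lambda>t2. R (t1 + t2)))" for P Q R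
    by (rule ext) (rule wp_Seq)
  then show ?thesis by (simp add: wpt_def add.assoc)
qed

lemma wpt_weaken:
  assumes "wpt b P c R s" "c \<le> c'"
    and "\<And>s'. bounded b s' \<Longrightarrow> \<forall>x. x \<notin> writes P \<longrightarrow> s' x = s x \<Longrightarrow> R s' \<Longrightarrow> R' s'"
  shows "wpt b P c' R' s"
  unfolding wpt_def by (rule wp_mono[OF assms(1)[unfolded wpt_def]]) (use assms in auto)

lemma wpt_Seq:
  assumes "wpt b P c1 R1 s" "c1 + c2 \<le> c"
    and "\<And>s'. bounded b s' \<Longrightarrow> \<forall>x. x \<notin> writes P \<longrightarrow> s' x = s x \<Longrightarrow> R1 s' \<Longrightarrow> wpt b Q c2 R s'"
  shows "wpt b (P ;; Q) c R s"
  unfolding wpt_def wp_Seq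
proof (rule wp_mono[OF assms(1)[unfolded wpt_def]])
  fix t1 s1 assume *: "bounded b s1" "\<forall>x. x \<notin> writes P \<longrightarrow> s1 x = s x" "t1 \<le> c1 \<and> R1 s1"
  show "wp b Q (\<lambda>t2 s'. t1 + t2 \<le> c \<and> R s') s1"
    by (rule wp_mono[OF assms(3)[unfolded wpt_def]]) (use * assms(2) in auto)
qed

lemma wpt_for_loop:
  fixes N K :: nat
  assumes "bounded b s" and i: "i \<in> names" "i \<notin> writes P" and "int N < 2 ^ b" and "0 < b"
    and h: "\<And>s'. \<forall>x. x \<notin> insert i (writes P) \<longrightarrow> s' x = s x \<Longrightarrow> expr_val s' h = int N"
    and c: "N * (K + 2) + 2 \<le> c"
    and I0: "I 0 s"
    and upd: "\<And>m s' z. I m s' \<Longrightarrow> I m (store_upd i 0 z s')"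
    and step: "\<And>m s'. m < N \<Longrightarrow> bounded b s' \<Longrightarrow> I m s' \<Longrightarrow> s' i 0 = int m \<Longrightarrow>
      \<forall>x. x \<notin> insert i (writes P) \<longrightarrow> s' x = s x \<Longrightarrow> wpt b P K (I (Suc m)) s'"
  shows "wpt b (for_loop i h P) c (I N) s"
  unfolding wpt_def
  by (rule wp_mono[OF wp_for_loop[where I = I and N = N and K = K]])
    (use assms in \<open>auto simp: wpt_def\<close>)

lemmas wpt_simps = wpt_Skip wpt_Write wpt_Write_Seq wpt_Cond wpt_Cond_Seq wpt_Skip_Seq wpt_Seq_assoc
  bounded_upd store_upd_apply store_upd_other

lemma nat_index [simp]:
  "nat (int a * int c + int d) = a * c + d"
  "nat (int d mod int c) = d mod c"
  "nat (int d div int c) = d div c"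
  "nat (int a * int c + int d mod int c) = a * c + d mod c"
  "nat (int d div int c * int c + int a) = d div c * c + a"
  "nat (int a + int c) = a + c"
  by (simp_all flip: of_nat_mult of_nat_add of_nat_div of_nat_mod)

section \<open>Correctness of the parts\<close>

definition grown :: "(nat \<times> nat) set \<Rightarrow> nat \<Rightarrow> nat list \<Rightarrow> nat set \<Rightarrow> nat list \<Rightarrow> (nat \<Rightarrow> nat) \<Rightarrow> bool" where
  "grown E n p X l pa \<longleftrightarrow> length p \<le> length l \<and> take (length p) l = p \<and> distinct l \<and> set l \<subseteq> {..<n} \<and>
    (\<forall>i. length p \<le> i \<and> i < length l \<longrightarrow> l ! i \<in> X \<and> pa i \<in> set (take i l) \<and> (pa i, l ! i) \<in> E)"

definition holds_list :: "store \<Rightarrow> nat \<Rightarrow> nat list \<Rightarrow> (nat \<Rightarrow> nat) \<Rightarrow> bool" where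
  "holds_list s j l pa \<longleftrightarrow> s ''len'' 0 = int (length l) \<and> (\<forall>i<length l. s ''lst'' i = int (l ! i)) \<and>
    (\<forall>i. j \<le> i \<and> i < length l \<longrightarrow> s ''par'' i = int (pa i))"

definition holds_set :: "nat \<Rightarrow> (nat \<Rightarrow> int) \<Rightarrow> nat set \<Rightarrow> bool" where
  "holds_set n f X \<longleftrightarrow> (\<forall>v<n. f v = of_bool (v \<in> X))"

locale machine =
  fixes E :: "(nat \<times> nat) set" and n k b :: nat and w :: "nat \<Rightarrow> nat"
  assumes E_sub: "E \<subseteq> {..<n} \<times> {..<n}" and sym_E: "sym E" and n_pos: "0 < n"
    and b_index: "n * n + 2 * n + 2 < b"
begin

text \<open>Chosen as an \<open>n\<close>-th power, which a loop can compute, and large enough to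
  exceed the number of objects whenever at most \<open>n\<close> vertices are coloured; see
  \<open>base_greater\<close>.\<close>

definition base :: int where "base = (2 * (int n * int n) + 1) ^ n"
definition wsum_max :: nat where "wsum_max = (\<Sum>v<n. w v)"
text \<open>A strict bound for the exponents of solutions: no solution weighs more than all vertices
  together, and the added modulus makes room for every remainder.\<close>

definition lm :: nat where "lm = wsum_max * (2 * n + 1) + (2 * n + 1)"

definition env :: "store \<Rightarrow> bool" where
  "env s \<longleftrightarrow> s ''n'' 0 = int n \<and> s ''k'' 0 = int k \<and>
    (\<forall>u<n. \<forall>v<n. s ''adj'' (u * n + v) = of_bool ((u, v) \<in> E)) \<and>
    s ''bs'' 0 = base \<and> s ''mz'' 0 = 2 * int n + 1 \<and> s ''lim'' 0 = int lm \<and>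
    (\<forall>v<n. s ''pw'' v = base ^ (w v * (2 * n + 1) + 1))"

lemma env_frame:
  "env s \<Longrightarrow> \<forall>x. x \<notin> X \<longrightarrow> s' x = s x \<Longrightarrow>
    ''n'' \<notin> X \<and> ''k'' \<notin> X \<and> ''adj'' \<notin> X \<and> ''bs'' \<notin> X \<and> ''mz'' \<notin> X \<and> ''lim'' \<notin> X \<and> ''pw'' \<notin> X \<Longrightarrow> env s'"
  by (simp add: env_def)

lemma small: "x \<le> n * n + 2 * n + 2 \<Longrightarrow> int x < 2 ^ b"
  using b_index by (meson less_exp of_nat_less_numeral_power_cancel_iff order_le_less_trans order_less_trans)

lemma index: "x \<le> n * n + 2 * n + 2 \<Longrightarrow> x < b"
  using b_index by simp

lemma b_pos: "0 < b" using b_index by simp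

lemma two_less: "2 < (2::int) ^ b" "1 < (2::int) ^ b"
  using small[of 2] small[of 1] by simp_all

lemma n_le: "n \<le> n * n" using n_pos by simp

lemma distinct_length: "distinct l \<Longrightarrow> set l \<subseteq> {..<n} \<Longrightarrow> length l \<le> n"
  using card_mono[of "{..<n}" "set l"] by (simp add: distinct_card)

lemma wpt_grow:
  assumes s: "bounded b s" "env s" and p: "s ''j'' 0 = int (length p)" "distinct p" "set p \<subseteq> {..<n}"
    "\<And>i. i < length p \<Longrightarrow> s ''ord'' i = int (p ! i)" and X: "holds_set n (s ''c'') X"
  shows "wpt b grow_prog (10 * (n * n) + 10 * n + 10) (\<lambda>s'. \<exists>l pa. grown E n p X l pa \<and>
    holds_list s' (length p) l pa \<and> holds_set n (s' ''mark'') (set l) \<and>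
    (\<forall>u\<in>set l. \<forall>v\<in>X. (u, v) \<in> E \<longrightarrow> v \<in> set l)) s"
proof -
  have lp: "length p \<le> n" using p distinct_length by simp
  have n: "s ''n'' 0 = int n" using s by (simp add: env_def)
  have pn: "p ! i < n" if "i < length p" for i using p(3) nth_mem[OF that] by blast
  show ?thesis
    unfolding grow_prog_def
  proof (rule wpt_Seq[where ?c1.0 = "n * 3 + 2" and ?c2.0 = "n * 4 + 2 + (1 + (n * n * 9 + 2))" and
      ?R1.0 = "\<lambda>s'. \<forall>v<n. s' ''mark'' v = 0"])
    show "wpt b (for_loop ''v'' (var ''n'') (Write ''mark'' (var ''v'') (Const 0))) (n * 3 + 2)
        (\<lambda>s'. \<forall>v<n. s' ''mark'' v = 0) s"
      by (rule wpt_for_loop[where N = n and K = 1 and I = "\<lambda>m s'. \<forall>v<m. s' ''mark'' v = 0"])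
        (use s n b_pos small[of n] two_less in \<open>auto simp: wpt_simps index less_Suc_eq\<close>)
    fix s1 assume s1: "bounded b s1"
      "\<forall>x. x \<notin> writes (for_loop ''v'' (var ''n'') (Write ''mark'' (var ''v'') (Const 0))) \<longrightarrow> s1 x = s x"
      "\<forall>v<n. s1 ''mark'' v = 0"
    let ?I2 = "\<lambda>m s'. (\<forall>i<m. s' ''lst'' i = int (p ! i)) \<and> holds_set n (s' ''mark'') (set (take m p))"
    show "wpt b (for_loop ''i'' (var ''j'')
       (Write ''lst'' (var ''i'') (Read ''ord'' (var ''i'')) ;;
        Write ''mark'' (Read ''ord'' (var ''i'')) (Const 1)) ;;
     ''len'' ::= var ''j'' ;;
     for_loop ''i'' (Mul (var ''n'') (var ''n''))
       grow_step)
     (n * 4 + 2 + (1 + (n * n * 9 + 2))) (\<lambda>s'. \<exists>l pa. grown E n p X l pa \<and>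
      holds_list s' (length p) l pa \<and> holds_set n (s' ''mark'') (set l) \<and>
      (\<forall>u\<in>set l. \<forall>v\<in>X. (u, v) \<in> E \<longrightarrow> v \<in> set l)) s1"
    proof (rule wpt_Seq[where ?c1.0 = "n * 4 + 2" and ?c2.0 = "1 + (n * n * 9 + 2)" and
        ?R1.0 = "?I2 (length p)"])
      show "wpt b (for_loop ''i'' (var ''j'')
       (Write ''lst'' (var ''i'') (Read ''ord'' (var ''i'')) ;;
        Write ''mark'' (Read ''ord'' (var ''i'')) (Const 1))) (n * 4 + 2) (?I2 (length p)) s1"
      proof (rule wpt_for_loop[where N = "length p" and K = 2 and I = ?I2])
        fix m s' assume m: "m < length p" and s': "bounded b s'" "?I2 m s'" "s' ''i'' 0 = int m"
          and "\<forall>x. x \<notin> insert ''i'' (writes (Write ''lst'' (var ''i'') (Read ''ord'' (var ''i'')) ;;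
            Write ''mark'' (Read ''ord'' (var ''i'')) (Const 1))) \<longrightarrow> s' x = s1 x"
        then have "s' ''ord'' m = int (p ! m)" using s1(2) p(4) by simp
        moreover have "int (p ! m) < 2 ^ b" "p ! m < b" "m < b"
          using pn[OF m] m lp n_le small[of "p ! m"] index[of "p ! m"] index[of m] by auto
        ultimately show "wpt b (Write ''lst'' (var ''i'') (Read ''ord'' (var ''i'')) ;;
            Write ''mark'' (Read ''ord'' (var ''i'')) (Const 1)) 2 (?I2 (Suc m)) s'"
          using s' m two_less
          by (auto simp: wpt_simps less_Suc_eq holds_set_def take_Suc_conv_app_nth)
      qed (use s1 lp p b_pos small[of "length p"] n_le in \<open>auto simp: store_upd_apply store_upd_other holds_set_def\<close>)
      fix s2 assume s2: "bounded b s2" "?I2 (length p) s2"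
        "\<forall>x. x \<notin> writes (for_loop ''i'' (var ''j'')
          (Write ''lst'' (var ''i'') (Read ''ord'' (var ''i'')) ;;
            Write ''mark'' (Read ''ord'' (var ''i'')) (Const 1))) \<longrightarrow> s2 x = s1 x"
      have j: "s2 ''j'' 0 = int (length p)" "s2 ''n'' 0 = int n" using s1(2) s2(3) p(1) n by auto
      have lb: "int (length p) < 2 ^ b" using lp by (intro small) simp
      define s3 where "s3 = store_upd ''len'' 0 (int (length p)) s2"
      have s3: "bounded b s3" unfolding s3_def by (rule bounded_upd) (use s2(1) lb b_pos in simp_all)
      have X3: "holds_set n (s3 ''c'') X" using X s1(2) s2(3) by (simp add: s3_def store_upd_apply store_upd_other)
      have env3: "env s3"
      proof -
        have "env s1" by (rule env_frame[OF s(2) s1(2)]) simp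
        then have "env s2" by (rule env_frame[OF _ s2(3)]) simp
        then show ?thesis by (simp add: s3_def env_def store_upd_apply store_upd_other)
      qed
      \<comment> \<open>All pairs with a number below \<open>q\<close> are settled. At
        \<open>q = n * n\<close> this includes every list position, so the list is closed under
        neighbours in \<open>X\<close>.\<close>
      let ?J = "\<lambda>q l. \<forall>h v. h * n + v < q \<longrightarrow> h < length l \<longrightarrow> v < n \<longrightarrow> v \<in> X \<longrightarrow> (l ! h, v) \<in> E \<longrightarrow> v \<in> set l"
      let ?I = "\<lambda>q s'. \<exists>l pa. grown E n p X l pa \<and> holds_list s' (length p) l pa \<and>
        holds_set n (s' ''mark'') (set l) \<and> ?J q l"
      have "wpt b (for_loop ''i'' (Mul (var ''n'') (var ''n'')) grow_step) (n * n * 9 + 2) (?I (n * n)) s3"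
      proof (rule wpt_for_loop[where I = ?I and N = "n * n" and K = 7])
        show "?I 0 s3"
          using s2(2) p lp by (intro exI[of _ p] exI[of _ "\<lambda>_. 0"]) (auto simp: grown_def holds_list_def s3_def store_upd_apply store_upd_other)
        fix q s' assume q: "q < n * n" and s': "bounded b s'" "?I q s'" "s' ''i'' 0 = int q"
          and fr: "\<forall>x. x \<notin> insert ''i'' (writes grow_step) \<longrightarrow> s' x = s3 x"
        obtain l pa where I: "grown E n p X l pa" "holds_list s' (length p) l pa"
          "holds_set n (s' ''mark'') (set l)" "?J q l" using s'(2) by blast
        have ln: "length l \<le> n" using I(1) distinct_length by (simp add: grown_def)
        have env': "env s'" by (rule env_frame[OF env3 fr]) (simp add: grow_step_def)
        have n': "s' ''n'' 0 = int n" using env' by (simp add: env_def)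
        have v: "q mod n < n" "q div n < n" using n_pos q by (auto simp: less_mult_imp_div_less)
        have X': "holds_set n (s' ''c'') X" using X3 fr by (simp add: grow_step_def)
        have bd: "\<bar>int q div int n\<bar> < 2 ^ b" "\<bar>int q mod int n\<bar> < 2 ^ b" "length l < b" "int (length l) + 1 < 2 ^ b"
          using small[of "q div n"] small[of "q mod n"] small[of "Suc (length l)"] index[of "length l"] v n_le ln
          by (auto simp flip: of_nat_div of_nat_mod)
        have vb: "q mod n < b" by (rule index) (use v(1) in linarith)
        let ?u = "q div n" and ?v = "q mod n"
        let ?c = "?u < length l \<and> ?v \<notin> set l \<and> ?v \<in> X \<and> (l ! ?u, ?v) \<in> E"
        have q_eq: "h = ?u \<and> v = ?v" if "h * n + v = q" "v < n" for h v using that by auto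
        have ln2: "l ! i < n" if "i < length l" for i
          using I(1) nth_mem[OF that] unfolding grown_def by blast
        have test: "?u < length l \<Longrightarrow> s' ''adj'' (nat (s' ''lst'' ?u * int n + int q mod int n)) = of_bool ((l ! ?u, ?v) \<in> E)"
        proof -
          assume u: "?u < length l"
          then have "l ! ?u < n" by (rule ln2)
          then show ?thesis using u I(2) env' v by (simp add: holds_list_def env_def)
        qed
        show "wpt b grow_step 7 (?I (Suc q)) s'"
        proof (cases ?c)
          case True
          have lu: "int (l ! ?u) < 2 ^ b" using ln2[of ?u] True by (intro small) linarith
          let ?l = "l @ [?v]" and ?pa = "pa(length l := l ! ?u)"
          have g: "grown E n p X ?l ?pa"
            using I(1) True v by (auto simp: grown_def nth_append less_Suc_eq)
          have J: "?J (Suc q) ?l"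
          proof (intro allI impI)
            fix h v assume *: "h * n + v < Suc q" "h < length ?l" "v < n" "v \<in> X" "(?l ! h, v) \<in> E"
            show "v \<in> set ?l"
            \<comment> \<open>The position of the new entry lies beyond the row \<open>?u\<close>
              being processed, so none of its pairs has been passed yet.\<close>
            proof (cases "h = length l")
              case True
              then have "(?u + 1) * n \<le> h * n" using \<open>?c\<close> by (intro mult_le_mono1) simp
              moreover have "?u * n + ?v = q" by simp
              ultimately have "q < h * n" using v(1) unfolding add_mult_distrib by linarith
              then show ?thesis using *(1) by simp
            next
              case False
              then have "h < length l" using * by simp
              then show ?thesis using * I(4)[rule_format, of h v] q_eq[of h v]
                by (cases "h * n + v = q") (simp_all add: nth_append)
            qed
          qed
          let ?s = "\<lambda>s'. holds_list s' (length p) ?l ?pa \<and> holds_set n (s' ''mark'') (set ?l)"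
          have "wpt b grow_step 7 ?s s'"
            using True s'(1,3) bd vb lu n' I(2,3) X' v b_pos test two_less
            by (auto simp: grow_step_def wpt_simps holds_list_def holds_set_def nth_append less_Suc_eq
                simp flip: of_nat_div of_nat_mod)
          then show ?thesis by (rule wpt_weaken) (use g J in blast)+
        next
          case False
          have J: "?J (Suc q) l"
          proof (intro allI impI)
            fix h v assume "h * n + v < Suc q" "h < length l" "v < n" "v \<in> X" "(l ! h, v) \<in> E"
            then show "v \<in> set l"
              using I(4)[rule_format, of h v] q_eq[of h v] False by (cases "h * n + v = q") simp_all
          qed
          let ?s = "\<lambda>s'. holds_list s' (length p) l pa \<and> holds_set n (s' ''mark'') (set l)"
          have "wpt b grow_step 7 ?s s'"
            using False s'(1,3) bd vb n' I(2,3) X' v b_pos test two_less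
            by (auto simp: grow_step_def wpt_simps holds_list_def holds_set_def simp flip: of_nat_div of_nat_mod)
          then show ?thesis by (rule wpt_weaken) (use I(1) J in blast)+
        qed
      qed (use s3 n n_pos b_pos j small[of "n * n"] in \<open>auto simp: grow_step_def s3_def store_upd_apply store_upd_other holds_list_def\<close>)
      then have "wpt b (for_loop ''i'' (Mul (var ''n'') (var ''n'')) grow_step) (n * n * 9 + 2)
        (\<lambda>s'. \<exists>l pa. grown E n p X l pa \<and> holds_list s' (length p) l pa \<and> holds_set n (s' ''mark'') (set l) \<and>
          (\<forall>u\<in>set l. \<forall>v\<in>X. (u, v) \<in> E \<longrightarrow> v \<in> set l)) s3"
      proof (rule wpt_weaken)
        fix s' assume "?I (n * n) s'"
        then obtain l pa where I: "grown E n p X l pa" "holds_list s' (length p) l pa"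
          "holds_set n (s' ''mark'') (set l)" "?J (n * n) l" by blast
        have ln: "length l \<le> n" using I(1) distinct_length by (simp add: grown_def)
        have "v \<in> set l" if "u \<in> set l" "v \<in> X" "(u, v) \<in> E" for u v
        proof -
          obtain h where h: "h < length l" "l ! h = u" using \<open>u \<in> set l\<close> by (auto simp: in_set_conv_nth)
          have v: "v < n" using that E_sub by auto
          have "h * n + v < (h + 1) * n" using v by simp
          also have "\<dots> \<le> n * n" using h ln by (intro mult_le_mono1) simp
          finally show ?thesis using I(4) h that v by blast
        qed
        with I show "\<exists>l pa. grown E n p X l pa \<and> holds_list s' (length p) l pa \<and>
          holds_set n (s' ''mark'') (set l) \<and> (\<forall>u\<in>set l. \<forall>v\<in>X. (u, v) \<in> E \<longrightarrow> v \<in> set l)" by blast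
      qed simp
      then show "wpt b (''len'' ::= var ''j'' ;; for_loop ''i'' (Mul (var ''n'') (var ''n'')) grow_step)
        (1 + (n * n * 9 + 2)) (\<lambda>s'. \<exists>l pa. grown E n p X l pa \<and> holds_list s' (length p) l pa \<and>
          holds_set n (s' ''mark'') (set l) \<and> (\<forall>u\<in>set l. \<forall>v\<in>X. (u, v) \<in> E \<longrightarrow> v \<in> set l)) s2"
        using s2(1) j lb b_pos by (simp add: wpt_simps s3_def)
    qed simp
  qed simp
qed

end

text \<open>\<open>peak\<close> bounds a single power of the base. The product in
  \<open>b_big\<close> bounds the sum over all masks: \<open>2 ^ n\<close> masks, a leading product
  of at most \<open>n\<close> powers, \<open>n\<close> walk lengths, and the estimate
  \<open>walk_sum_le\<close> with its exponents rounded up to \<open>n\<close> and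
  \<open>n + 1\<close>.\<close>

locale big_machine = machine +
  fixes peak :: int
  assumes k_le: "k \<le> n"
    and peak: "peak = base ^ (wsum_max * (2 * n + 1) + 1)"
    and b_lm: "int lm < 2 ^ b"
    and b_big: "2 ^ n * peak ^ n * (int n * (int (n * n) ^ n * peak ^ (n + 1))) < 2 ^ b"
begin

section \<open>Magnitudes of the intermediate numbers\<close>

lemma base_ge: "1 \<le> base"
  by (simp add: base_def)

lemma base_power_le: "t \<le> wsum_max * (2 * n + 1) + 1 \<Longrightarrow> base ^ t \<le> peak"
  unfolding peak using base_ge by (rule power_increasing[rotated])

lemma peak_ge: "1 \<le> peak"
  using base_power_le[of 0] by simp

lemma w_le: "v < n \<Longrightarrow> w v \<le> wsum_max"
  unfolding wsum_max_def by (rule member_le_sum) auto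

lemma pw_le: "v < n \<Longrightarrow> base ^ (w v * (2 * n + 1) + 1) \<le> peak"
  by (intro base_power_le add_right_mono mult_le_mono1 w_le)

lemma walk_bound_ge: "1 \<le> int (n * n) ^ n * peak ^ (n + 1)"
proof -
  have "1 \<le> int (n * n)" using n_pos by (metis One_nat_def Suc_leI nat_0_less_mult_iff of_nat_1 of_nat_mono)
  then have "1 \<le> int (n * n) ^ n" by (rule one_le_power)
  moreover have "1 \<le> peak ^ (n + 1)" by (rule one_le_power[OF peak_ge])
  ultimately have "1 * 1 \<le> int (n * n) ^ n * peak ^ (n + 1)" by (intro mult_mono) linarith+
  then show ?thesis by simp
qed

lemma bounds:
  "2 ^ n < (2::int) ^ b" "peak ^ n < 2 ^ b" "peak < 2 ^ b"
  "int n * (int (n * n) ^ n * peak ^ (n + 1)) < 2 ^ b"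
  "int (n * n) ^ n * peak ^ (n + 1) < 2 ^ b"
proof -
  have le: "x \<le> x * y \<and> y \<le> x * y" if "1 \<le> x" "1 \<le> y" for x y :: int
    using that mult_left_mono[of 1 y x] mult_right_mono[of 1 x y] by simp
  let ?W = "int (n * n) ^ n * peak ^ (n + 1)"
  have p: "1 \<le> peak ^ n" using peak_ge by (rule one_le_power)
  have t: "1 \<le> (2::int) ^ n" by simp
  have W: "1 \<le> int n * ?W" using le[of "int n" ?W] walk_bound_ge n_pos by linarith
  have 1: "1 \<le> 2 ^ n * peak ^ n" using le[OF t p] t by linarith
  note 2 = le[OF t p] le[OF 1 W] le[of "int n" ?W] walk_bound_ge b_big
  show "2 ^ n < (2::int) ^ b" "peak ^ n < 2 ^ b" using 2 by linarith+
  show "int n * ?W < 2 ^ b" "?W < 2 ^ b" using 2 n_pos by linarith+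
  have "peak ^ 1 \<le> peak ^ n" using peak_ge n_pos by (intro power_increasing) auto
  then show "peak < 2 ^ b" using \<open>peak ^ n < 2 ^ b\<close> by simp
qed

lemma lm_split: "wsum_max \<le> lm" "wsum_max * (2 * n + 1) + 1 \<le> lm"
proof -
  have "wsum_max * 1 \<le> wsum_max * (2 * n + 1)" by (intro mult_le_mono2) simp
  then show "wsum_max \<le> lm" unfolding lm_def by linarith
qed (simp add: lm_def)

lemma wpt_init_bs:
  assumes s: "bounded b s" "s ''n'' 0 = int n"
  shows "wpt b (''bs'' ::= Const 1 ;; for_loop ''i'' (var ''n'')
       (''bs'' ::= Mul (var ''bs'') (Add (Mul (Const 2) (Mul (var ''n'') (var ''n''))) (Const 1))))
    (n * 3 + 3) (\<lambda>s'. s' ''bs'' 0 = base) s"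
proof -
  let ?x = "2 * (int n * int n) + 1 :: int"
  define s1 where "s1 = store_upd ''bs'' 0 1 s"
  have s1: "bounded b s1" unfolding s1_def by (rule bounded_upd) (use s b_pos two_less in simp_all)
  have "wpt b (for_loop ''i'' (var ''n'')
       (''bs'' ::= Mul (var ''bs'') (Add (Mul (Const 2) (Mul (var ''n'') (var ''n''))) (Const 1))))
    (n * 3 + 2) (\<lambda>s'. s' ''bs'' 0 = ?x ^ n) s1"
  proof (rule wpt_for_loop[where N = n and K = 1 and I = "\<lambda>m s'. s' ''bs'' 0 = ?x ^ m"])
    fix m s' assume m: "m < n" "bounded b s'" "s' ''bs'' 0 = ?x ^ m" "s' ''i'' 0 = int m"
      and fr: "\<forall>x. x \<notin> insert ''i'' (writes (''bs'' ::= Mul (var ''bs'') (Add (Mul (Const 2) (Mul (var ''n'') (var ''n''))) (Const 1)))) \<longrightarrow> s' x = s1 x"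
    have n: "s' ''n'' 0 = int n" using fr s by (simp add: s1_def store_upd_other)
    have x: "1 \<le> ?x" by simp
    have "?x ^ Suc m \<le> ?x ^ n" using m(1) x by (intro power_increasing) auto
    also have "\<dots> \<le> peak" using base_power_le[of 1] by (simp add: base_def)
    finally have "?x ^ Suc m < 2 ^ b" using bounds(3) by linarith
    moreover have "0 \<le> ?x ^ Suc m" by simp
    ultimately have "\<bar>?x ^ m * ?x\<bar> < 2 ^ b" by (simp only: power_Suc2 abs_of_nonneg)
    then show "wpt b (''bs'' ::= Mul (var ''bs'') (Add (Mul (Const 2) (Mul (var ''n'') (var ''n''))) (Const 1))) 1
      (\<lambda>s'. s' ''bs'' 0 = ?x ^ Suc m) s'"
      using m n b_pos by (simp add: wpt_simps mult.commute)
  qed (use s s1 b_pos small[of n] in \<open>auto simp: s1_def store_upd_apply store_upd_other\<close>)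
  then show ?thesis using s b_pos two_less by (simp add: wpt_simps s1_def base_def)
qed

lemma wpt_init_ws:
  assumes s: "bounded b s" "s ''n'' 0 = int n" "\<And>v. v < n \<Longrightarrow> s ''weight'' v = int (w v)"
  shows "wpt b (for_loop ''i'' (var ''n'') (''ws'' ::= Add (var ''ws'') (Read ''weight'' (var ''i''))))
    (n * 3 + 2) (\<lambda>s'. s' ''ws'' 0 = int wsum_max) (store_upd ''ws'' 0 0 s)"
  unfolding wsum_max_def
proof (rule wpt_for_loop[where N = n and K = 1 and I = "\<lambda>m s'. s' ''ws'' 0 = int (\<Sum>v<m. w v)"])
  show "bounded b (store_upd ''ws'' 0 0 s)" by (rule bounded_upd) (use s b_pos in simp_all)
  fix m s' assume m: "m < n" "bounded b s'" "s' ''ws'' 0 = int (\<Sum>v<m. w v)" "s' ''i'' 0 = int m"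
    and fr: "\<forall>x. x \<notin> insert ''i'' (writes (''ws'' ::= Add (var ''ws'') (Read ''weight'' (var ''i'')))) \<longrightarrow>
      s' x = store_upd ''ws'' 0 0 s x"
  have wm: "s' ''weight'' m = int (w m)" using fr s(3)[OF m(1)] by (simp add: store_upd_other)
  have "(\<Sum>v<Suc m. w v) \<le> wsum_max" unfolding wsum_max_def using m(1) by (intro sum_mono2) auto
  then have "int (\<Sum>v<Suc m. w v) < 2 ^ b" using lm_split(1) b_lm by linarith
  then have "\<bar>int (\<Sum>v<m. w v) + int (w m)\<bar> < 2 ^ b"
    by (simp only: sum.lessThan_Suc abs_of_nat flip: of_nat_add)
  then show "wpt b (''ws'' ::= Add (var ''ws'') (Read ''weight'' (var ''i''))) 1
      (\<lambda>s'. s' ''ws'' 0 = int (\<Sum>v<Suc m. w v)) s'"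
    using m(2,3,4) wm b_pos by (simp add: wpt_simps)
qed (use s b_pos small[of n] in \<open>auto simp: store_upd_apply store_upd_other\<close>)

lemma wpt_init_pw:
  assumes s: "bounded b s" "s ''n'' 0 = int n" "\<And>v. v < n \<Longrightarrow> s ''weight'' v = int (w v)"
    "s ''bs'' 0 = base" "s ''mz'' 0 = 2 * int n + 1"
  shows "wpt b (for_loop ''v'' (var ''n'')
       (Write ''pw'' (var ''v'') (Const 1) ;;
        for_loop ''i'' (Add (Mul (Read ''weight'' (var ''v'')) (var ''mz'')) (Const 1))
          (Write ''pw'' (var ''v'') (Mul (Read ''pw'' (var ''v'')) (var ''bs'')))))
    (n * (lm * 3 + 5) + 2) (\<lambda>s'. \<forall>v<n. s' ''pw'' v = base ^ (w v * (2 * n + 1) + 1)) s"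
proof (rule wpt_for_loop[where N = n and K = "lm * 3 + 3" and
      I = "\<lambda>m s'. \<forall>v<m. s' ''pw'' v = base ^ (w v * (2 * n + 1) + 1)"])
  let ?L = "Write ''pw'' (var ''v'') (Mul (Read ''pw'' (var ''v'')) (var ''bs''))"
  fix m s' assume m: "m < n" "bounded b s'" "\<forall>v<m. s' ''pw'' v = base ^ (w v * (2 * n + 1) + 1)"
      "s' ''v'' 0 = int m"
    and fr: "\<forall>x. x \<notin> insert ''v'' (writes (Write ''pw'' (var ''v'') (Const 1) ;;
        for_loop ''i'' (Add (Mul (Read ''weight'' (var ''v'')) (var ''mz'')) (Const 1)) ?L)) \<longrightarrow> s' x = s x"
  define s1 where "s1 = store_upd ''pw'' m 1 s'"
  have mb: "m < b" by (rule index) (use m(1) in linarith)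
  have s1: "bounded b s1" unfolding s1_def by (rule bounded_upd) (use m(2) mb two_less in simp_all)
  let ?c = "w m * (2 * n + 1) + 1"
  have c: "?c \<le> wsum_max * (2 * n + 1) + 1" by (intro add_right_mono mult_le_mono1 w_le m(1))
  then have c': "?c \<le> lm" using lm_split(2) by linarith
  let ?I = "\<lambda>t s''. s'' ''pw'' m = base ^ t \<and> (\<forall>v<m. s'' ''pw'' v = base ^ (w v * (2 * n + 1) + 1))"
  have "wpt b (for_loop ''i'' (Add (Mul (Read ''weight'' (var ''v'')) (var ''mz'')) (Const 1)) ?L)
      (lm * 3 + 2) (?I ?c) s1"
  proof (rule wpt_for_loop[where N = ?c and K = 1 and I = ?I])
    show "int ?c < 2 ^ b" using c' b_lm by linarith
    show "?c * (1 + 2) + 2 \<le> lm * 3 + 2" using mult_le_mono1[OF c', of 3] by (simp add: algebra_simps)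
    fix t s'' assume t: "t < ?c" "bounded b s''" "?I t s''" "s'' ''i'' 0 = int t"
      and fr2: "\<forall>x. x \<notin> insert ''i'' (writes ?L) \<longrightarrow> s'' x = s1 x"
    have v: "s'' ''v'' 0 = int m" "s'' ''bs'' 0 = base"
      using fr2 fr m(4) s(4) by (simp_all add: s1_def store_upd_other)
    have "base ^ Suc t \<le> peak" using t(1) c by (intro base_power_le) linarith
    then have "base ^ Suc t < 2 ^ b" using bounds(3) by linarith
    moreover have "0 \<le> base ^ Suc t" using base_ge by simp
    ultimately have "\<bar>base ^ t * base\<bar> < 2 ^ b" by (simp only: power_Suc2 abs_of_nonneg)
    then show "wpt b ?L 1 (?I (Suc t)) s''"
      using t(2,3) v mb by (simp add: wpt_simps mult.commute)
  next
    fix s'' assume fr2: "\<forall>x. x \<notin> insert ''i'' (writes ?L) \<longrightarrow> s'' x = s1 x"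
    show "expr_val s'' (Add (Mul (Read ''weight'' (var ''v'')) (var ''mz'')) (Const 1)) = int ?c"
      using fr2 fr m(1,4) s(3)[OF m(1)] s(5) by (simp add: s1_def store_upd_other algebra_simps)
  qed (use m s1 b_pos in \<open>auto simp: s1_def store_upd_apply store_upd_other\<close>)
  then have "wpt b (for_loop ''i'' (Add (Mul (Read ''weight'' (var ''v'')) (var ''mz'')) (Const 1)) ?L)
      (lm * 3 + 2) (\<lambda>s'. \<forall>v<Suc m. s' ''pw'' v = base ^ (w v * (2 * n + 1) + 1)) s1"
    by (rule wpt_weaken) (auto simp: less_Suc_eq)
  then show "wpt b (Write ''pw'' (var ''v'') (Const 1) ;;
        for_loop ''i'' (Add (Mul (Read ''weight'' (var ''v'')) (var ''mz'')) (Const 1)) ?L) (lm * 3 + 3)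
      (\<lambda>s'. \<forall>v<Suc m. s' ''pw'' v = base ^ (w v * (2 * n + 1) + 1)) s'"
    using m(2,4) mb two_less by (simp add: wpt_simps s1_def)
qed (use s b_pos small[of n] in \<open>auto simp: store_upd_apply store_upd_other\<close>)

end

locale searcher = big_machine E n k b w peak + cover_search E n l j pa D w "machine.base n"
  for E n k b w peak l j pa D
begin

section \<open>Evaluating one inclusion--exclusion sum on the machine\<close>

definition ready :: "store \<Rightarrow> bool" where
  "ready s \<longleftrightarrow> env s \<and> holds_list s j l pa \<and> s ''j'' 0 = int j \<and> s ''r'' 0 = int r \<and>
    holds_set n (s ''c'') C \<and> holds_set n (s ''d'') D"

lemma ready_frame:
  "ready s \<Longrightarrow> \<forall>x. x \<notin> X \<longrightarrow> s' x = s x \<Longrightarrow>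
    ''n'' \<notin> X \<and> ''k'' \<notin> X \<and> ''adj'' \<notin> X \<and> ''bs'' \<notin> X \<and> ''mz'' \<notin> X \<and> ''lim'' \<notin> X \<and> ''pw'' \<notin> X \<and>
    ''len'' \<notin> X \<and> ''lst'' \<notin> X \<and> ''par'' \<notin> X \<and> ''j'' \<notin> X \<and> ''r'' \<notin> X \<and> ''c'' \<notin> X \<and> ''d'' \<notin> X \<Longrightarrow>
    ready s'"
  by (simp add: ready_def env_def holds_list_def)

lemma length_l: "length l \<le> n" "j + m = length l" "m \<le> n"
  using distinct_length[OF l] j by (auto simp: m_def)

lemma cols_range: "cols M y u \<in> {0, 1, 2}"
  by (induction y arbitrary: u) (auto split: if_splits)

lemma sgs_range: "\<bar>sgs M y\<bar> = 1"
  by (induction y) (auto simp: abs_mult)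

lemma two_power_m: "2 ^ m < (2::int) ^ b" "y \<le> m \<Longrightarrow> 2 ^ y < (2::int) ^ b"
proof -
  have "2 ^ y < (2::int) ^ b" if "y \<le> m" for y
    using bounds(1) that length_l(3) power_increasing[of y n "2::int"] by linarith
  then show "2 ^ m < (2::int) ^ b" "y \<le> m \<Longrightarrow> 2 ^ y < (2::int) ^ b" by blast+
qed

lemma l_less: "i < length l \<Longrightarrow> l ! i < n"
  using l(2) nth_mem by blast

lemma wpt_decode_init:
  assumes s: "bounded b s" "ready s"
  shows "wpt b (for_loop ''i'' (var ''j'') (Write ''col'' (Read ''lst'' (var ''i'')) (Const 1)))
    (n * 3 + 2) (\<lambda>s'. \<forall>u\<in>P. s' ''col'' u = 1) s"
proof -
  have "wpt b (for_loop ''i'' (var ''j'') (Write ''col'' (Read ''lst'' (var ''i'')) (Const 1)))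
    (n * 3 + 2) (\<lambda>s'. \<forall>u\<in>set (take j l). s' ''col'' u = 1) s"
  proof (rule wpt_for_loop[where N = j and K = 1 and I = "\<lambda>m s'. \<forall>u\<in>set (take m l). s' ''col'' u = 1"])
    fix t s' assume t: "t < j" "bounded b s'" "\<forall>u\<in>set (take t l). s' ''col'' u = 1" "s' ''i'' 0 = int t"
      and fr: "\<forall>x. x \<notin> insert ''i'' (writes (Write ''col'' (Read ''lst'' (var ''i'')) (Const 1))) \<longrightarrow> s' x = s x"
    have tl: "t < length l" using t(1) j by linarith
    have "s' ''lst'' t = int (l ! t)" using fr s(2) tl by (simp add: ready_def holds_list_def)
    moreover have "l ! t < b" using l_less[OF tl] by (intro index) linarith
    ultimately show "wpt b (Write ''col'' (Read ''lst'' (var ''i'')) (Const 1)) 1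
        (\<lambda>s'. \<forall>u\<in>set (take (Suc t) l). s' ''col'' u = 1) s'"
      using t two_less tl by (auto simp: wpt_simps take_Suc_conv_app_nth)
  next
    show "int j < 2 ^ b" using j(2) length_l(1) by (intro small) linarith
    show "j * (1 + 2) + 2 \<le> n * 3 + 2" using j(2) length_l(1) by simp
  qed (use s b_pos in \<open>auto simp: store_upd_apply store_upd_other ready_def\<close>)
  then show ?thesis by (simp add: P_def)
qed

lemma wpt_decode_body:
  assumes M: "M < 2 ^ m" and y: "y < m" and s: "bounded b s" "ready s" "s ''i'' 0 = int y"
    and I: "\<forall>u\<in>before y. s ''col'' u = cols M y u" "s ''p'' 0 = sgs M y" "s ''x'' 0 = int (M div 2 ^ y)"
  shows "wpt b decode_body 8 (\<lambda>s'. (\<forall>u\<in>before (Suc y). s' ''col'' u = cols M (Suc y) u) \<and>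
    s' ''p'' 0 = sgs M (Suc y) \<and> s' ''x'' 0 = int (M div 2 ^ Suc y)) s"
proof -
  have jy: "j + y < length l" using y length_l(2) by linarith
  have v: "s ''lst'' (j + y) = int (nd y)" "s ''par'' (j + y) = int (pr y)" "s ''j'' 0 = int j"
    using s(2) jy by (auto simp: ready_def holds_list_def nd_def pr_def)
  have a: "s ''col'' (pr y) = cols M y (pr y)" using I(1) pr_in[OF y] by blast
  have nd: "nd y < n" using l_less[OF jy] by (simp add: nd_def)
  have ndb: "nd y < b" "int (nd y) < 2 ^ b" using nd by (auto intro!: index small[of "nd y", simplified])
  have "M div 2 ^ y \<le> M" by (rule div_le_dividend)
  then have "int (M div 2 ^ y) \<le> int M" by (rule of_nat_mono)
  moreover have "int M < 2 ^ m" using M by (metis of_nat_less_numeral_power_cancel_iff)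
  ultimately have x: "int (M div 2 ^ y) < 2 ^ b" using two_power_m(1) by linarith
  have x2: "M div 2 ^ y div 2 \<le> M div 2 ^ y" by (rule div_le_dividend)
  have xs: "int (M div 2 ^ y div 2) < 2 ^ b" using x of_nat_mono[OF x2] by linarith
  have e: "int (M div 2 ^ y) div 2 = int (M div 2 ^ Suc y)"
    by (simp add: power_Suc2 div_mult2_eq zdiv_int del: power_Suc)
  have xb: "\<bar>int (M div 2 ^ y) div 2\<bar> < 2 ^ b"
    unfolding e using xs by (simp only: power_Suc2 div_mult2_eq abs_of_nat)
  have o: "int (M div 2 ^ y) mod 2 = of_bool (bit M y)"
    by (simp add: bit_iff_odd mod_2_eq_odd flip: of_nat_div)
  have c: "cols M y (pr y) \<in> {0, 1, 2}" by (rule cols_range)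
  have sg: "\<bar>sgs M y\<bar> < 2 ^ b" using sgs_range two_less by simp
  have bf: "before (Suc y) = insert (nd y) (before y)" by (rule before_Suc[OF y])
  have nn: "nd y \<notin> before y" by (rule nd_notin[OF y])
  have ob: "\<bar>of_bool (bit M y) :: int\<bar> < 2 ^ b" using two_less by simp
  have cb: "\<bar>cols M y (pr y)\<bar> < 2 ^ b" using c two_less by auto
  show ?thesis
    unfolding decode_body_def
    using s(1,3) v a ndb xb o sg bf nn ob cb I two_less b_pos
    by (auto simp: wpt_simps e simp del: cols.simps(1) power_Suc)
qed

lemma wpt_decode:
  assumes M: "M < 2 ^ m" and s: "bounded b s" "ready s" "s ''mask'' 0 = int M"
  shows "wpt b decode_prog (13 * n + 6)
    (\<lambda>s'. (\<forall>u\<in>C. s' ''col'' u = col M u) \<and> s' ''p'' 0 = sgs M m) s"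
proof -
  define s1 where "s1 = store_upd ''x'' 0 (int M) (store_upd ''p'' 0 1 s)"
  have Mb: "int M < 2 ^ b"
    using two_power_m(1) M by (metis less_trans of_nat_less_numeral_power_cancel_iff)
  have s1: "bounded b s1" unfolding s1_def
    by (intro bounded_upd) (use s two_less b_pos Mb in simp_all)
  have r1: "ready s1" using s(2) by (simp add: s1_def ready_def env_def holds_list_def store_upd_other store_upd_apply)
  let ?F1 = "for_loop ''i'' (var ''j'') (Write ''col'' (Read ''lst'' (var ''i'')) (Const 1))"
  let ?F2 = "for_loop ''i'' (Sub (var ''len'') (var ''j'')) decode_body"
  have "wpt b (?F1 ;; ?F2) (4 + 13 * n) (\<lambda>s'. (\<forall>u\<in>C. s' ''col'' u = col M u) \<and> s' ''p'' 0 = sgs M m) s1"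
  proof (rule wpt_Seq[OF wpt_decode_init[OF s1 r1], where ?c2.0 = "n * 10 + 2"])
    fix s2 assume s2: "bounded b s2" "\<forall>x. x \<notin> writes ?F1 \<longrightarrow> s2 x = s1 x" "\<forall>u\<in>P. s2 ''col'' u = 1"
    have r2: "ready s2" by (rule ready_frame[OF r1 s2(2)]) simp
    have px: "s2 ''p'' 0 = 1" "s2 ''x'' 0 = int M" using s2(2) by (simp_all add: s1_def store_upd_apply)
    let ?I = "\<lambda>y s'. (\<forall>u\<in>before y. s' ''col'' u = cols M y u) \<and>
      s' ''p'' 0 = sgs M y \<and> s' ''x'' 0 = int (M div 2 ^ y)"
    have "wpt b ?F2 (n * 10 + 2) (?I m) s2"
    proof (rule wpt_for_loop[where N = m and K = 8 and I = ?I])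
      fix y s' assume y: "y < m" "bounded b s'" "?I y s'" "s' ''i'' 0 = int y"
        and fr: "\<forall>x. x \<notin> insert ''i'' (writes decode_body) \<longrightarrow> s' x = s2 x"
      have "ready s'" by (rule ready_frame[OF r2 fr]) (simp add: decode_body_def)
      then show "wpt b decode_body 8 (?I (Suc y)) s'"
        using wpt_decode_body[OF M y(1,2) _ y(4)] y(3) by blast
    next
      show "int m < 2 ^ b" using length_l(3) by (intro small) linarith
      show "m * (8 + 2) + 2 \<le> n * 10 + 2" using length_l(3) by simp
      fix s' assume fr: "\<forall>x. x \<notin> insert ''i'' (writes decode_body) \<longrightarrow> s' x = s2 x"
      have "ready s'" by (rule ready_frame[OF r2 fr]) (simp add: decode_body_def)
      then show "expr_val s' (Sub (var ''len'') (var ''j'')) = int m"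
        using length_l(2) by (simp add: ready_def holds_list_def)
    qed (use s2 px b_pos in \<open>simp_all add: store_upd_apply store_upd_other before_0 decode_body_def\<close>)
    then show "wpt b ?F2 (n * 10 + 2) (\<lambda>s'. (\<forall>u\<in>C. s' ''col'' u = col M u) \<and> s' ''p'' 0 = sgs M m) s2"
      by (rule wpt_weaken) (simp_all add: before_m col_def)
  qed simp
  then show ?thesis
    unfolding decode_prog_def
    using s Mb two_less b_pos by (simp add: wpt_simps s1_def)
qed

lemma cost_le: "v < n \<Longrightarrow> base ^ cost v \<le> peak"
  using pw_le[of v] by (simp add: cost_def mz_def)

lemma n_square_ge: "1 \<le> int (n * n)"
  using n_pos by (metis One_nat_def Suc_leI nat_0_less_mult_iff of_nat_1 of_nat_mono)

lemma base_cost_ge: "1 \<le> base ^ cost v"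
  using base_ge by (rule one_le_power)

lemma leaf_of_range: "0 \<le> leaf_of M v" "leaf_of M v \<le> peak"
  using base_cost_ge[of v] cost_le[of v] peak_ge D
  by (auto simp: leaf_of_def leaf_def)

text \<open>The contribution of a single vertex to \<open>lead\<close>, so that the global condition
  \<open>good\<close> can be checked in one pass: each violation shows up as a factor 0 at one of
  the vertices concerned.\<close>

definition factor :: "nat set \<Rightarrow> nat \<Rightarrow> int" where
  "factor A v =
    (if v \<in> C then if v \<in> A then base ^ cost v * of_bool (v \<in> D)
       else of_bool (\<not> (\<exists>u\<in>C - A. (v, u) \<in> E))
     else if v \<in> forced A then base ^ cost v * of_bool (v \<in> D) * of_bool (\<exists>u\<in>A. (v, u) \<in> E)
     else 1)"

lemma prod_factor:
  assumes "A \<subseteq> C"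
  shows "(\<Prod>v<n. factor A v) = lead A"
proof (cases "good A")
  case True
  have sub: "A \<union> forced A \<subseteq> {..<n}" using assms C_sub by (auto simp: forced_def)
  have "(\<Prod>v\<in>A \<union> forced A. base ^ cost v) = (\<Prod>v<n. factor A v)"
  proof (rule prod.mono_neutral_cong_left)
    show "\<forall>v\<in>{..<n} - (A \<union> forced A). factor A v = 1"
      using True by (auto simp: factor_def good_def)
    fix v assume v: "v \<in> A \<union> forced A"
    then have "v \<in> D" "v \<in> forced A \<Longrightarrow> \<exists>u\<in>A. (v, u) \<in> E" using True by (auto simp: good_def)
    moreover have "v \<in> forced A \<Longrightarrow> v \<notin> C" by (simp add: forced_def)
    ultimately show "base ^ cost v = factor A v" using v assms by (auto simp: factor_def)
  qed (use sub in auto)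
  then show ?thesis using True by (simp add: lead_def)
next
  case False
  then consider u v where "u \<in> C - A" "v \<in> C - A" "(u, v) \<in> E" | v where "v \<in> A" "v \<notin> D"
    | v where "v \<in> forced A" "v \<notin> D \<or> \<not> (\<exists>u\<in>A. (v, u) \<in> E)"
    unfolding good_def by blast
  then have "\<exists>v<n. factor A v = 0"
  proof cases
    case 1
    then show ?thesis using C_sub by (intro exI[of _ u]) (auto simp: factor_def)
  next
    case 2
    then show ?thesis using C_sub assms by (intro exI[of _ v]) (auto simp: factor_def)
  next
    case 3
    then show ?thesis by (intro exI[of _ v]) (auto simp: factor_def forced_def)
  qed
  then have "(\<Prod>v<n. factor A v) = 0" by (simp add: prod_zero_iff) blast
  then show ?thesis using False by (simp add: lead_def)
qed

lemma factor_range: "v < n \<Longrightarrow> 0 \<le> factor A v" "v < n \<Longrightarrow> factor A v \<le> peak"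
  using base_cost_ge[of v] cost_le[of v] peak_ge by (auto simp: factor_def)

text \<open>Stated for partial products, because these are the values of \<open>p\<close> during the
  loop up to sign.\<close>

lemma prod_factor_range: "x \<le> n \<Longrightarrow> 0 \<le> (\<Prod>v<x. factor A v)" "x \<le> n \<Longrightarrow> (\<Prod>v<x. factor A v) \<le> peak ^ n"
proof -
  assume x: "x \<le> n"
  show "0 \<le> (\<Prod>v<x. factor A v)" using x by (intro prod_nonneg) (auto intro: factor_range)
  have "(\<Prod>v<x. factor A v) \<le> (\<Prod>v<x. peak)"
    using x by (intro prod_mono) (auto intro: factor_range)
  also have "\<dots> = peak ^ x" by simp
  also have "\<dots> \<le> peak ^ n" using x peak_ge by (intro power_increasing)
  finally show "(\<Prod>v<x. factor A v) \<le> peak ^ n" .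
qed

lemma wpt_near:
  assumes s: "bounded b s" "ready s" "\<forall>u\<in>C. s ''col'' u = col M u" "s ''v'' 0 = int v"
    "s ''h0'' 0 = 0" "s ''h1'' 0 = 0" and v: "v < n"
  shows "wpt b near_prog (n * 5 + 2)
    (\<lambda>s'. s' ''h0'' 0 = of_bool (\<exists>u\<in>C - used M. (v, u) \<in> E) \<and>
      s' ''h1'' 0 = of_bool (\<exists>u\<in>used M. (v, u) \<in> E)) s"
proof -
  let ?B = "Cond (And (Equal (Read ''adj'' (Add (Mul (var ''v'') (var ''n'')) (var ''u''))) (Const 1))
             (Equal (Read ''c'' (var ''u'')) (Const 1)))
           (Cond (Equal (Read ''col'' (var ''u'')) (Const 0)) (''h0'' ::= Const 1) (''h1'' ::= Const 1))
           Skip"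
  let ?I = "\<lambda>x s'. s' ''h0'' 0 = of_bool (\<exists>u<x. u \<in> C \<and> u \<notin> used M \<and> (v, u) \<in> E) \<and>
      s' ''h1'' 0 = of_bool (\<exists>u<x. u \<in> used M \<and> (v, u) \<in> E)"
  have "wpt b near_prog (n * 5 + 2) (?I n) s"
    unfolding near_prog_def
  proof (rule wpt_for_loop[where N = n and K = 3 and I = ?I])
    fix x s' assume x: "x < n" "bounded b s'" "?I x s'" "s' ''u'' 0 = int x"
      and fr: "\<forall>y. y \<notin> insert ''u'' (writes ?B) \<longrightarrow> s' y = s y"
    have r: "ready s'" by (rule ready_frame[OF s(2) fr]) simp
    have st: "s' ''n'' 0 = int n" "s' ''adj'' (v * n + x) = of_bool ((v, x) \<in> E)"
      "s' ''c'' x = of_bool (x \<in> C)" "s' ''v'' 0 = int v"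
      using r x(1) v fr s(4) by (simp_all add: ready_def env_def holds_set_def)
    have c: "x \<in> C \<Longrightarrow> s' ''col'' x = 0 \<longleftrightarrow> x \<notin> used M" using fr s(3) by (simp add: used_def)
    have u: "x \<in> used M \<Longrightarrow> x \<in> C" by (simp add: used_def)
    show "wpt b ?B 3 (?I (Suc x)) s'"
      using x(2-4) st c u b_pos two_less by (auto simp: wpt_simps less_Suc_eq)
  qed (use s b_pos small[of n] in \<open>auto simp: store_upd_apply store_upd_other ready_def env_def\<close>)
  then show ?thesis
  proof (rule wpt_weaken)
    have C: "u < n" if "u \<in> C" for u using that C_sub by auto
    have U: "u < n" if "u \<in> used M" for u using that C used_sub_C by auto
    have "(\<exists>u<n. u \<in> C \<and> u \<notin> used M \<and> (v, u) \<in> E) \<longleftrightarrow> (\<exists>u\<in>C - used M. (v, u) \<in> E)"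
      "(\<exists>u<n. u \<in> used M \<and> (v, u) \<in> E) \<longleftrightarrow> (\<exists>u\<in>used M. (v, u) \<in> E)" using C U by auto
    then show "?I n s' \<Longrightarrow> s' ''h0'' 0 = of_bool (\<exists>u\<in>C - used M. (v, u) \<in> E) \<and>
      s' ''h1'' 0 = of_bool (\<exists>u\<in>used M. (v, u) \<in> E)" for s' :: store by simp
  qed simp
qed

lemma wpt_judge:
  assumes s: "bounded b s" "ready s" "\<forall>u\<in>C. s ''col'' u = col M u" "s ''v'' 0 = int v" and v: "v < n"
    and h: "s ''h0'' 0 = of_bool (\<exists>u\<in>C - used M. (v, u) \<in> E)"
      "s ''h1'' 0 = of_bool (\<exists>u\<in>used M. (v, u) \<in> E)"
    and p: "\<bar>s ''p'' 0\<bar> < 2 ^ b" "\<bar>s ''p'' 0 * factor (used M) v\<bar> < 2 ^ b"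
  shows "wpt b judge_prog 5 (\<lambda>s'. s' ''p'' 0 = s ''p'' 0 * factor (used M) v \<and>
    (\<forall>u. s' ''e'' u = (if u = v then leaf_of M v else s ''e'' u))) s"
proof -
  have st: "s ''c'' v = of_bool (v \<in> C)" "s ''d'' v = of_bool (v \<in> D)" "s ''pw'' v = base ^ cost v"
    using s(2) v by (simp_all add: ready_def env_def holds_set_def cost_def mz_def)
  have vb: "v < b" by (rule index) (use v in linarith)
  have pw: "\<bar>base ^ cost v\<bar> < 2 ^ b" "\<bar>of_bool (v \<in> D) * base ^ cost v\<bar> < 2 ^ b"
    using cost_le[OF v] base_cost_ge[of v] bounds(3) two_less by auto
  show ?thesis
  proof (cases "v \<in> C")
    case True
    then have cm: "s ''col'' v = col M v" using s(3) by blast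
    have used: "v \<in> used M \<longleftrightarrow> col M v \<noteq> 0" "v \<in> side M \<longleftrightarrow> col M v = 2"
      using True by (simp_all add: used_def side_def)
    have cr: "col M v \<in> {0, 1, 2}" using col_range[OF True] .
    have nf: "v \<notin> forced (used M)" using True by (simp add: forced_def)
    define H where "H \<longleftrightarrow> (\<exists>u\<in>C - used M. (v, u) \<in> E)"
    have h0: "s ''h0'' 0 = of_bool H" using h(1) by (simp add: H_def)
    have fac: "factor (used M) v = (if v \<in> used M then base ^ cost v * of_bool (v \<in> D) else of_bool (\<not> H))"
      using True by (simp add: factor_def H_def)
    have lf: "leaf_of M v = (if v \<in> used M \<and> v \<notin> side M then 1 else 0)"
      using True nf by (simp add: leaf_of_def leaf_def)
    from cr consider "col M v = 0" | "col M v = 1" | "col M v = 2" by auto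
    then show ?thesis
    proof cases
      case 1
      then show ?thesis
        unfolding judge_prog_def fac lf
        using s(1,4) st(1) vb cm used True two_less b_pos h0
        by (cases H) (simp_all add: wpt_simps)
    next
      case 2
      then show ?thesis
        using s(1,4) st vb cm used True two_less b_pos p
        unfolding judge_prog_def fac lf
        by (simp add: wpt_simps)
    next
      case 3
      then show ?thesis
        using s(1,4) st vb cm used True two_less b_pos p
        unfolding judge_prog_def fac lf
        by (simp add: wpt_simps)
    qed
  next
    case False
    then have n: "v \<notin> used M" "v \<notin> side M" using used_sub_C side_sub_used by auto
    have fo: "v \<in> forced (used M) \<longleftrightarrow> (\<exists>u\<in>C - used M. (v, u) \<in> E)"
      using False v by (simp add: forced_def)
    then have h0: "s ''h0'' 0 = of_bool (v \<in> forced (used M))" using h(1) by simp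
    show ?thesis
      unfolding judge_prog_def
      using s(1,4) st vb n False p two_less b_pos h0 h(2) pw
      by (auto simp: wpt_simps factor_def leaf_of_def leaf_def mult.assoc)
  qed
qed

lemma wpt_classify:
  assumes s: "bounded b s" "ready s" "\<forall>u\<in>C. s ''col'' u = col M u" "s ''p'' 0 = sgs M m"
  shows "wpt b classify_prog (n * (n * 5 + 11) + 2)
    (\<lambda>s'. s' ''p'' 0 = sgs M m * lead (used M) \<and> (\<forall>v<n. s' ''e'' v = leaf_of M v)) s"
proof -
  let ?I = "\<lambda>x s'. s' ''p'' 0 = sgs M m * (\<Prod>v<x. factor (used M) v) \<and> (\<forall>v<x. s' ''e'' v = leaf_of M v)"
  let ?B = "''h0'' ::= Const 0 ;; ''h1'' ::= Const 0 ;; near_prog ;; judge_prog"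
  have "wpt b (for_loop ''v'' (var ''n'') ?B) (n * (n * 5 + 11) + 2) (?I n) s"
  proof (rule wpt_for_loop[where N = n and K = "n * 5 + 9" and I = ?I])
    fix v s' assume v: "v < n" "bounded b s'" "?I v s'" "s' ''v'' 0 = int v"
      and fr: "\<forall>y. y \<notin> insert ''v'' (writes ?B) \<longrightarrow> s' y = s y"
    have r: "ready s'" by (rule ready_frame[OF s(2) fr]) (simp add: near_prog_def judge_prog_def)
    have c: "s' ''col'' = s ''col''" using fr by (simp add: near_prog_def judge_prog_def)
    define s1 where "s1 = store_upd ''h1'' 0 0 (store_upd ''h0'' 0 0 s')"
    have s1: "bounded b s1" unfolding s1_def by (intro bounded_upd) (use v b_pos in simp_all)
    have r1: "ready s1" using r by (simp add: s1_def ready_def env_def holds_list_def store_upd_other)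
    have "wpt b (near_prog ;; judge_prog) (n * 5 + 7) (?I (Suc v)) s1"
    proof (rule wpt_Seq[where ?c1.0 = "n * 5 + 2" and ?c2.0 = 5])
      show "wpt b near_prog (n * 5 + 2)
        (\<lambda>s'. s' ''h0'' 0 = of_bool (\<exists>u\<in>C - used M. (v, u) \<in> E) \<and>
          s' ''h1'' 0 = of_bool (\<exists>u\<in>used M. (v, u) \<in> E)) s1"
        by (rule wpt_near[OF s1 r1]) (use s(3) c v in \<open>simp_all add: s1_def store_upd_apply store_upd_other\<close>)
      fix s2 assume s2: "bounded b s2" "\<forall>x. x \<notin> writes near_prog \<longrightarrow> s2 x = s1 x"
        "s2 ''h0'' 0 = of_bool (\<exists>u\<in>C - used M. (v, u) \<in> E) \<and> s2 ''h1'' 0 = of_bool (\<exists>u\<in>used M. (v, u) \<in> E)"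
      have r2: "ready s2" by (rule ready_frame[OF r1 s2(2)]) (simp add: near_prog_def)
      have e2: "s2 ''e'' = s' ''e''" "s2 ''p'' = s' ''p''" "s2 ''v'' = s' ''v''" "s2 ''col'' = s' ''col''"
        using s2(2) by (simp_all add: near_prog_def s1_def store_upd_other)
      have pb: "\<bar>sgs M m * (\<Prod>v<x. factor (used M) v)\<bar> < 2 ^ b" if "x \<le> n" for x
      proof -
        have "0 \<le> (\<Prod>v<x. factor (used M) v)" by (rule prod_factor_range(1)[OF that])
        then have "\<bar>sgs M m * (\<Prod>v<x. factor (used M) v)\<bar> = (\<Prod>v<x. factor (used M) v)"
          using sgs_range[of M m] by (simp add: abs_mult)
        then show ?thesis using prod_factor_range(2)[OF that, of "used M"] bounds(2) by linarith
      qed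
      have eq: "s2 ''p'' 0 * factor (used M) v = sgs M m * (\<Prod>v<Suc v. factor (used M) v)"
        using v(3) e2 by simp
      have "wpt b judge_prog 5 (\<lambda>s'. s' ''p'' 0 = s2 ''p'' 0 * factor (used M) v \<and>
          (\<forall>u. s' ''e'' u = (if u = v then leaf_of M v else s2 ''e'' u))) s2"
      proof (rule wpt_judge[OF s2(1) r2])
        show "\<bar>s2 ''p'' 0\<bar> < 2 ^ b" using pb[of v] v e2 by simp
        show "\<bar>s2 ''p'' 0 * factor (used M) v\<bar> < 2 ^ b" unfolding eq by (rule pb) (use v in simp)
      qed (use v s2 s(3) c e2 in simp_all)
      then show "wpt b judge_prog 5 (?I (Suc v)) s2"
      proof (rule wpt_weaken)
        fix s3 :: store
        assume "s3 ''p'' 0 = s2 ''p'' 0 * factor (used M) v \<and>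
          (\<forall>u. s3 ''e'' u = (if u = v then leaf_of M v else s2 ''e'' u))"
        then show "?I (Suc v) s3" unfolding eq using v(3) e2 by (simp add: less_Suc_eq)
      qed simp
    qed simp
    then show "wpt b ?B (n * 5 + 9) (?I (Suc v)) s'"
      using v(2) b_pos two_less by (simp add: wpt_simps s1_def add.commute)
  qed (use s b_pos small[of n] in \<open>auto simp: store_upd_apply store_upd_other near_prog_def judge_prog_def ready_def env_def\<close>)
  then have "wpt b (for_loop ''v'' (var ''n'') ?B) (n * (n * 5 + 11) + 2)
    (\<lambda>s'. s' ''p'' 0 = sgs M m * lead (used M) \<and> (\<forall>v<n. s' ''e'' v = leaf_of M v)) s"
    by (rule wpt_weaken) (simp_all add: prod_factor[OF used_sub_C])
  then show ?thesis by (simp add: classify_prog_def)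
qed

definition term_at :: "(nat \<Rightarrow> int) \<Rightarrow> nat \<Rightarrow> nat \<Rightarrow> nat \<Rightarrow> int" where
  "term_at e i v q = of_bool ((v, q mod n) \<in> E) * walk_sum E e (q div n) v *
    walk_sum E e (i - 1 - q div n) (q mod n)"

lemma term_at_sum: "0 < i \<Longrightarrow> (\<Sum>q<n * i. term_at e i v q) = walk_sum E e i v"
  using walk_sum_Suc_div_mod[OF E_sub, of e "i - 1" v] by (simp add: term_at_def)

lemma wpt_add:
  assumes s: "bounded b s" "ready s" "s ''u'' 0 = int i" "s ''v'' 0 = int v" "v < n" "i < n"
    and e: "\<And>v. 0 \<le> e v" "\<And>v. e v \<le> peak"
    and f: "\<forall>z<i * n + v. s ''f'' z = walk_sum E e (z div n) (z mod n)"
    and a: "s ''acc'' 0 = (if i = 0 then e v else 0)"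
  shows "wpt b add_prog (n * n * 3 + 2) (\<lambda>s'. s' ''acc'' 0 = walk_sum E e i v) s"
proof (cases "i = 0")
  case True
  have "wpt b add_prog (n * n * 3 + 2) (\<lambda>s'. s' ''acc'' 0 = e v) s"
    unfolding add_prog_def
    by (rule wpt_for_loop[where N = 0 and K = 0 and I = "\<lambda>_ s'. s' ''acc'' 0 = e v"])
      (use s True a b_pos in \<open>auto simp: store_upd_apply ready_def env_def\<close>)
  then show ?thesis using True by simp
next
  case False
  let ?B = "''acc'' ::= Add (var ''acc'')
             (Mul (Mul
               (Read ''adj'' (Add (Mul (var ''v'') (var ''n'')) (Mod (var ''g'') (var ''n''))))
               (Read ''f'' (Add (Mul (Div (var ''g'') (var ''n'')) (var ''n'')) (var ''v''))))
               (Read ''f'' (Add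
                 (Mul (Sub (Sub (var ''u'') (Const 1)) (Div (var ''g'') (var ''n''))) (var ''n''))
                 (Mod (var ''g'') (var ''n'')))))"
  let ?I = "\<lambda>x s'. s' ''acc'' 0 = (\<Sum>q<x. term_at e i v q)"
  have nn: "n * i \<le> n * n" using s(6) by simp
  have "wpt b add_prog (n * n * 3 + 2) (?I (n * i)) s"
    unfolding add_prog_def
  proof (rule wpt_for_loop[where N = "n * i" and K = 1 and I = ?I])
    show "int (n * i) < 2 ^ b" by (rule small) (use nn in linarith)
    show "n * i * (1 + 2) + 2 \<le> n * n * 3 + 2" by (intro add_right_mono mult_le_mono nn) simp
    fix q s' assume q: "q < n * i" "bounded b s'" "?I q s'" "s' ''g'' 0 = int q"
      and fr: "\<forall>y. y \<notin> insert ''g'' (writes ?B) \<longrightarrow> s' y = s y"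
    have r: "ready s'" by (rule ready_frame[OF s(2) fr]) simp
    let ?a = "q div n" and ?u = "q mod n"
    have u: "?u < n" "?a < i" using q(1) n_pos by (simp_all add: less_mult_imp_div_less mult.commute)
    have adj: "s' ''adj'' (v * n + ?u) = of_bool ((v, ?u) \<in> E)"
      using r u(1) s(5) by (simp add: ready_def env_def)
    have vars: "s' ''n'' 0 = int n" "s' ''u'' 0 = int i" "s' ''v'' 0 = int v" "s' ''f'' = s ''f''"
      using r fr s(3,4) by (simp_all add: ready_def env_def)
    \<comment> \<open>Both table entries that are read belong to walks with fewer joins than the
      current one, and the table is filled by increasing number of joins.\<close>
    have lt1: "?a * n + v < i * n + v" using u(2) n_pos by simp
    have lt2: "(i - 1 - ?a) * n + ?u < i * n + v"
    proof -
      have "(i - 1 - ?a) * n + ?u < (i - 1 - ?a + 1) * n" using u(1) by simp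
      also have "\<dots> \<le> i * n" using u(2) by (intro mult_le_mono1) linarith
      finally show ?thesis by simp
    qed
    have f1: "s' ''f'' (?a * n + v) = walk_sum E e ?a v"
      using f[rule_format, OF lt1] s(5) vars by simp
    have f2: "s' ''f'' ((i - 1 - ?a) * n + ?u) = walk_sum E e (i - 1 - ?a) ?u"
      using f[rule_format, OF lt2] u(1) vars by simp
    have eq: "int i - 1 - int ?a = int (i - Suc ?a)" using u(2) by linarith
    have ix: "nat ((int i - 1 - int ?a) * int n + int ?u) = (i - Suc ?a) * n + ?u"
      unfolding eq by (rule nat_index(1))
    have ev: "expr_val s' (Add (var ''acc'')
             (Mul (Mul
               (Read ''adj'' (Add (Mul (var ''v'') (var ''n'')) (Mod (var ''g'') (var ''n''))))
               (Read ''f'' (Add (Mul (Div (var ''g'') (var ''n'')) (var ''n'')) (var ''v''))))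
               (Read ''f'' (Add
                 (Mul (Sub (Sub (var ''u'') (Const 1)) (Div (var ''g'') (var ''n''))) (var ''n''))
                 (Mod (var ''g'') (var ''n'')))))) = (\<Sum>q<Suc q. term_at e i v q)"
      using vars q(3,4) adj f1 f2
      by (simp add: term_at_def ix flip: of_nat_div of_nat_mod)
    have t0: "0 \<le> term_at e i v q" for q
      unfolding term_at_def by (intro mult_nonneg_nonneg walk_sum_nonneg e) simp
    \<comment> \<open>The terms are nonnegative, so each partial sum in \<open>acc\<close> is
      bounded by the complete walk sum.\<close>
    have "(\<Sum>q<Suc q. term_at e i v q) \<le> (\<Sum>q<n * i. term_at e i v q)"
      using q(1) t0 by (intro sum_mono2) auto
    also have "\<dots> = walk_sum E e i v" using False by (intro term_at_sum) simp
    also have "\<dots> \<le> int (n * n) ^ i * peak ^ Suc i"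
      by (rule walk_sum_le[OF E_sub e]) (use s(6) in simp)
    also have "\<dots> \<le> int (n * n) ^ n * peak ^ (n + 1)"
      using s(6) n_square_ge peak_ge by (intro mult_mono power_increasing) auto
    finally have "(\<Sum>q<Suc q. term_at e i v q) < 2 ^ b" using bounds(5) by linarith
    moreover have "0 \<le> (\<Sum>q<Suc q. term_at e i v q)" by (intro sum_nonneg t0)
    ultimately have "\<bar>\<Sum>q<Suc q. term_at e i v q\<bar> < 2 ^ b" by linarith
    then show "wpt b ?B 1 (?I (Suc q)) s'"
      using ev q(2) b_pos by (subst wpt_Write) (simp_all only: ev, simp_all add: store_upd_apply)
  next
    fix s' assume fr: "\<forall>y. y \<notin> insert ''g'' (writes ?B) \<longrightarrow> s' y = s y"
    show "expr_val s' (Mul (var ''n'') (var ''u'')) = int (n * i)"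
      using fr s(2,3) by (simp add: ready_def env_def)
  qed (use s False a b_pos in \<open>auto simp: store_upd_apply\<close>)
  then show ?thesis using term_at_sum[of i e v] False by simp
qed

lemma walk_sum_small:
  assumes e: "\<And>v. 0 \<le> e v" "\<And>v. e v \<le> peak" and i: "i < n"
  shows "0 \<le> walk_sum E e i v" "walk_sum E e i v \<le> int (n * n) ^ n * peak ^ (n + 1)"
    "\<bar>walk_sum E e i v\<bar> < 2 ^ b"
proof -
  show 1: "0 \<le> walk_sum E e i v" by (rule walk_sum_nonneg[OF e(1)])
  have "walk_sum E e i v \<le> int (n * n) ^ i * peak ^ Suc i"
    by (rule walk_sum_le[OF E_sub e]) (use i in simp)
  also have "\<dots> \<le> int (n * n) ^ n * peak ^ (n + 1)"
    using i n_square_ge peak_ge by (intro mult_mono power_increasing) auto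
  finally show 2: "walk_sum E e i v \<le> int (n * n) ^ n * peak ^ (n + 1)" .
  then show "\<bar>walk_sum E e i v\<bar> < 2 ^ b" using 1 bounds(5) by linarith
qed

lemma wpt_table_body:
  assumes s: "bounded b s" "ready s" "s ''y'' 0 = int y" "y < n * n"
    and e: "\<And>v. 0 \<le> e v" "\<And>v. e v \<le> peak" "\<forall>v<n. s ''e'' v = e v"
    and f: "\<forall>z<y. s ''f'' z = walk_sum E e (z div n) (z mod n)"
  shows "wpt b table_body (n * n * 3 + 7) (\<lambda>s'. \<forall>z<Suc y. s' ''f'' z = walk_sum E e (z div n) (z mod n)) s"
proof -
  let ?i = "y div n" and ?v = "y mod n"
  have v: "?v < n" "?i < n" using n_pos s(4) by (simp_all add: less_mult_imp_div_less)
  have n: "s ''n'' 0 = int n" using s(2) by (simp add: ready_def env_def)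
  let ?a = "if ?i = 0 then e ?v else 0"
  define s1 where "s1 = store_upd ''acc'' 0 ?a (store_upd ''v'' 0 (int ?v) (store_upd ''u'' 0 (int ?i) s))"
  have ab: "\<bar>?a\<bar> < 2 ^ b" using e(1,2)[of ?v] bounds(3) by auto
  have vb: "int ?v < 2 ^ b" "int ?i < 2 ^ b" using v by (intro small; linarith)+
  have yb: "y < b" by (rule index) (use s(4) in linarith)
  have s1: "bounded b s1" unfolding s1_def by (intro bounded_upd) (use s(1) b_pos ab vb in simp_all)
  have r1: "ready s1" using s(2)
    by (simp add: s1_def ready_def env_def holds_list_def store_upd_other)
  have "wpt b (add_prog ;; Write ''f'' (var ''y'') (var ''acc'')) (n * n * 3 + 3)
      (\<lambda>s'. \<forall>z<Suc y. s' ''f'' z = walk_sum E e (z div n) (z mod n)) s1"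
  proof (rule wpt_Seq[where ?c2.0 = 1])
    show "wpt b add_prog (n * n * 3 + 2) (\<lambda>s'. s' ''acc'' 0 = walk_sum E e ?i ?v) s1"
      by (rule wpt_add[OF s1 r1 _ _ v e(1,2)])
        (use f in \<open>simp_all add: s1_def store_upd_apply store_upd_other\<close>)
    fix s2 assume s2: "bounded b s2" "\<forall>x. x \<notin> writes add_prog \<longrightarrow> s2 x = s1 x"
      "s2 ''acc'' 0 = walk_sum E e ?i ?v"
    have "s2 ''y'' = s ''y''" "s2 ''f'' = s ''f''"
      using s2(2) by (simp_all add: add_prog_def s1_def store_upd_other)
    then show "wpt b (Write ''f'' (var ''y'') (var ''acc'')) 1
      (\<lambda>s'. \<forall>z<Suc y. s' ''f'' z = walk_sum E e (z div n) (z mod n)) s2"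
      using s2(1,3) walk_sum_small(3)[where v = ?v and i = ?i and e = e, OF e(1,2) v(2)] yb s(3) f
      by (simp add: wpt_simps less_Suc_eq)
  qed simp
  moreover have "(if int ?i = 0 then e ?v else 0) = ?a" by simp
  ultimately show ?thesis
    unfolding table_body_def
    using s(1,3) n vb ab e(3) v b_pos
    by (simp add: wpt_simps s1_def add.commute split del: if_split flip: of_nat_div of_nat_mod)
      (auto simp: wpt_simps)
qed

lemma wpt_count:
  assumes s: "bounded b s" "ready s"
    and e: "\<And>v. 0 \<le> e v" "\<And>v. e v \<le> peak" "\<forall>v<n. s ''e'' v = e v"
  shows "wpt b count_prog (n * n * (n * n * 3 + 9) + 3 * n + 5)
    (\<lambda>s'. s' ''tot'' 0 = (\<Sum>i<n. walk_sum E e i r)) s"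
proof -
  have n: "s ''n'' 0 = int n" using s by (simp add: ready_def env_def)
  let ?F = "for_loop ''y'' (Mul (var ''n'') (var ''n'')) table_body"
  let ?A = "''tot'' ::= Add (var ''tot'') (Read ''f'' (Add (Mul (var ''g'') (var ''n'')) (var ''r'')))"
  let ?I = "\<lambda>y s'. \<forall>z<y. s' ''f'' z = walk_sum E e (z div n) (z mod n)"
  have F: "wpt b ?F (n * n * (n * n * 3 + 9) + 2) (?I (n * n)) s"
  proof (rule wpt_for_loop[where N = "n * n" and K = "n * n * 3 + 7" and I = ?I])
    fix y s' assume y: "y < n * n" "bounded b s'" "?I y s'" "s' ''y'' 0 = int y"
      and fr: "\<forall>x. x \<notin> insert ''y'' (writes table_body) \<longrightarrow> s' x = s x"
    have r: "ready s'" by (rule ready_frame[OF s(2) fr]) (simp add: table_body_def add_prog_def)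
    have ev: "\<forall>v<n. s' ''e'' v = e v" using fr e(3) by (simp add: table_body_def add_prog_def)
    show "wpt b table_body (n * n * 3 + 7) (?I (Suc y)) s'"
      by (rule wpt_table_body[OF y(2) r y(4,1) e(1,2) ev y(3)])
  next
    show "int (n * n) < 2 ^ b" by (rule small) simp
    fix s' assume fr: "\<forall>x. x \<notin> insert ''y'' (writes table_body) \<longrightarrow> s' x = s x"
    show "expr_val s' (Mul (var ''n'') (var ''n'')) = int (n * n)"
      using fr n by (simp add: table_body_def add_prog_def)
  qed (use s(1) b_pos in \<open>simp_all add: store_upd_apply store_upd_other table_body_def add_prog_def\<close>)
  have "wpt b (?F ;; ''tot'' ::= Const 0 ;; for_loop ''g'' (var ''n'') ?A)
    (n * n * (n * n * 3 + 9) + 3 * n + 5) (\<lambda>s'. s' ''tot'' 0 = (\<Sum>i<n. walk_sum E e i r)) s"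
  proof (rule wpt_Seq[OF F, where ?c2.0 = "1 + (n * 3 + 2)"])
    fix s1 assume s1: "bounded b s1" "\<forall>x. x \<notin> writes ?F \<longrightarrow> s1 x = s x" "?I (n * n) s1"
    have r1: "ready s1" by (rule ready_frame[OF s(2) s1(2)]) (simp add: table_body_def add_prog_def)
    define s2 where "s2 = store_upd ''tot'' 0 0 s1"
    have s2: "bounded b s2" unfolding s2_def by (rule bounded_upd) (use s1(1) b_pos in simp_all)
    let ?J = "\<lambda>x s'. s' ''tot'' 0 = (\<Sum>i<x. walk_sum E e i r)"
    have "wpt b (for_loop ''g'' (var ''n'') ?A) (n * 3 + 2) (?J n) s2"
    proof (rule wpt_for_loop[where N = n and K = 1 and I = ?J])
      fix x s' assume x: "x < n" "bounded b s'" "?J x s'" "s' ''g'' 0 = int x"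
        and fr: "\<forall>y. y \<notin> insert ''g'' (writes ?A) \<longrightarrow> s' y = s2 y"
      have "x * n + r < (x + 1) * n" using r_less by simp
      also have "\<dots> \<le> n * n" using x(1) by (intro mult_le_mono1) simp
      finally have "s1 ''f'' (x * n + r) = walk_sum E e x r" using s1(3) r_less by simp
      then have f: "s' ''f'' (x * n + r) = walk_sum E e x r" "s' ''n'' 0 = int n" "s' ''r'' 0 = int r"
        using fr r1 by (simp_all add: s2_def store_upd_other ready_def env_def)
      have "(\<Sum>i<Suc x. walk_sum E e i r) \<le> (\<Sum>i<n. walk_sum E e i r)"
        using x(1) walk_sum_small(1)[OF e(1,2)] by (intro sum_mono2) auto
      also have "\<dots> \<le> (\<Sum>i<n. int (n * n) ^ n * peak ^ (n + 1))"
        by (intro sum_mono walk_sum_small(2)[OF e(1,2)]) simp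
      finally have "(\<Sum>i<Suc x. walk_sum E e i r) < 2 ^ b" using bounds(4) by simp
      moreover have "0 \<le> (\<Sum>i<Suc x. walk_sum E e i r)"
        using x(1) by (intro sum_nonneg walk_sum_small(1)[OF e(1,2)]) auto
      ultimately have "\<bar>\<Sum>i<Suc x. walk_sum E e i r\<bar> < 2 ^ b" by linarith
      then show "wpt b ?A 1 (?J (Suc x)) s'"
        using x(2-4) f b_pos by (simp add: wpt_simps)
    qed (use s2 r1 b_pos small[of n] in \<open>auto simp: s2_def store_upd_apply store_upd_other ready_def env_def\<close>)
    then show "wpt b (''tot'' ::= Const 0 ;; for_loop ''g'' (var ''n'') ?A) (1 + (n * 3 + 2)) (?J n) s1"
      using s1(1) b_pos by (simp add: wpt_simps s2_def)
  qed simp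
  then show ?thesis by (simp add: count_prog_def)
qed

definition summand :: "nat \<Rightarrow> int" where
  "summand M = sgs M m * lead (used M) * (\<Sum>i<n. walk_sum E (leaf_of M) i r)"

lemma summand_small: "\<bar>summand M\<bar> \<le> peak ^ n * (int n * (int (n * n) ^ n * peak ^ (n + 1)))"
proof -
  have "0 \<le> lead (used M)" "lead (used M) \<le> peak ^ n"
    using prod_factor_range[of n "used M"] by (simp_all add: prod_factor[OF used_sub_C])
  moreover have "(\<Sum>i<n. walk_sum E (leaf_of M) i r) \<le> (\<Sum>i<n. int (n * n) ^ n * peak ^ (n + 1))"
    by (intro sum_mono walk_sum_small(2) leaf_of_range) simp
  moreover have "0 \<le> (\<Sum>i<n. walk_sum E (leaf_of M) i r)"
    by (intro sum_nonneg walk_sum_nonneg leaf_of_range)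
  ultimately show ?thesis
    unfolding summand_def abs_mult sgs_range by (simp add: mult_mono)
qed

text \<open>The summands have both signs and cancel only in the complete sum, so the values of
  \<open>q\<close> on the way are bounded through absolute values.\<close>

lemma sum_summand_small:
  assumes "x \<le> 2 ^ m"
  shows "\<bar>\<Sum>M<x. summand M\<bar> < 2 ^ b"
proof -
  let ?K = "peak ^ n * (int n * (int (n * n) ^ n * peak ^ (n + 1)))"
  have K: "0 \<le> ?K" using summand_small[of 0] by linarith
  have "\<bar>\<Sum>M<x. summand M\<bar> \<le> (\<Sum>M<x. \<bar>summand M\<bar>)" by (rule sum_abs)
  also have "\<dots> \<le> (\<Sum>M<x. ?K)" by (intro sum_mono summand_small)
  also have "\<dots> = int x * ?K" by simp
  also have "\<dots> \<le> 2 ^ n * ?K"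
  proof (rule mult_right_mono[OF _ K])
    have "x \<le> 2 ^ n" using assms length_l(3) power_increasing[of m n "2::nat"] by linarith
    then have "int x \<le> int (2 ^ n)" by (rule of_nat_mono)
    then show "int x \<le> 2 ^ n" by simp
  qed
  also have "\<dots> < 2 ^ b" using b_big by (simp add: mult.assoc)
  finally show ?thesis .
qed

lemma wpt_mask_body:
  assumes M: "M < 2 ^ m" and s: "bounded b s" "ready s" "s ''mask'' 0 = int M"
    and q: "s ''q'' 0 = (\<Sum>M<M. summand M)"
  shows "wpt b mask_body (mask_time n) (\<lambda>s'. s' ''q'' 0 = (\<Sum>M<Suc M. summand M)) s"
  unfolding mask_body_def mask_time_def
proof (rule wpt_Seq[OF wpt_decode[OF M s]])
  fix s1 assume s1: "bounded b s1" "\<forall>x. x \<notin> writes decode_prog \<longrightarrow> s1 x = s x"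
    "(\<forall>u\<in>C. s1 ''col'' u = col M u) \<and> s1 ''p'' 0 = sgs M m"
  have r1: "ready s1" by (rule ready_frame[OF s(2) s1(2)]) (simp add: decode_defs)
  have q1: "s1 ''q'' = s ''q''" using s1(2) by (simp add: decode_defs)
  show "wpt b (classify_prog ;; count_prog ;; ''q'' ::= Add (var ''q'') (Mul (var ''p'') (var ''tot'')))
     ((n * (n * 5 + 11) + 2) + ((n * n * (n * n * 3 + 9) + 3 * n + 5) + 1))
     (\<lambda>s'. s' ''q'' 0 = (\<Sum>M<Suc M. summand M)) s1"
  proof (rule wpt_Seq[OF wpt_classify[OF s1(1) r1]])
    fix s2 assume s2: "bounded b s2" "\<forall>x. x \<notin> writes classify_prog \<longrightarrow> s2 x = s1 x"
      "s2 ''p'' 0 = sgs M m * lead (used M) \<and> (\<forall>v<n. s2 ''e'' v = leaf_of M v)"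
    have r2: "ready s2" by (rule ready_frame[OF r1 s2(2)]) (simp add: classify_defs)
    have q2: "s2 ''q'' = s ''q''" using s2(2) q1 by (simp add: classify_defs)
    show "wpt b (count_prog ;; ''q'' ::= Add (var ''q'') (Mul (var ''p'') (var ''tot'')))
      ((n * n * (n * n * 3 + 9) + 3 * n + 5) + 1) (\<lambda>s'. s' ''q'' 0 = (\<Sum>M<Suc M. summand M)) s2"
    proof (rule wpt_Seq[OF wpt_count[OF s2(1) r2 leaf_of_range]])
      show "\<forall>v<n. s2 ''e'' v = leaf_of M v" using s2(3) by blast
      fix s3 assume s3: "bounded b s3" "\<forall>x. x \<notin> writes count_prog \<longrightarrow> s3 x = s2 x"
        "s3 ''tot'' 0 = (\<Sum>i<n. walk_sum E (leaf_of M) i r)"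
      have "s3 ''q'' = s ''q''" "s3 ''p'' = s2 ''p''" using s3(2) q2 by (simp_all add: count_defs)
      then have eq: "s3 ''q'' 0 + s3 ''p'' 0 * s3 ''tot'' 0 = (\<Sum>M<Suc M. summand M)"
        using s2(3) s3(3) q by (simp add: summand_def)
      moreover have "\<bar>\<Sum>M<Suc M. summand M\<bar> < 2 ^ b" by (rule sum_summand_small) (use M in simp)
      ultimately show "wpt b (''q'' ::= Add (var ''q'') (Mul (var ''p'') (var ''tot''))) 1
        (\<lambda>s'. s' ''q'' 0 = (\<Sum>M<Suc M. summand M)) s3"
        using s3(1) b_pos by (simp add: wpt_simps)
    qed simp
  qed (use s1 in simp_all)
qed simp

lemma wpt_masks:
  assumes s: "bounded b s" "ready s"
  shows "wpt b masks_prog (3 * n + 6 + 2 ^ m * (mask_time n + 2)) (\<lambda>s'. s' ''q'' 0 = total) s"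
proof -
  define s1 where "s1 = store_upd ''two'' 0 1 s"
  have s1: "bounded b s1" unfolding s1_def by (rule bounded_upd) (use s(1) b_pos two_less in simp_all)
  have r1: "ready s1" using s(2) by (simp add: s1_def ready_def env_def holds_list_def store_upd_other)
  let ?D = "''two'' ::= Mul (var ''two'') (Const 2)"
  let ?F1 = "for_loop ''i'' (Sub (var ''len'') (var ''j'')) ?D"
  let ?F2 = "for_loop ''mask'' (var ''two'') mask_body"
  let ?I = "\<lambda>y s'. s' ''two'' 0 = (2::int) ^ y"
  have F1: "wpt b ?F1 (n * 3 + 2) (?I m) s1"
  proof (rule wpt_for_loop[where N = m and K = 1 and I = ?I])
    fix y s' assume y: "y < m" "bounded b s'" "?I y s'" "s' ''i'' 0 = int y"
    have "(2::int) ^ Suc y < 2 ^ b" by (rule two_power_m(2)) (use y in simp)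
    then show "wpt b ?D 1 (?I (Suc y)) s'" using y(2,3) b_pos by (simp add: wpt_simps)
  next
    show "int m < 2 ^ b" using length_l(3) by (intro small) linarith
    show "m * (1 + 2) + 2 \<le> n * 3 + 2" using length_l(3) by simp
    fix s' assume fr: "\<forall>x. x \<notin> insert ''i'' (writes ?D) \<longrightarrow> s' x = s1 x"
    have "ready s'" by (rule ready_frame[OF r1 fr]) simp
    then show "expr_val s' (Sub (var ''len'') (var ''j'')) = int m"
      using length_l(2) by (simp add: ready_def holds_list_def)
  qed (use s1 b_pos in \<open>simp_all add: store_upd_apply s1_def\<close>)
  define T where "T = 5 + 3 * n + 2 ^ m * (mask_time n + 2)"
  have "wpt b (?F1 ;; ''q'' ::= Const 0 ;; ?F2) T
      (\<lambda>s'. s' ''q'' 0 = total) s1"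
  proof (rule wpt_Seq[OF F1, where ?c2.0 = "1 + (2 ^ m * (mask_time n + 2) + 2)"])
    fix s2 assume s2: "bounded b s2" "\<forall>x. x \<notin> writes ?F1 \<longrightarrow> s2 x = s1 x" "s2 ''two'' 0 = 2 ^ m"
    have r2: "ready s2" by (rule ready_frame[OF r1 s2(2)]) simp
    define s3 where "s3 = store_upd ''q'' 0 0 s2"
    have s3: "bounded b s3" unfolding s3_def by (rule bounded_upd) (use s2(1) b_pos in simp_all)
    have r3: "ready s3" using r2 by (simp add: s3_def ready_def env_def holds_list_def store_upd_other)
    let ?J = "\<lambda>x s'. s' ''q'' 0 = (\<Sum>M<x. summand M)"
    have "wpt b ?F2 (2 ^ m * (mask_time n + 2) + 2) (?J (2 ^ m)) s3"
    proof (rule wpt_for_loop[where N = "2 ^ m" and K = "mask_time n" and I = ?J])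
      fix M s' assume M: "M < 2 ^ m" "bounded b s'" "?J M s'" "s' ''mask'' 0 = int M"
        and fr: "\<forall>x. x \<notin> insert ''mask'' (writes mask_body) \<longrightarrow> s' x = s3 x"
      have r: "ready s'"
        by (rule ready_frame[OF r3 fr])
          (simp add: min_defs)
      show "wpt b mask_body (mask_time n) (?J (Suc M)) s'"
        by (rule wpt_mask_body[OF M(1,2) r M(4,3)])
    qed (use s3 s2(3) b_pos two_power_m in \<open>simp_all add: store_upd_apply store_upd_other s3_def min_defs\<close>)
    then have "wpt b ?F2 (2 ^ m * (mask_time n + 2) + 2) (\<lambda>s'. s' ''q'' 0 = total) s3"
      by (simp add: total_def summand_def)
    then show "wpt b (''q'' ::= Const 0 ;; ?F2) (1 + (2 ^ m * (mask_time n + 2) + 2))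
      (\<lambda>s'. s' ''q'' 0 = total) s2"
      using s2(1) b_pos by (simp add: wpt_simps s3_def)
  qed (simp add: T_def)
  moreover have "3 * n + 6 + 2 ^ m * (mask_time n + 2) = Suc T" by (simp add: T_def)
  ultimately show ?thesis
    unfolding masks_prog_def
    using s(1) b_pos two_less by (simp add: wpt_simps s1_def)
qed

definition found_at :: "nat \<Rightarrow> nat set" where
  "found_at e = {x. x < e \<and> total div base ^ x mod base \<noteq> 0 \<and> x mod (2 * n + 1) < k + j}"

text \<open>The value of \<open>res\<close> after \<open>e\<close> digits have been scanned.\<close>

definition best_at :: "nat \<Rightarrow> int" where
  "best_at e = (if found_at e = {} then -1 else int (Min (found_at e) div (2 * n + 1)))"

lemma found_at_Suc: "found_at (Suc e) =
  (if total div base ^ e mod base \<noteq> 0 \<and> e mod (2 * n + 1) < k + j then insert e (found_at e) else found_at e)"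
  by (auto simp: found_at_def less_Suc_eq)

text \<open>Exponents are scanned in increasing order, so a later hit never changes the
  minimum.\<close>

lemma best_at_Suc: "best_at (Suc e) =
  (if best_at e < 0 \<and> total div base ^ e mod base \<noteq> 0 \<and> e mod (2 * n + 1) < k + j
   then int (e div (2 * n + 1)) else best_at e)"
proof -
  have fin: "finite (found_at e)" by (simp add: found_at_def)
  have "Min (insert e (found_at e)) = Min (found_at e)" if "found_at e \<noteq> {}"
  proof -
    have "Min (found_at e) < e" using Min_in[OF fin that] by (simp add: found_at_def)
    then show ?thesis using fin that by simp
  qed
  then show ?thesis by (auto simp: best_at_def found_at_Suc)
qed

lemma best_at_lm: "is_min sol w (k + j) (best_at lm)"
  by (rule is_min_digits[of lm "found_at lm"])
    (simp_all add: found_at_def best_at_def lm_def wsum_max_def mz_def)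

lemma wpt_scan:
  assumes s: "bounded b s" "ready s" "s ''q'' 0 = total"
  shows "wpt b scan_prog (lm * 5 + 3) (\<lambda>s'. is_min sol w (k + j) (s' ''res'' 0)) s"
proof -
  define s1 where "s1 = store_upd ''res'' 0 (- 1) s"
  have s1: "bounded b s1" unfolding s1_def by (rule bounded_upd) (use s(1) b_pos two_less in simp_all)
  have r1: "ready s1" using s(2) by (simp add: s1_def ready_def env_def holds_list_def store_upd_other)
  let ?B = "Cond (And (Less (var ''res'') (Const 0))
           (And (Neg (Equal (Mod (var ''q'') (var ''bs'')) (Const 0)))
             (Less (Mod (var ''i'') (var ''mz'')) (Add (var ''k'') (var ''j'')))))
         (''res'' ::= Div (var ''i'') (var ''mz''))
         Skip ;;
        ''q'' ::= Div (var ''q'') (var ''bs'')"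
  let ?I = "\<lambda>e s'. s' ''q'' 0 = total div base ^ e \<and> s' ''res'' 0 = best_at e"
  have t0: "0 \<le> total" unfolding total_eq using base_ge by (intro sum_nonneg) simp
  have tb: "total < 2 ^ b" using sum_summand_small[of "2 ^ m"] by (simp add: total_def summand_def)
  have "wpt b (for_loop ''i'' (var ''lim'') ?B) (lm * 5 + 2) (?I lm) s1"
  proof (rule wpt_for_loop[where N = lm and K = 3 and I = ?I])
    fix e s' assume e: "e < lm" "bounded b s'" "?I e s'" "s' ''i'' 0 = int e"
      and fr: "\<forall>x. x \<notin> insert ''i'' (writes ?B) \<longrightarrow> s' x = s1 x"
    have r: "ready s'" by (rule ready_frame[OF r1 fr]) simp
    have v: "s' ''bs'' 0 = base" "s' ''mz'' 0 = int (2 * n + 1)" "s' ''k'' 0 = int k" "s' ''j'' 0 = int j"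
      using r by (simp_all add: ready_def env_def)
    have qe: "total div base ^ e div base = total div base ^ Suc e"
      using base_ge by (simp add: div_mult2_eq power_Suc2 zdiv_zmult2_eq del: power_Suc)
    have qb: "\<bar>total div base ^ Suc e\<bar> < 2 ^ b"
      using abs_div_le[of total "base ^ Suc e"] t0 tb by linarith
    have "e div (2 * n + 1) \<le> e" by (rule div_le_dividend)
    then have "int (e div (2 * n + 1)) < 2 ^ b" using e(1) b_lm by linarith
    moreover have ed: "int e div int (2 * n + 1) = int (e div (2 * n + 1))" "int e mod int (2 * n + 1) = int (e mod (2 * n + 1))"
      by (simp_all only: of_nat_div of_nat_mod)
    ultimately have eb: "\<bar>int e div int (2 * n + 1)\<bar> < 2 ^ b" by simp
    let ?c = "best_at e < 0 \<and> total div base ^ e mod base \<noteq> 0 \<and> e mod (2 * n + 1) < k + j"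
    have test: "test_val s' (And (Less (var ''res'') (Const 0))
           (And (Neg (Equal (Mod (var ''q'') (var ''bs'')) (Const 0)))
             (Less (Mod (var ''i'') (var ''mz'')) (Add (var ''k'') (var ''j''))))) \<longleftrightarrow> ?c"
    proof -
      have "int (e mod (2 * n + 1)) < int k + int j \<longleftrightarrow> e mod (2 * n + 1) < k + j" by linarith
      then show ?thesis using e(3,4) v ed(2) by (simp only: test_val.simps expr_val.simps nat_zero_as_int[symmetric] nat_0)
    qed
    show "wpt b ?B 3 (?I (Suc e)) s'"
    proof (cases ?c)
      case True
      then have be: "best_at (Suc e) = int e div int (2 * n + 1)" unfolding best_at_Suc ed(1) by simp
      show ?thesis
        unfolding wpt_Cond_Seq test if_P[OF True]
        using e(2-4) v eb qb b_pos be by (simp add: wpt_simps qe del: power_Suc)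
    next
      case False
      then have be: "best_at (Suc e) = best_at e" unfolding best_at_Suc by simp
      show ?thesis
        unfolding wpt_Cond_Seq test if_not_P[OF False]
        using e(2-4) v qb b_pos be by (simp add: wpt_simps qe del: power_Suc)
    qed
  next
    show "?I 0 s1" using s(3) by (simp add: s1_def store_upd_apply store_upd_other best_at_def found_at_def)
    fix s' assume fr: "\<forall>x. x \<notin> insert ''i'' (writes ?B) \<longrightarrow> s' x = s1 x"
    have "ready s'" by (rule ready_frame[OF r1 fr]) simp
    then show "expr_val s' (var ''lim'') = int lm" by (simp add: ready_def env_def)
  qed (use s1 b_pos b_lm in \<open>simp_all add: store_upd_apply\<close>)
  then have "wpt b (for_loop ''i'' (var ''lim'') ?B) (lm * 5 + 2)
      (\<lambda>s'. is_min sol w (k + j) (s' ''res'' 0)) s1"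
    by (rule wpt_weaken) (use best_at_lm in simp_all)
  then show ?thesis
    unfolding scan_prog_def using s(1) b_pos two_less by (simp add: wpt_simps s1_def)
qed

definition min_time :: nat where
  "min_time = (3 * n + 6 + 2 ^ m * (mask_time n + 2)) + (lm * 5 + 3)"

lemma wpt_min:
  assumes s: "bounded b s" "ready s"
  shows "wpt b min_prog min_time (\<lambda>s'. is_min sol w (k + j) (s' ''res'' 0)) s"
  unfolding min_prog_def min_time_def
proof (rule wpt_Seq[OF wpt_masks[OF s] le_refl])
  fix s1 assume s1: "bounded b s1" "\<forall>x. x \<notin> writes masks_prog \<longrightarrow> s1 x = s x" "s1 ''q'' 0 = total"
  have "ready s1"
    by (rule ready_frame[OF s(2) s1(2)])
      (simp add: min_defs)
  then show "wpt b scan_prog (lm * 5 + 3) (\<lambda>s'. is_min sol w (k + j) (s' ''res'' 0)) s1"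
    by (rule wpt_scan[OF s1(1) _ s1(3)])
qed

end

text \<open>Shrinking the family of solutions cannot lower the minimum, and an optimum that survives
  keeps it from rising.\<close>

lemma is_min_mono:
  assumes "is_min S w k z" "is_min S' w k z'" "\<And>X. S' X \<Longrightarrow> S X"
    "S' X" "card X < k" "z = int (weight w X)"
  shows "z' = z"
  using assms unfolding is_min_def by (smt (verit) of_nat_le_iff)

lemma is_minD:
  assumes "is_min S w k z" "0 \<le> z"
  obtains X where "S X" "card X < k" "z = int (weight w X)"
  using assms unfolding is_min_def by (auto split: if_splits)

lemma is_min_neg: "is_min S w k z \<Longrightarrow> z < 0 \<Longrightarrow> S X \<Longrightarrow> \<not> card X < k"
  unfolding is_min_def by (auto split: if_splits)

lemma is_min_le: "is_min S w k z \<Longrightarrow> S X \<Longrightarrow> card X < k \<Longrightarrow> z \<le> int (weight w X)"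
  unfolding is_min_def by (auto split: if_splits)

lemma conn_Un:
  assumes "sym E" "r \<in> X" "r \<in> Y" "conn E X" "conn E Y"
  shows "conn E (X \<union> Y)"
proof -
  have "r \<in> X \<union> Y" using assms by simp
  moreover have "(r, v) \<in> (Restr E (X \<union> Y))\<^sup>*" if "v \<in> X \<union> Y" for v
    using that assms rtrancl_Restr_mono[of r v E X "X \<union> Y"] rtrancl_Restr_mono[of r v E Y "X \<union> Y"]
    by (auto simp: conn_def)
  ultimately show ?thesis using conn_iff_root[OF assms(1)] by blast
qed

text \<open>A path inside \<open>X\<close> from \<open>r\<close> to a vertex outside
  \<open>Y\<close> would have an edge leaving \<open>Y\<close>.\<close>

lemma conn_sub_closed:
  assumes "conn E X" "r \<in> X" "r \<in> Y" "\<And>u v. u \<in> Y \<Longrightarrow> v \<in> X \<Longrightarrow> (u, v) \<in> E \<Longrightarrow> v \<in> Y"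
  shows "X \<subseteq> Y"
proof (rule ccontr)
  assume "\<not> X \<subseteq> Y"
  then obtain v where "v \<in> X" "v \<notin> Y" by blast
  then have "(r, v) \<in> (Restr E X)\<^sup>*" using assms by (auto simp: conn_def)
  then obtain a c where "(a, c) \<in> Restr E X" "a \<in> Y" "c \<notin> Y"
    using rtrancl_exit[of r v] \<open>v \<notin> Y\<close> assms(3) by metis
  then show False using assms(4) by blast
qed

lemma (in machine) base_greater:
  assumes "m \<le> n"
  shows "int (2 ^ m * (n * (n * n) ^ (n - 1))) < base"
proof -
  \<comment> \<open>Enlarging the factor \<open>n\<close> to \<open>n * n\<close> produces an exact
    \<open>n\<close>-th power, to which \<open>2 ^ n\<close> can be joined; the 1 in
    \<open>base\<close> makes the inequality strict.\<close>
  have "2 ^ m * (n * (n * n) ^ (n - 1)) \<le> 2 ^ n * ((n * n) * (n * n) ^ (n - 1))"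
    using assms n_pos by (intro mult_mono power_increasing) auto
  also have "(n * n) * (n * n) ^ (n - 1) = (n * n) ^ n" using n_pos by (cases n) auto
  also have "2 ^ n * (n * n) ^ n = (2 * (n * n)) ^ n" by (simp add: power_mult_distrib)
  also have "\<dots> < (2 * (n * n) + 1) ^ n" by (rule power_strict_mono) (use n_pos in auto)
  finally have "int (2 ^ m * (n * (n * n) ^ (n - 1))) < int ((2 * (n * n) + 1) ^ n)"
    by (rule of_nat_less_iff[THEN iffD2])
  then show ?thesis by (simp add: base_def add.commute)
qed

section \<open>From minimum weights to covers: deletion, compression, descent\<close>

context big_machine
begin

definition min_bound :: nat where
  "min_bound = (3 * n + 6 + 2 ^ k * (mask_time n + 2)) + (lm * 5 + 3)"

text \<open>Here the factor \<open>2 ^ k\<close> arises: the hypothesis that at most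
  \<open>k\<close> entries of \<open>l\<close> lie outside the prefix bounds the number of
  masks.\<close>

lemma wpt_min_at:
  assumes "tree_order E n l j pa" "covers E (set l)" "length l - j \<le> k" "D \<subseteq> {..<n}"
    and s: "bounded b s" "env s" "holds_list s j l pa" "s ''j'' 0 = int j" "s ''r'' 0 = int (l ! 0)"
      "holds_set n (s ''c'') (set l)" "holds_set n (s ''d'') D"
  shows "wpt b min_prog min_bound
    (\<lambda>s'. is_min (is_sol E (set (take j l)) D) w (k + j) (s' ''res'' 0)) s"
proof -
  interpret T: tree_order E n l j pa by (rule assms(1))
  interpret S: searcher E n k b w peak l j pa D
    by unfold_locales (use assms(2-4) base_greater[of T.m] k_le in \<open>simp_all add: T.C_def T.m_def\<close>)
  have "S.ready s" using s by (simp add: S.ready_def T.r_def T.C_def)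
  moreover have "S.min_time \<le> min_bound"
    unfolding S.min_time_def min_bound_def using assms(3)
    by (intro add_mono mult_le_mono power_increasing) (simp_all add: T.m_def)
  ultimately show ?thesis
    using s(1) by (intro wpt_weaken[OF S.wpt_min]) (simp_all add: T.P_def)
qed

text \<open>
  A vertex stays in \<open>d\<close> only if every optimum within \<open>d\<close> contains it, so \<open>d\<close> shrinks to an optimum.
\<close>

lemma wpt_reduce:
  assumes L: "tree_order E n l j pa" "covers E (set l)" "length l - j \<le> k"
    and s: "bounded b s" "env s" "holds_list s j l pa" "s ''j'' 0 = int j" "s ''r'' 0 = int (l ! 0)"
      "holds_set n (s ''c'') (set l)" "holds_set n (s ''d'') {..<n}"
    and T: "s ''target'' 0 = T" "0 \<le> T" "is_min (is_sol E (set (take j l)) {..<n}) w (k + j) T"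
  shows "wpt b reduce_prog (n * (min_bound + 5) + 2)
    (\<lambda>s'. \<exists>X. holds_set n (s' ''d'') X \<and> is_sol E (set (take j l)) {..<n} X \<and> card X < k + j \<and>
      T = int (weight w X)) s"
proof -
  let ?S = "is_sol E (set (take j l))"
  let ?opt = "\<lambda>D X. ?S D X \<and> card X < k + j \<and> int (weight w X) = T"
  let ?B = "Write ''d'' (var ''z'') (Const 0) ;;
           min_prog ;;
           Cond (Equal (var ''res'') (var ''target'')) Skip (Write ''d'' (var ''z'') (Const 1))"
  \<comment> \<open>Vertices from \<open>x\<close> on have not been examined and are all still
    allowed; an examined vertex that is still allowed lies in every optimum.\<close>
  let ?I = "\<lambda>x s'. \<exists>D. holds_set n (s' ''d'') D \<and> D \<subseteq> {..<n} \<and> {x..<n} \<subseteq> D \<and> is_min (?S D) w (k + j) T \<and>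
    (\<forall>y\<in>D. y < x \<longrightarrow> (\<forall>X. ?opt D X \<longrightarrow> y \<in> X))"
  have "wpt b reduce_prog (n * (min_bound + 5) + 2) (?I n) s"
    unfolding reduce_prog_def
  proof (rule wpt_for_loop[where N = n and K = "min_bound + 3" and I = ?I])
    show "?I 0 s" using s T by (intro exI[of _ "{..<n}"]) auto
    fix x s' assume x: "x < n" "bounded b s'" "?I x s'" "s' ''z'' 0 = int x"
      and fr: "\<forall>y. y \<notin> insert ''z'' (writes ?B) \<longrightarrow> s' y = s y"
    obtain D where D: "holds_set n (s' ''d'') D" "D \<subseteq> {..<n}" "{x..<n} \<subseteq> D" "is_min (?S D) w (k + j) T"
      "\<And>y X. y \<in> D \<Longrightarrow> y < x \<Longrightarrow> ?opt D X \<Longrightarrow> y \<in> X" using x(3) by blast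
    have xb: "x < b" by (rule index) (use x(1) in linarith)
    define s1 where "s1 = store_upd ''d'' x 0 s'"
    have s1: "bounded b s1" unfolding s1_def by (rule bounded_upd) (use x(2) xb in simp_all)
    have e1: "env s1"
    proof -
      have "env s'" by (rule env_frame[OF s(2) fr]) (simp add: min_defs)
      then show ?thesis by (simp add: s1_def env_def store_upd_other)
    qed
    have d1: "holds_set n (s1 ''d'') (D - {x})"
      using D(1) by (simp add: s1_def holds_set_def store_upd_apply)
    have same: "s1 ''len'' = s ''len''" "s1 ''lst'' = s ''lst''" "s1 ''par'' = s ''par''" "s1 ''j'' = s ''j''"
      "s1 ''r'' = s ''r''" "s1 ''c'' = s ''c''" "s1 ''target'' = s ''target''"
      using fr by (simp_all add: s1_def store_upd_other min_defs)
    have M: "wpt b min_prog min_bound (\<lambda>s'. is_min (?S (D - {x})) w (k + j) (s' ''res'' 0)) s1"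
      by (rule wpt_min_at[OF L _ s1 e1])
        (use D(2) s(3-6) same d1 in \<open>simp_all add: holds_list_def, blast\<close>)
    have "wpt b (min_prog ;; Cond (Equal (var ''res'') (var ''target'')) Skip (Write ''d'' (var ''z'') (Const 1)))
      (min_bound + 2) (?I (Suc x)) s1"
    proof (rule wpt_Seq[OF M, where ?c2.0 = 2])
      fix s2 assume s2: "bounded b s2" "\<forall>y. y \<notin> writes min_prog \<longrightarrow> s2 y = s1 y"
        "is_min (?S (D - {x})) w (k + j) (s2 ''res'' 0)"
      have v: "s2 ''target'' 0 = T" "s2 ''d'' = s1 ''d''" "s2 ''z'' 0 = int x"
        using s2(2) same(7) T(1) x(4) by (simp_all add: min_defs s1_def store_upd_other)
      have mono: "?S D X" if "?S (D - {x}) X" for X using that by (auto simp: is_sol_def)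
      show "wpt b (Cond (Equal (var ''res'') (var ''target'')) Skip (Write ''d'' (var ''z'') (Const 1))) 2
          (?I (Suc x)) s2"
      proof (cases "s2 ''res'' 0 = T")
        case True
        have "?I (Suc x) s2"
          using d1 v(2) D s2(3) True mono by (intro exI[of _ "D - {x}"]) auto
        then show ?thesis using True v s2(1) by (simp add: wpt_simps)
      next
        case False
        have "holds_set n (store_upd ''d'' x 1 s2 ''d'') D"
          using d1 v(2) D(3) x(1) by (auto simp: holds_set_def store_upd_apply)
        moreover have "y \<in> X" if "y \<in> D" "y < Suc x" "?opt D X" for y X
        proof (cases "y = x")
          case True
          show ?thesis
          proof (rule ccontr)
            assume "y \<notin> X"
            then have "?S (D - {x}) X" using that(3) True by (auto simp: is_sol_def)
            \<comment> \<open>An optimum without this vertex would survive its deletion, and the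
              recomputed minimum would still be \<open>T\<close>.\<close>
            then have "s2 ''res'' 0 = T"
              using is_min_mono[OF D(4) s2(3) mono, of X] that(3) by auto
            with False show False by simp
          qed
        next
          case False
          then show ?thesis using D(5)[of y X] that by simp
        qed
        ultimately have "?I (Suc x) (store_upd ''d'' x 1 s2)"
          using D(2-4) by (intro exI[of _ D]) auto
        then show ?thesis using False v s2(1) xb two_less by (simp add: wpt_simps)
      qed
    qed simp
    then show "wpt b ?B (min_bound + 3) (?I (Suc x)) s'"
      using x(2,4) xb two_less by (simp add: wpt_simps s1_def)
  next
    show "int n < 2 ^ b" by (rule small) simp
    fix s' assume fr: "\<forall>y. y \<notin> insert ''z'' (writes ?B) \<longrightarrow> s' y = s y"
    show "expr_val s' (var ''n'') = int n" using fr s(2) by (simp add: env_def min_defs)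
  qed (use s(1) b_pos in \<open>simp_all add: min_defs store_upd_other\<close>)
  then show ?thesis
  proof (rule wpt_weaken)
    fix s' assume "?I n s'"
    then obtain D where D: "holds_set n (s' ''d'') D" "D \<subseteq> {..<n}" "is_min (?S D) w (k + j) T"
      "\<forall>y\<in>D. y < n \<longrightarrow> (\<forall>X. ?opt D X \<longrightarrow> y \<in> X)" by blast
    obtain X where X: "?S D X" "card X < k + j" "T = int (weight w X)" using is_minD[OF D(3) T(2)] .
    \<comment> \<open>All remaining vertices belong to every optimum, while every solution is
      contained in \<open>D\<close>: the allowed set has shrunk to the optimum itself.\<close>
    then have "D \<subseteq> X" using D(2,4) by blast
    moreover have "X \<subseteq> D" using X(1) by (simp add: is_sol_def)
    ultimately have "X = D" by blast
    then show "\<exists>X. holds_set n (s' ''d'') X \<and> ?S {..<n} X \<and> card X < k + j \<and> T = int (weight w X)"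
      using X D(1,2) by (auto simp: is_sol_def)
  qed simp
qed

lemma wpt_copy_set:
  assumes s: "bounded b s" "s ''n'' 0 = int n" "holds_set n (s y) X"
    and x: "x \<in> names" "x \<noteq> y" "x \<noteq> ''v''" "x \<noteq> ''n''" "y \<noteq> ''v''"
  shows "wpt b (for_loop ''v'' (var ''n'') (Write x (var ''v'') (Read y (var ''v'')))) (n * 3 + 2)
    (\<lambda>s'. holds_set n (s' x) X) s"
  unfolding holds_set_def
proof (rule wpt_for_loop[where N = n and K = 1 and I = "\<lambda>t s'. \<forall>v<t. s' x v = of_bool (v \<in> X)"])
  fix t s' assume t: "t < n" "bounded b s'" "\<forall>v<t. s' x v = of_bool (v \<in> X)" "s' ''v'' 0 = int t"
    and fr: "\<forall>y'. y' \<notin> insert ''v'' (writes (Write x (var ''v'') (Read y (var ''v'')))) \<longrightarrow> s' y' = s y'"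
  have "s' y t = of_bool (t \<in> X)" using fr x s(3) t(1) by (simp add: holds_set_def)
  moreover have "t < b" by (rule index) (use t(1) in linarith)
  ultimately show "wpt b (Write x (var ''v'') (Read y (var ''v''))) 1 (\<lambda>s'. \<forall>v<Suc t. s' x v = of_bool (v \<in> X)) s'"
    using t x(1) two_less by (simp add: wpt_simps less_Suc_eq)
qed (use s x b_pos small[of n] in \<open>simp_all add: store_upd_other\<close>)

lemma wpt_fill_set:
  assumes s: "bounded b s" "s ''n'' 0 = int n" and x: "x \<in> names" "x \<noteq> ''v''" "x \<noteq> ''n''"
  shows "wpt b (for_loop ''v'' (var ''n'') (Write x (var ''v'') (Const 1))) (n * 3 + 2)
    (\<lambda>s'. holds_set n (s' x) {..<n}) s"
proof -
  have "wpt b (for_loop ''v'' (var ''n'') (Write x (var ''v'') (Const 1))) (n * 3 + 2)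
    (\<lambda>s'. \<forall>v<n. s' x v = 1) s"
  proof (rule wpt_for_loop[where N = n and K = 1 and I = "\<lambda>t s'. \<forall>v<t. s' x v = 1"])
    fix t s' assume t: "t < n" "bounded b s'" "\<forall>v<t. s' x v = 1" "s' ''v'' 0 = int t"
    moreover have "t < b" by (rule index) (use t(1) in linarith)
    ultimately show "wpt b (Write x (var ''v'') (Const 1)) 1 (\<lambda>s'. \<forall>v<Suc t. s' x v = 1) s'"
      using x(1) two_less by (simp add: wpt_simps less_Suc_eq)
  qed (use s x b_pos small[of n] in \<open>simp_all add: store_upd_other\<close>)
  then show ?thesis by (simp add: holds_set_def)
qed

definition compress_time :: nat where
  "compress_time = (10 * (n * n) + 10 * n + 10) + ((n * 3 + 2) + (min_bound + (2 + ((n * (min_bound + 5) + 2) + (n * 3 + 2)))))"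

lemma wpt_compress:
  assumes p: "p \<noteq> []" "distinct p" "set p \<subseteq> {..<n}" "conn E (set p)"
    and X: "set p \<subseteq> X" "X \<subseteq> {..<n}" "conn E X" "covers E X" "card X \<le> k + length p"
    and s: "bounded b s" "env s" "s ''j'' 0 = int (length p)" "s ''r'' 0 = int (p ! 0)"
      "\<And>i. i < length p \<Longrightarrow> s ''ord'' i = int (p ! i)" "holds_set n (s ''c'') X"
  shows "wpt b compress_prog compress_time (\<lambda>s'.
    is_min (is_sol E (set p) {..<n}) w (k + length p) (s' ''target'' 0) \<and>
    (if s' ''target'' 0 < 0 then s' ''ok'' 0 = 0
     else s' ''ok'' 0 = s ''ok'' 0 \<and> (\<exists>Y. holds_set n (s' ''c'') Y \<and> is_sol E (set p) {..<n} Y \<and>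
       card Y < k + length p \<and> s' ''target'' 0 = int (weight w Y)))) s"
  (is "wpt b _ _ ?Q s")
  unfolding compress_prog_def compress_time_def
proof (rule wpt_Seq[OF wpt_grow[OF s(1-3) p(2,3) s(5,6)]])
  fix s1 assume s1: "bounded b s1" "\<forall>x. x \<notin> writes grow_prog \<longrightarrow> s1 x = s x"
    "\<exists>l pa. grown E n p X l pa \<and> holds_list s1 (length p) l pa \<and> holds_set n (s1 ''mark'') (set l) \<and>
      (\<forall>u\<in>set l. \<forall>v\<in>X. (u, v) \<in> E \<longrightarrow> v \<in> set l)"
  then obtain l pa where l: "grown E n p X l pa" "holds_list s1 (length p) l pa"
    "\<forall>u\<in>set l. \<forall>v\<in>X. (u, v) \<in> E \<longrightarrow> v \<in> set l" by blast
  let ?j = "length p"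
  have take: "take ?j l = p" "?j \<le> length l" "distinct l" using l(1) by (simp_all add: grown_def)
  have l0: "l ! 0 = p ! 0" using take(1) p(1) by (metis length_greater_0_conv nth_take)
  \<comment> \<open>Growth stays inside \<open>X\<close>, and as \<open>X\<close> is connected a
    list closed under neighbours in \<open>X\<close> exhausts it. So the list is a spanning tree
    order of the whole cover.\<close>
  have set_l: "set l = X"
  proof
    show "set l \<subseteq> X"
    proof
      fix v assume "v \<in> set l"
      then obtain i where i: "i < length l" "l ! i = v" by (auto simp: in_set_conv_nth)
      show "v \<in> X"
      proof (cases "i < ?j")
        case True
        then have "v = p ! i" using take(1) i by (metis nth_take)
        then show ?thesis using True X(1) nth_mem by blast
      next
        case False
        then show ?thesis using l(1) i by (auto simp: grown_def)
      qed
    qed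
    have "p ! 0 \<in> set p" using p(1) by simp
    then show "X \<subseteq> set l"
      using X(1,3) l(3) take(1) set_take_subset[of ?j l] by (intro conn_sub_closed[of E X "p ! 0"]) auto
  qed
  have L: "tree_order E n l ?j pa"
    by unfold_locales (use E_sub sym_E l(1) p(1,4) take in \<open>auto simp: grown_def\<close>)
  have cov: "covers E (set l)" using X(4) set_l by simp
  have "length l = card X" using take(3) set_l distinct_card by metis
  then have len: "length l - ?j \<le> k" using X(5) by simp
  have e1: "env s1" by (rule env_frame[OF s(2) s1(2)]) (simp add: grow_defs)
  have v1: "s1 ''j'' 0 = int ?j" "s1 ''r'' 0 = int (l ! 0)" "holds_set n (s1 ''c'') (set l)" "s1 ''ok'' = s ''ok''"
    using s1(2) s(3,4,6) set_l l0 by (simp_all add: grow_defs)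
  let ?F = "for_loop ''v'' (var ''n'') (Write ''d'' (var ''v'') (Const 1))"
  let ?K = "Cond (Less (var ''target'') (Const 0))
       (''ok'' ::= Const 0)
       (reduce_prog ;; for_loop ''v'' (var ''n'') (Write ''c'' (var ''v'') (Read ''d'' (var ''v''))))"
  have F: "wpt b ?F (n * 3 + 2) (\<lambda>s'. holds_set n (s' ''d'') {..<n}) s1"
    by (rule wpt_fill_set) (use s1(1) e1 in \<open>simp_all add: env_def\<close>)
  have "wpt b (?F ;; min_prog ;; ''target'' ::= var ''res'' ;; ?K)
    ((n * 3 + 2) + (min_bound + (2 + ((n * (min_bound + 5) + 2) + (n * 3 + 2))))) ?Q s1"
  proof (rule wpt_Seq[OF F le_refl])
    fix s2 assume s2: "bounded b s2" "\<forall>x. x \<notin> writes ?F \<longrightarrow> s2 x = s1 x" "holds_set n (s2 ''d'') {..<n}"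
    have e2: "env s2" by (rule env_frame[OF e1 s2(2)]) simp
    have v2: "holds_list s2 ?j l pa" "s2 ''j'' 0 = int ?j" "s2 ''r'' 0 = int (l ! 0)"
      "holds_set n (s2 ''c'') (set l)" "s2 ''ok'' = s ''ok''"
      using s2(2) l(2) v1 by (simp_all add: holds_list_def)
    show "wpt b (min_prog ;; ''target'' ::= var ''res'' ;; ?K)
      (min_bound + (2 + ((n * (min_bound + 5) + 2) + (n * 3 + 2)))) ?Q s2"
    proof (rule wpt_Seq[OF wpt_min_at[OF L cov len subset_refl s2(1) e2 v2(1-4) s2(3)] le_refl])
      fix s3 assume s3: "bounded b s3" "\<forall>x. x \<notin> writes min_prog \<longrightarrow> s3 x = s2 x"
        "is_min (is_sol E (set (take ?j l)) {..<n}) w (k + ?j) (s3 ''res'' 0)"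
      define T where "T = s3 ''res'' 0"
      define s4 where "s4 = store_upd ''target'' 0 T s3"
      have Tb: "\<bar>T\<bar> < 2 ^ b" unfolding T_def by (rule boundedD[OF s3(1)])
      have s4: "bounded b s4" unfolding s4_def by (rule bounded_upd) (use s3(1) b_pos Tb in simp_all)
      have e4: "env s4"
      proof -
        have "env s3" by (rule env_frame[OF e2 s3(2)]) (simp add: min_defs)
        then show ?thesis by (simp add: s4_def env_def store_upd_other)
      qed
      have v4: "holds_list s4 ?j l pa" "s4 ''j'' 0 = int ?j" "s4 ''r'' 0 = int (l ! 0)"
        "holds_set n (s4 ''c'') (set l)" "holds_set n (s4 ''d'') {..<n}" "s4 ''ok'' = s ''ok''"
        "s4 ''target'' 0 = T"
        using s3(2) v2 s2(3) by (simp_all add: holds_list_def s4_def store_upd_apply store_upd_other min_defs)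
      have min: "is_min (is_sol E (set (take ?j l)) {..<n}) w (k + ?j) T" using s3(3) by (simp add: T_def)
      have "wpt b ?K (1 + ((n * (min_bound + 5) + 2) + (n * 3 + 2))) ?Q s4"
      proof (cases "T < 0")
        case True
        have "?Q (store_upd ''ok'' 0 0 s4)"
          using True min v4(7) take(1) by (simp add: store_upd_apply)
        then show ?thesis using True s4 v4(7) b_pos by (simp add: wpt_simps)
      next
        case False
        have "wpt b (reduce_prog ;; for_loop ''v'' (var ''n'') (Write ''c'' (var ''v'') (Read ''d'' (var ''v''))))
          ((n * (min_bound + 5) + 2) + (n * 3 + 2)) ?Q s4"
        proof (rule wpt_Seq[OF wpt_reduce[OF L cov len s4 e4 v4(1-5,7) _ min] le_refl])
          show "0 \<le> T" using False by simp
          fix s5 assume s5: "bounded b s5" "\<forall>x. x \<notin> writes reduce_prog \<longrightarrow> s5 x = s4 x"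
            "\<exists>Y. holds_set n (s5 ''d'') Y \<and> is_sol E (set (take ?j l)) {..<n} Y \<and> card Y < k + ?j \<and> T = int (weight w Y)"
          then obtain Y where Y: "holds_set n (s5 ''d'') Y" "is_sol E (set p) {..<n} Y" "card Y < k + ?j"
            "T = int (weight w Y)" unfolding take(1) by blast
          have v5: "s5 ''n'' 0 = int n" "s5 ''target'' 0 = T" "s5 ''ok'' 0 = s ''ok'' 0"
            using s5(2) e4 v4(6,7) by (simp_all add: reduce_prog_def min_defs env_def)
          have "wpt b (for_loop ''v'' (var ''n'') (Write ''c'' (var ''v'') (Read ''d'' (var ''v''))))
              (n * 3 + 2) (\<lambda>s'. holds_set n (s' ''c'') Y) s5"
            by (rule wpt_copy_set) (use s5(1) v5(1) Y(1) in simp_all)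
          then show "wpt b (for_loop ''v'' (var ''n'') (Write ''c'' (var ''v'') (Read ''d'' (var ''v''))))
              (n * 3 + 2) ?Q s5"
          proof (rule wpt_weaken)
            fix s6 :: store
            assume "\<forall>x. x \<notin> writes (for_loop ''v'' (var ''n'') (Write ''c'' (var ''v'') (Read ''d'' (var ''v'')))) \<longrightarrow> s6 x = s5 x"
              and "holds_set n (s6 ''c'') Y"
            then have "s6 ''target'' 0 = T" "s6 ''ok'' 0 = s ''ok'' 0" using v5 by simp_all
            then show "?Q s6" using \<open>holds_set n (s6 ''c'') Y\<close> Y(2-4) False min take(1) by auto
          qed simp
        qed
        then show ?thesis using False v4(7) by (simp add: wpt_simps)
      qed
      then show "wpt b (''target'' ::= var ''res'' ;; ?K)
        (2 + ((n * (min_bound + 5) + 2) + (n * 3 + 2))) ?Q s3"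
        using s3(1) Tb b_pos by (simp add: wpt_Write_Seq s4_def T_def)
    qed
  qed
  then show "wpt b (?F ;; min_prog ;; ''target'' ::= var ''res'' ;; ?K)
    ((n * 3 + 2) + (min_bound + (2 + ((n * (min_bound + 5) + 2) + (n * 3 + 2))))) ?Q s1" .
qed (assumption | rule le_refl)+

text \<open>Closed under neighbours and with connected prefixes, the list enumerates exactly the
  component of \<open>r\<close>. Connectivity of every prefix lets each of them serve as contracted
  root later.\<close>

definition root_order :: "nat \<Rightarrow> nat list \<Rightarrow> bool" where
  "root_order r l \<longleftrightarrow> l \<noteq> [] \<and> l ! 0 = r \<and> distinct l \<and> set l \<subseteq> {..<n} \<and>
    (\<forall>i. 0 < i \<and> i \<le> length l \<longrightarrow> conn E (set (take i l))) \<and>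
    (\<forall>u\<in>set l. \<forall>v. (u, v) \<in> E \<longrightarrow> v \<in> set l)"

lemma grown_root_order:
  assumes g: "grown E n [r] {..<n} l pa" and closed: "\<forall>u\<in>set l. \<forall>v\<in>{..<n}. (u, v) \<in> E \<longrightarrow> v \<in> set l"
  shows "root_order r l"
proof -
  have l: "1 \<le> length l" "take 1 l = [r]" "distinct l" "set l \<subseteq> {..<n}"
    "\<And>i. 1 \<le> i \<Longrightarrow> i < length l \<Longrightarrow> pa i \<in> set (take i l) \<and> (pa i, l ! i) \<in> E"
    using g by (auto simp: grown_def)
  have ne: "l \<noteq> []" using l(1) by auto
  then have l0: "l ! 0 = r" using l(2) by (cases l) auto
  have "conn E (set (take (Suc i) l))" if "Suc i \<le> length l" for i
    using that
  proof (induction i)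
    case 0
    then show ?case using l(2) by (simp add: conn_def)
  next
    case (Suc i)
    let ?X = "set (take (Suc i) l)" and ?v = "l ! Suc i"
    have Y: "set (take (Suc (Suc i)) l) = insert ?v ?X" using Suc.prems by (simp add: take_Suc_conv_app_nth insert_commute)
    have r: "r \<in> ?X" using l0 ne by (cases l) auto
    have p: "pa (Suc i) \<in> ?X" "(pa (Suc i), ?v) \<in> E" using l(5)[of "Suc i"] Suc.prems by auto
    have old: "(r, u) \<in> (Restr E (insert ?v ?X))\<^sup>*" if "u \<in> ?X" for u
      using Suc that r rtrancl_Restr_mono[of r u E ?X "insert ?v ?X"] by (auto simp: conn_def)
    have "(r, ?v) \<in> (Restr E (insert ?v ?X))\<^sup>*"
      using old[OF p(1)] p by (auto intro: rtrancl_into_rtrancl)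
    then show ?case unfolding Y using conn_iff_root[OF sym_E, of r "insert ?v ?X"] r old by blast
  qed
  then have "conn E (set (take i l))" if "0 < i" "i \<le> length l" for i
    using that by (cases i) auto
  moreover have "v \<in> set l" if "u \<in> set l" "(u, v) \<in> E" for u v
    using closed that E_sub by blast
  ultimately show ?thesis unfolding root_order_def using ne l0 l(3,4) by blast
qed

lemma wpt_reach:
  assumes s: "bounded b s" "env s" "s ''r'' 0 = int r" and r: "r < n"
  shows "wpt b reach_prog (reach_time n) (\<lambda>s'. \<exists>l. root_order r l \<and> s' ''num'' 0 = int (length l) \<and>
    (\<forall>i<length l. s' ''ord'' i = int (l ! i)) \<and> holds_set n (s' ''c'') (set l) \<and>
    s' ''ok'' 0 = of_bool (covers E (set l))) s"
    (is "wpt b _ _ ?Q s")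
proof -
  have rb: "int r < 2 ^ b" using r by (intro small) linarith
  define s0 where "s0 = store_upd ''j'' 0 1 (store_upd ''ord'' 0 (int r) s)"
  have s0: "bounded b s0" unfolding s0_def
    by (intro bounded_upd) (use s(1) b_pos rb two_less in simp_all)
  have e0: "env s0" using s(2) by (simp add: s0_def env_def store_upd_other)
  let ?F = "for_loop ''v'' (var ''n'') (Write ''c'' (var ''v'') (Const 1))"
  let ?O = "for_loop ''i'' (var ''num'') (Write ''ord'' (var ''i'') (Read ''lst'' (var ''i'')))"
  let ?C = "for_loop ''v'' (var ''n'') (Write ''c'' (var ''v'') (Read ''mark'' (var ''v'')))"
  let ?B = "Cond (And (Equal (Read ''adj'' (var ''i'')) (Const 1))
           (Equal (Read ''c'' (Div (var ''i'') (var ''n''))) (Const 0)))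
         (''ok'' ::= Const 0) Skip"
  let ?L = "for_loop ''i'' (Mul (var ''n'') (var ''n'')) ?B"
  have F: "wpt b ?F (n * 3 + 2) (\<lambda>s'. holds_set n (s' ''c'') {..<n}) s0"
    by (rule wpt_fill_set) (use s0 e0 in \<open>simp_all add: env_def\<close>)
  have "wpt b (?F ;; grow_prog ;; ''num'' ::= var ''len'' ;; ?O ;; ?C ;; ''ok'' ::= Const 1 ;; ?L)
    ((n * 3 + 2) + ((10 * (n * n) + 10 * n + 10) + (1 + ((n * 3 + 2) + ((n * 3 + 2) + (1 + (n * n * 4 + 2)))))))
    ?Q s0"
  proof (rule wpt_Seq[OF F le_refl])
    fix s1 assume s1: "bounded b s1" "\<forall>x. x \<notin> writes ?F \<longrightarrow> s1 x = s0 x" "holds_set n (s1 ''c'') {..<n}"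
    have e1: "env s1" by (rule env_frame[OF e0 s1(2)]) simp
    have j1: "s1 ''j'' 0 = int (length [r])" "s1 ''ord'' i = int ([r] ! i)" if "i < length [r]" for i
      using s1(2) that by (simp_all add: s0_def store_upd_apply store_upd_other)
    have j: "s1 ''j'' 0 = int (length [r])" using s1(2) by (simp add: s0_def store_upd_apply)
    have G: "wpt b grow_prog (10 * (n * n) + 10 * n + 10) (\<lambda>s'. \<exists>l pa. grown E n [r] {..<n} l pa \<and>
        holds_list s' (length [r]) l pa \<and> holds_set n (s' ''mark'') (set l) \<and>
        (\<forall>u\<in>set l. \<forall>v\<in>{..<n}. (u, v) \<in> E \<longrightarrow> v \<in> set l)) s1"
      by (rule wpt_grow[OF s1(1) e1 j]) (use r j1(2) s1(3) in simp_all)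
    show "wpt b (grow_prog ;; ''num'' ::= var ''len'' ;; ?O ;; ?C ;; ''ok'' ::= Const 1 ;; ?L)
      ((10 * (n * n) + 10 * n + 10) + (1 + ((n * 3 + 2) + ((n * 3 + 2) + (1 + (n * n * 4 + 2)))))) ?Q s1"
    proof (rule wpt_Seq[OF G le_refl])
      fix s2 assume s2: "bounded b s2" "\<forall>x. x \<notin> writes grow_prog \<longrightarrow> s2 x = s1 x"
        "\<exists>l pa. grown E n [r] {..<n} l pa \<and>
        holds_list s2 (length [r]) l pa \<and> holds_set n (s2 ''mark'') (set l) \<and>
        (\<forall>u\<in>set l. \<forall>v\<in>{..<n}. (u, v) \<in> E \<longrightarrow> v \<in> set l)"
      then obtain l pa where l: "grown E n [r] {..<n} l pa" "holds_list s2 (length [r]) l pa"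
        "holds_set n (s2 ''mark'') (set l)" "\<forall>u\<in>set l. \<forall>v\<in>{..<n}. (u, v) \<in> E \<longrightarrow> v \<in> set l" by blast
      have ro: "root_order r l" by (rule grown_root_order[OF l(1,4)])
      have dl: "distinct l" "set l \<subseteq> {..<n}" using ro by (simp_all add: root_order_def)
      have ll: "length l \<le> n" by (rule distinct_length[OF dl])
      have lb: "int (length l) < 2 ^ b" using ll by (intro small) linarith
      have lst: "s2 ''len'' 0 = int (length l)" "\<And>i. i < length l \<Longrightarrow> s2 ''lst'' i = int (l ! i)"
        using l(2) by (simp_all add: holds_list_def)
      have e2: "env s2" by (rule env_frame[OF e1 s2(2)]) (simp add: grow_defs)
      define s3 where "s3 = store_upd ''num'' 0 (int (length l)) s2"
      have s3: "bounded b s3" unfolding s3_def by (rule bounded_upd) (use s2(1) b_pos lb in simp_all)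
      have e3: "env s3" using e2 by (simp add: s3_def env_def store_upd_other)
      have O: "wpt b ?O (n * 3 + 2) (\<lambda>s'. \<forall>i<length l. s' ''ord'' i = int (l ! i)) s3"
      proof (rule wpt_for_loop[where N = "length l" and K = 1 and I = "\<lambda>t s'. \<forall>i<t. s' ''ord'' i = int (l ! i)"])
        fix t s' assume t: "t < length l" "bounded b s'" "\<forall>i<t. s' ''ord'' i = int (l ! i)" "s' ''i'' 0 = int t"
          and fr: "\<forall>x. x \<notin> insert ''i'' (writes (Write ''ord'' (var ''i'') (Read ''lst'' (var ''i'')))) \<longrightarrow> s' x = s3 x"
        have "s' ''lst'' t = int (l ! t)" using fr lst(2)[OF t(1)] by (simp add: s3_def store_upd_other)
        moreover have "l ! t < n" using dl(2) nth_mem[OF t(1)] by blast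
        then have "int (l ! t) < 2 ^ b" by (intro small) linarith
        moreover have "t < b" by (rule index) (use t(1) ll in linarith)
        ultimately show "wpt b (Write ''ord'' (var ''i'') (Read ''lst'' (var ''i''))) 1
            (\<lambda>s'. \<forall>i<Suc t. s' ''ord'' i = int (l ! i)) s'"
          using t(2-4) by (simp add: wpt_simps less_Suc_eq)
      qed (use s3 lb b_pos ll in \<open>simp_all add: s3_def store_upd_apply store_upd_other\<close>)
      have "wpt b (?O ;; ?C ;; ''ok'' ::= Const 1 ;; ?L)
        ((n * 3 + 2) + ((n * 3 + 2) + (1 + (n * n * 4 + 2)))) ?Q s3"
      proof (rule wpt_Seq[OF O le_refl])
        fix s4 assume s4: "bounded b s4" "\<forall>x. x \<notin> writes ?O \<longrightarrow> s4 x = s3 x" "\<forall>i<length l. s4 ''ord'' i = int (l ! i)"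
        have e4: "env s4" by (rule env_frame[OF e3 s4(2)]) simp
        have v4: "holds_set n (s4 ''mark'') (set l)" "s4 ''num'' 0 = int (length l)"
          using s4(2) l(3) by (simp_all add: s3_def store_upd_apply store_upd_other)
        have C: "wpt b ?C (n * 3 + 2) (\<lambda>s'. holds_set n (s' ''c'') (set l)) s4"
          by (rule wpt_copy_set) (use s4(1) e4 v4(1) in \<open>simp_all add: env_def\<close>)
        show "wpt b (?C ;; ''ok'' ::= Const 1 ;; ?L) ((n * 3 + 2) + (1 + (n * n * 4 + 2))) ?Q s4"
        proof (rule wpt_Seq[OF C le_refl])
          fix s5 assume s5: "bounded b s5" "\<forall>x. x \<notin> writes ?C \<longrightarrow> s5 x = s4 x" "holds_set n (s5 ''c'') (set l)"
          have e5: "env s5" by (rule env_frame[OF e4 s5(2)]) simp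
          define s6 where "s6 = store_upd ''ok'' 0 1 s5"
          have s6: "bounded b s6" unfolding s6_def by (rule bounded_upd) (use s5(1) b_pos two_less in simp_all)
          have e6: "env s6" using e5 by (simp add: s6_def env_def store_upd_other)
          have v6: "holds_set n (s6 ''c'') (set l)" "s6 ''num'' 0 = int (length l)"
            "\<forall>i<length l. s6 ''ord'' i = int (l ! i)"
            using s5(2,3) v4(2) s4(3) by (simp_all add: s6_def store_upd_other)
          let ?I = "\<lambda>q s'. s' ''ok'' 0 = of_bool (\<forall>x<q. (x div n, x mod n) \<in> E \<longrightarrow> x div n \<in> set l)"
          have "wpt b ?L (n * n * 4 + 2) (?I (n * n)) s6"
          proof (rule wpt_for_loop[where N = "n * n" and K = 2 and I = ?I])
            fix q s' assume q: "q < n * n" "bounded b s'" "?I q s'" "s' ''i'' 0 = int q"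
              and fr: "\<forall>x. x \<notin> insert ''i'' (writes ?B) \<longrightarrow> s' x = s6 x"
            have v: "q mod n < n" "q div n < n" using n_pos q(1) by (auto simp: less_mult_imp_div_less)
            have e': "env s'" by (rule env_frame[OF e6 fr]) simp
            have "q div n * n + q mod n = q" by simp
            then have a: "s' ''adj'' q = of_bool ((q div n, q mod n) \<in> E)"
              using e' v unfolding env_def by metis
            have c: "s' ''c'' (q div n) = of_bool (q div n \<in> set l)" "s' ''n'' 0 = int n"
              using fr v6(1) v(2) e' by (simp_all add: holds_set_def env_def)
            show "wpt b ?B 2 (?I (Suc q)) s'"
              using q(2-4) a c b_pos by (auto simp: wpt_simps less_Suc_eq)
          next
            show "int (n * n) < 2 ^ b" by (rule small) simp
            fix s' assume fr: "\<forall>x. x \<notin> insert ''i'' (writes ?B) \<longrightarrow> s' x = s6 x"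
            show "expr_val s' (Mul (var ''n'') (var ''n'')) = int (n * n)"
              using fr e6 by (simp add: env_def)
          qed (use s6 b_pos in \<open>simp_all add: store_upd_other s6_def store_upd_apply\<close>)
          then have "wpt b ?L (n * n * 4 + 2) ?Q s6"
          proof (rule wpt_weaken)
            fix s7 assume s7: "\<forall>x. x \<notin> writes ?L \<longrightarrow> s7 x = s6 x" "?I (n * n) s7"
            have "(\<forall>x<n * n. (x div n, x mod n) \<in> E \<longrightarrow> x div n \<in> set l) \<longleftrightarrow> covers E (set l)"
            proof
              assume *: "\<forall>x<n * n. (x div n, x mod n) \<in> E \<longrightarrow> x div n \<in> set l"
              have "u \<in> set l" if "(u, v) \<in> E" for u v
              proof -
                have uv: "u < n" "v < n" using that E_sub by auto
                have "u * n + v < (u + 1) * n" using uv by simp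
                also have "\<dots> \<le> n * n" using uv by (intro mult_le_mono1) simp
                finally show ?thesis using *[rule_format, of "u * n + v"] uv that by simp
              qed
              then show "covers E (set l)" unfolding covers_def by blast
            next
              assume *: "covers E (set l)"
              \<comment> \<open>The program tests only the first end of each arc. That is equivalent
                to covering, since a component containing one end of an edge contains the
                other.\<close>
              have "u \<in> set l" if "(u, v) \<in> E" for u v
                using * that ro symD[OF sym_E] unfolding covers_def root_order_def by blast
              then show "\<forall>x<n * n. (x div n, x mod n) \<in> E \<longrightarrow> x div n \<in> set l" by blast
            qed
            then have "s7 ''ok'' 0 = of_bool (covers E (set l))" using s7(2) by simp
            moreover have "holds_set n (s7 ''c'') (set l)" "s7 ''num'' 0 = int (length l)"
              "\<forall>i<length l. s7 ''ord'' i = int (l ! i)" using s7(1) v6 by simp_all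
            ultimately show "?Q s7" using ro by blast
          qed simp
          then show "wpt b (''ok'' ::= Const 1 ;; ?L) (1 + (n * n * 4 + 2)) ?Q s5"
            using s5(1) b_pos two_less by (simp add: wpt_Write_Seq s6_def)
        qed
      qed
      then show "wpt b (''num'' ::= var ''len'' ;; ?O ;; ?C ;; ''ok'' ::= Const 1 ;; ?L)
        (1 + ((n * 3 + 2) + ((n * 3 + 2) + (1 + (n * n * 4 + 2))))) ?Q s2"
        using s2(1) lst(1) lb b_pos by (simp add: wpt_Write_Seq s3_def)
    qed
  qed
  then show ?thesis
    unfolding reach_prog_def reach_time_def
    using s(1,3) rb b_pos two_less by (simp add: wpt_Write_Seq bounded_upd s0_def)
qed

text \<open>Nonemptiness is explicit because \<open>conn\<close> holds vacuously for the empty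
  set.\<close>

definition cvc :: "nat set \<Rightarrow> bool" where
  "cvc X \<longleftrightarrow> X \<noteq> {} \<and> X \<subseteq> {..<n} \<and> conn E X \<and> covers E X \<and> card X \<le> k"

text \<open>Both sets are connected and contain \<open>r\<close>, so their union is connected, and
  sharing \<open>r\<close> makes it smaller than \<open>k + i\<close>. This strict bound is what
  pays for shortening the prefix by one vertex.\<close>

lemma cvc_through_prefix:
  assumes l: "root_order r l" and S: "cvc S" "r \<in> S" and i: "0 < i" "i \<le> length l"
  shows "is_sol E (set (take i l)) {..<n} (S \<union> set (take i l)) \<and> card (S \<union> set (take i l)) < k + i"
proof -
  let ?P = "set (take i l)"
  have r: "r \<in> ?P" using l i by (cases l) (auto simp: root_order_def take_Cons')
  have P: "?P \<subseteq> {..<n}" "conn E ?P" "card ?P = i"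
    using l i set_take_subset[of i l] distinct_card[of "take i l"] by (auto simp: root_order_def)
  have fin: "finite S" using S by (auto simp: cvc_def intro: finite_subset[of _ "{..<n}"])
  have "conn E (S \<union> ?P)" using S P r sym_E by (intro conn_Un[of E r]) (auto simp: cvc_def)
  moreover have "covers E (S \<union> ?P)" using S by (auto simp: cvc_def covers_def)
  moreover have "1 \<le> card (S \<inter> ?P)"
    using fin r S(2) by (simp add: Suc_le_eq card_gt_0_iff) blast
  then have "card (S \<union> ?P) < k + i"
    using card_Un_Int[OF fin, of ?P] S(1) P(3) i by (auto simp: cvc_def)
  ultimately show ?thesis using S P by (auto simp: is_sol_def cvc_def)
qed

lemma wpt_descend:
  assumes l: "root_order r l"
    and s: "bounded b s" "env s" "s ''r'' 0 = int r" "s ''num'' 0 = int (length l)"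
      "\<forall>i<length l. s ''ord'' i = int (l ! i)" "holds_set n (s ''c'') (set l)"
      "s ''ok'' 0 = of_bool (covers E (set l))"
  shows "wpt b descend_prog (n * (compress_time + 4) + 2) (\<lambda>s'.
    s' ''ok'' 0 = 0 \<and> (\<nexists>S. cvc S \<and> r \<in> S) \<or>
    s' ''ok'' 0 = 1 \<and> (\<exists>X. holds_set n (s' ''c'') X \<and> cvc X \<and> r \<in> X \<and> s' ''target'' 0 = int (weight w X) \<and>
      (\<forall>S. cvc S \<and> r \<in> S \<longrightarrow> weight w X \<le> weight w S))) s"
proof -
  let ?N = "length l"
  have dl: "distinct l" "set l \<subseteq> {..<n}" "l \<noteq> []" "l ! 0 = r" using l by (simp_all add: root_order_def)
  have ll: "?N \<le> n" by (rule distinct_length[OF dl(1,2)])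
  have conn: "conn E (set (take i l))" if "0 < i" "i \<le> ?N" for i using l that by (simp add: root_order_def)
  have reach: "S \<subseteq> set l" if "cvc S" "r \<in> S" for S
  proof (rule conn_sub_closed[of E S r])
    show "r \<in> set l" using dl(3,4) by (metis length_greater_0_conv nth_mem)
    show "v \<in> set l" if "u \<in> set l" "v \<in> S" "(u, v) \<in> E" for u v
      using l that by (auto simp: root_order_def)
  qed (use that in \<open>auto simp: cvc_def\<close>)
  let ?B = "Cond (Equal (var ''ok'') (Const 1))
         (''j'' ::= Sub (var ''num'') (var ''t'') ;; compress_prog) Skip"
  let ?P = "\<lambda>i. set (take i l)"
  \<comment> \<open>The invariant is the input condition for the next prefix, together with
    optimality for the previous, longer one. After the last round the next prefix is empty, the size
    bound is \<open>k\<close>, and the optimality refers to the prefix consisting of the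
    root.\<close>
  let ?J = "\<lambda>t s' X. holds_set n (s' ''c'') X \<and> is_sol E (?P (?N - t)) {..<n} X \<and> card X \<le> k + (?N - t) \<and>
    (0 < t \<longrightarrow> s' ''target'' 0 = int (weight w X) \<and>
      is_min (is_sol E (?P (?N - t + 1)) {..<n}) w (k + (?N - t + 1)) (s' ''target'' 0) \<and> ?P (?N - t + 1) \<subseteq> X)"
  let ?I = "\<lambda>t s'. s' ''ok'' 0 = 0 \<and> (\<nexists>S. cvc S \<and> r \<in> S) \<or> s' ''ok'' 0 = 1 \<and> (\<exists>X. ?J t s' X)"
  have "wpt b descend_prog (n * (compress_time + 4) + 2) (?I ?N) s"
    unfolding descend_prog_def
  proof (rule wpt_for_loop[where N = ?N and K = "compress_time + 2" and I = ?I])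
    show "?I 0 s"
    proof (cases "covers E (set l)")
      case True
      have "?J 0 s (set l)"
        using s(6) dl conn[of ?N] True by (simp add: is_sol_def distinct_card)
      then show ?thesis using s(7) True by auto
    next
      case False
      have "\<not> (cvc S \<and> r \<in> S)" for S
      proof
        assume S: "cvc S \<and> r \<in> S"
        then have "S \<subseteq> set l" using reach by blast
        moreover have "covers E S" using S by (simp add: cvc_def)
        ultimately show False using False unfolding covers_def by blast
      qed
      then show ?thesis using s(7) False by auto
    qed
    fix t s' assume t: "t < ?N" "bounded b s'" "?I t s'" "s' ''t'' 0 = int t"
      and fr: "\<forall>x. x \<notin> insert ''t'' (writes ?B) \<longrightarrow> s' x = s x"
    show "wpt b ?B (compress_time + 2) (?I (Suc t)) s'"
    proof (cases "s' ''ok'' 0 = 1")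
      case False
      then have "?I (Suc t) s'" using t(3) by auto
      then show ?thesis using False t(2) by (simp add: wpt_Cond wpt_Skip)
    next
      case True
      then obtain X where X: "?J t s' X" using t(3) by auto
      define i where "i = ?N - t"
      have i: "0 < i" "i \<le> ?N" "?N - Suc t = i - 1" "?N - Suc t + 1 = i" using t(1) by (simp_all add: i_def)
      define s1 where "s1 = store_upd ''j'' 0 (int i) s'"
      have ib: "int i < 2 ^ b" using i ll by (intro small) linarith
      have s1: "bounded b s1" unfolding s1_def by (rule bounded_upd) (use t(2) b_pos ib in simp_all)
      have e1: "env s1"
      proof -
        have "env s'" by (rule env_frame[OF s(2) fr]) (simp add: compress_defs)
        then show ?thesis by (simp add: s1_def env_def store_upd_other)
      qed
      have v1: "s1 ''j'' 0 = int (length (take i l))" "s1 ''r'' 0 = int (take i l ! 0)" "s1 ''ok'' 0 = 1"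
        "holds_set n (s1 ''c'') X"
        using fr s(3) i dl(4) True X
        by (simp_all add: s1_def store_upd_apply store_upd_other compress_defs min_def)
      have o1: "s1 ''ord'' x = int (take i l ! x)" if "x < length (take i l)" for x
        using fr s(5) that by (simp add: s1_def store_upd_other compress_defs)
      have num: "s' ''num'' 0 = int ?N" using fr s(4) by (simp add: compress_defs)
      have li: "length (take i l) = i" using i by simp
      have Xi: "is_sol E (?P i) {..<n} X" "card X \<le> k + i" using X by (simp_all add: i_def)
      have ti: "take i l \<noteq> []" "distinct (take i l)" "?P i \<subseteq> {..<n}"
        using i dl set_take_subset[of i l] by auto
      have xs: "?P i \<subseteq> X" "X \<subseteq> {..<n}" "conn E X" "covers E X" "card X \<le> k + length (take i l)"
        using Xi li by (simp_all add: is_sol_def)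
      have W: "wpt b compress_prog compress_time (\<lambda>s'.
        is_min (is_sol E (?P i) {..<n}) w (k + length (take i l)) (s' ''target'' 0) \<and>
        (if s' ''target'' 0 < 0 then s' ''ok'' 0 = 0
         else s' ''ok'' 0 = s1 ''ok'' 0 \<and> (\<exists>Y. holds_set n (s' ''c'') Y \<and> is_sol E (?P i) {..<n} Y \<and>
           card Y < k + length (take i l) \<and> s' ''target'' 0 = int (weight w Y)))) s1"
        by (rule wpt_compress[OF ti conn[OF i(1,2)] xs s1 e1 v1(1,2) o1 v1(4)])
      have "wpt b compress_prog compress_time (?I (Suc t)) s1"
      proof (rule wpt_weaken[OF W])
        fix s2 assume s2: "is_min (is_sol E (?P i) {..<n}) w (k + length (take i l)) (s2 ''target'' 0) \<and>
        (if s2 ''target'' 0 < 0 then s2 ''ok'' 0 = 0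
         else s2 ''ok'' 0 = s1 ''ok'' 0 \<and> (\<exists>Y. holds_set n (s2 ''c'') Y \<and> is_sol E (?P i) {..<n} Y \<and>
           card Y < k + length (take i l) \<and> s2 ''target'' 0 = int (weight w Y)))"
        show "?I (Suc t) s2"
        proof (cases "s2 ''target'' 0 < 0")
          case True
          have "\<not> (cvc S \<and> r \<in> S)" for S
            using is_min_neg[OF _ True, of _ w "k + i"] s2 cvc_through_prefix[OF l _ _ i(1,2), of S] li by metis
          then show ?thesis using s2 True by auto
        next
          case False
          then obtain Y where Y: "holds_set n (s2 ''c'') Y" "is_sol E (?P i) {..<n} Y"
            "card Y < k + i" "s2 ''target'' 0 = int (weight w Y)" "s2 ''ok'' 0 = 1"
            using s2 v1(3) li by auto
          \<comment> \<open>Dropping the last prefix vertex keeps \<open>Y\<close> a solution, and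
            \<open>card Y < k + i\<close> is the size bound required for the prefix of length
            \<open>i - 1\<close>.\<close>
          have "?P (i - 1) \<subseteq> ?P i" by (intro set_take_subset_set_take) simp
          then have "is_sol E (?P (i - 1)) {..<n} Y" using Y(2) by (auto simp: is_sol_def)
          moreover have "card Y \<le> k + (i - 1)" using Y(3) i(1) by simp
          moreover have "?P i \<subseteq> Y" using Y(2) by (simp add: is_sol_def)
          ultimately have "?J (Suc t) s2 Y" unfolding i(3,4) using Y s2 li i by simp
          then show ?thesis using Y(5) by blast
        qed
      qed simp
      moreover have "int ?N - int t = int i" using t(1) by (simp add: i_def)
      ultimately show ?thesis
        using True t(2,4) num ib b_pos by (simp add: wpt_Cond wpt_Write_Seq s1_def)
    qed
  next
    show "int ?N < 2 ^ b" using ll by (intro small) linarith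
    show "?N * (compress_time + 2 + 2) + 2 \<le> n * (compress_time + 4) + 2"
      by (intro add_right_mono mult_le_mono ll) simp
    fix s' assume fr: "\<forall>x. x \<notin> insert ''t'' (writes ?B) \<longrightarrow> s' x = s x"
    show "expr_val s' (var ''num'') = int ?N" using fr s(4) by (simp add: compress_defs)
  qed (use s(1) b_pos in \<open>simp_all add: compress_defs store_upd_other store_upd_apply\<close>)
  then show ?thesis
  proof (rule wpt_weaken)
    fix s' assume I: "?I ?N s'"
    have N: "0 < ?N" using dl(3) by simp
    have P1: "?P 1 = {r}" using dl(3,4) by (cases l) auto
    show "s' ''ok'' 0 = 0 \<and> (\<nexists>S. cvc S \<and> r \<in> S) \<or>
      s' ''ok'' 0 = 1 \<and> (\<exists>X. holds_set n (s' ''c'') X \<and> cvc X \<and> r \<in> X \<and> s' ''target'' 0 = int (weight w X) \<and>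
      (\<forall>S. cvc S \<and> r \<in> S \<longrightarrow> weight w X \<le> weight w S))"
    proof (cases "s' ''ok'' 0 = 1")
      case True
      then obtain X where "?J ?N s' X" using I by auto
      then have X: "holds_set n (s' ''c'') X" "is_sol E {} {..<n} X" "card X \<le> k"
        "s' ''target'' 0 = int (weight w X)" "is_min (is_sol E {r} {..<n}) w (k + 1) (s' ''target'' 0)" "r \<in> X"
        using N P1 by auto
      have "weight w X \<le> weight w S" if "cvc S" "r \<in> S" for S
      proof -
        have "is_sol E {r} {..<n} S" "card S < k + 1" using that by (auto simp: is_sol_def cvc_def)
        then show ?thesis using is_min_le[OF X(5)] X(4) by fastforce
      qed
      moreover have "cvc X" using X by (auto simp: cvc_def is_sol_def)
      ultimately show ?thesis using True X by blast
    qed (use I in auto)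
  qed simp
qed

definition root_time :: nat where
  "root_time = reach_time n + ((n * (compress_time + 4) + 2) + (3 + (n * 3 + 2)))"

text \<open>Covers meeting the first \<open>x\<close> vertices are those through one of the roots
  treated so far. For \<open>x = n\<close> these are all covers, as a cover is nonempty.\<close>

definition best_upto :: "nat \<Rightarrow> store \<Rightarrow> bool" where
  "best_upto x s \<longleftrightarrow> s ''found'' 0 = 0 \<and> (\<nexists>S. cvc S \<and> S \<inter> {..<x} \<noteq> {}) \<or>
    s ''found'' 0 = 1 \<and> (\<exists>X. holds_set n (s ''sol'') X \<and> cvc X \<and> s ''best'' 0 = int (weight w X) \<and>
      (\<forall>S. cvc S \<and> S \<inter> {..<x} \<noteq> {} \<longrightarrow> weight w X \<le> weight w S))"

lemma wpt_root:
  assumes s: "bounded b s" "env s" "s ''r'' 0 = int r" "best_upto r s" and r: "r < n"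
  shows "wpt b root_prog root_time (best_upto (Suc r)) s"
proof -
  let ?F = "for_loop ''v'' (var ''n'') (Write ''sol'' (var ''v'') (Read ''c'' (var ''v'')))"
  let ?K = "Cond (And (Equal (var ''ok'') (Const 1))
         (Neg (And (Equal (var ''found'') (Const 1)) (Neg (Less (var ''target'') (var ''best''))))))
       (''found'' ::= Const 1 ;; ''best'' ::= var ''target'' ;; ?F) Skip"
  have "wpt b (reach_prog ;; descend_prog ;; ?K) root_time (best_upto (Suc r)) s"
    unfolding root_time_def
  proof (rule wpt_Seq[OF wpt_reach[OF s(1-3) r] le_refl])
    fix s1 assume s1: "bounded b s1" "\<forall>x. x \<notin> writes reach_prog \<longrightarrow> s1 x = s x"
      "\<exists>l. root_order r l \<and> s1 ''num'' 0 = int (length l) \<and>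
      (\<forall>i<length l. s1 ''ord'' i = int (l ! i)) \<and> holds_set n (s1 ''c'') (set l) \<and>
      s1 ''ok'' 0 = of_bool (covers E (set l))"
    then obtain l where l: "root_order r l" "s1 ''num'' 0 = int (length l)"
      "\<forall>i<length l. s1 ''ord'' i = int (l ! i)" "holds_set n (s1 ''c'') (set l)"
      "s1 ''ok'' 0 = of_bool (covers E (set l))" by blast
    have e1: "env s1" by (rule env_frame[OF s(2) s1(2)]) (simp add: reach_prog_def grow_defs)
    have r1: "s1 ''r'' 0 = int r" using s1(2) s(3) by (simp add: reach_prog_def grow_defs)
    show "wpt b (descend_prog ;; ?K) ((n * (compress_time + 4) + 2) + (3 + (n * 3 + 2))) (best_upto (Suc r)) s1"
    proof (rule wpt_Seq[OF wpt_descend[OF l(1) s1(1) e1 r1 l(2-5)] le_refl])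
      fix s2 assume s2: "bounded b s2" "\<forall>x. x \<notin> writes descend_prog \<longrightarrow> s2 x = s1 x"
        "s2 ''ok'' 0 = 0 \<and> (\<nexists>S. cvc S \<and> r \<in> S) \<or>
        s2 ''ok'' 0 = 1 \<and> (\<exists>X. holds_set n (s2 ''c'') X \<and> cvc X \<and> r \<in> X \<and> s2 ''target'' 0 = int (weight w X) \<and>
        (\<forall>S. cvc S \<and> r \<in> S \<longrightarrow> weight w X \<le> weight w S))"
      have keep: "s2 ''found'' = s ''found''" "s2 ''best'' = s ''best''" "s2 ''sol'' = s ''sol''"
        "s2 ''n'' 0 = int n"
        using s1(2) s2(2) e1 by (simp_all add: root_defs env_def)
      have step: "S \<inter> {..<Suc r} \<noteq> {} \<longleftrightarrow> S \<inter> {..<r} \<noteq> {} \<or> r \<in> S" for S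
        by (auto simp: less_Suc_eq)
      let ?c = "s2 ''ok'' 0 = 1 \<and> \<not> (s2 ''found'' 0 = 1 \<and> \<not> s2 ''target'' 0 < s2 ''best'' 0)"
      have b2: "best_upto r s2" using s(4) keep by (simp add: best_upto_def)
      show "wpt b ?K (3 + (n * 3 + 2)) (best_upto (Suc r)) s2"
      proof (cases ?c)
        case False
        have "best_upto (Suc r) s2"
        proof (cases "s2 ''ok'' 0 = 1")
          case True
          then obtain X where X: "s2 ''target'' 0 = int (weight w X)" "\<forall>S. cvc S \<and> r \<in> S \<longrightarrow> weight w X \<le> weight w S"
            using s2(3) by auto
          have f: "s2 ''found'' 0 = 1" "s2 ''best'' 0 \<le> s2 ''target'' 0" using False True by auto
          then obtain Z where Z: "holds_set n (s2 ''sol'') Z" "cvc Z" "s2 ''best'' 0 = int (weight w Z)"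
            "\<forall>S. cvc S \<and> S \<inter> {..<r} \<noteq> {} \<longrightarrow> weight w Z \<le> weight w S"
            using b2 unfolding best_upto_def by auto
          have "weight w Z \<le> weight w X" using f(2) X(1) Z(3) by simp
          then have "\<forall>S. cvc S \<and> S \<inter> {..<Suc r} \<noteq> {} \<longrightarrow> weight w Z \<le> weight w S"
            unfolding step using X(2) Z(4) order_trans by metis
          then show ?thesis unfolding best_upto_def using f(1) Z(1-3) by metis
        next
          case False
          then have "\<nexists>S. cvc S \<and> r \<in> S" using s2(3) by simp
          then have eq: "cvc S \<and> S \<inter> {..<Suc r} \<noteq> {} \<longleftrightarrow> cvc S \<and> S \<inter> {..<r} \<noteq> {}" for S
            unfolding step by blast
          show ?thesis using b2 by (simp only: best_upto_def eq)
        qed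
        then show ?thesis using False s2(1) by (auto simp: wpt_Cond wpt_Skip)
      next
        case True
        then obtain X where X: "holds_set n (s2 ''c'') X" "cvc X" "s2 ''target'' 0 = int (weight w X)"
          "\<forall>S. cvc S \<and> r \<in> S \<longrightarrow> weight w X \<le> weight w S" using s2(3) by auto
        have old: "\<forall>S. cvc S \<and> S \<inter> {..<r} \<noteq> {} \<longrightarrow> weight w X \<le> weight w S"
        proof (cases "s2 ''found'' 0 = 1")
          case f: True
          then obtain Z where Z: "s2 ''best'' 0 = int (weight w Z)"
            "\<forall>S. cvc S \<and> S \<inter> {..<r} \<noteq> {} \<longrightarrow> weight w Z \<le> weight w S"
            using b2 unfolding best_upto_def by auto
          have "weight w X \<le> weight w Z" using True f X(3) Z(1) by simp
          then show ?thesis using Z(2) order_trans by blast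
        next
          case False
          then show ?thesis using b2 unfolding best_upto_def by blast
        qed
        have Tb: "\<bar>s2 ''target'' 0\<bar> < 2 ^ b" by (rule boundedD[OF s2(1)])
        define s3 where "s3 = store_upd ''best'' 0 (s2 ''target'' 0) (store_upd ''found'' 0 1 s2)"
        have s3: "bounded b s3" unfolding s3_def
          by (intro bounded_upd) (use s2(1) b_pos Tb two_less in simp_all)
        have "wpt b ?F (n * 3 + 2) (\<lambda>s'. holds_set n (s' ''sol'') X) s3"
          by (rule wpt_copy_set) (use s3 keep(4) X(1) in \<open>simp_all add: s3_def store_upd_other\<close>)
        then have "wpt b ?F (n * 3 + 2) (best_upto (Suc r)) s3"
        proof (rule wpt_weaken)
          fix s4 assume s4: "\<forall>x. x \<notin> writes ?F \<longrightarrow> s4 x = s3 x" "holds_set n (s4 ''sol'') X"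
          have "s4 ''found'' 0 = 1" "s4 ''best'' 0 = int (weight w X)"
            using s4(1) X(3) by (simp_all add: s3_def store_upd_apply)
          then show "best_upto (Suc r) s4"
            unfolding best_upto_def step using s4(2) X(2,4) old by blast
        qed simp
        then show ?thesis
          using True s2(1) Tb b_pos two_less
          by (simp add: wpt_Cond wpt_Write_Seq bounded_upd s3_def store_upd_apply)
      qed
    qed
  qed
  then show ?thesis by (simp only: root_prog_def)
qed

definition init_time :: nat where
  "init_time = (n * 3 + 3) + (1 + (1 + ((n * 3 + 2) + (1 + (n * (lm * 3 + 5) + 2)))))"

lemma wpt_init:
  assumes s: "bounded b s" "s ''n'' 0 = int n" "s ''k'' 0 = int k"
    "\<And>v. v < n \<Longrightarrow> s ''weight'' v = int (w v)"
    "\<And>u v. u < n \<Longrightarrow> v < n \<Longrightarrow> s ''adj'' (u * n + v) = of_bool ((u, v) \<in> E)"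
  shows "wpt b init_prog init_time env s"
proof -
  let ?A = "''bs'' ::= Const 1 ;; for_loop ''i'' (var ''n'')
       (''bs'' ::= Mul (var ''bs'') (Add (Mul (Const 2) (Mul (var ''n'') (var ''n''))) (Const 1)))"
  let ?W = "for_loop ''i'' (var ''n'') (''ws'' ::= Add (var ''ws'') (Read ''weight'' (var ''i'')))"
  let ?F = "for_loop ''v'' (var ''n'')
       (Write ''pw'' (var ''v'') (Const 1) ;;
        for_loop ''i'' (Add (Mul (Read ''weight'' (var ''v'')) (var ''mz'')) (Const 1))
          (Write ''pw'' (var ''v'') (Mul (Read ''pw'' (var ''v'')) (var ''bs''))))"
  let ?Z = "''mz'' ::= Add (Mul (Const 2) (var ''n'')) (Const 1) ;; ''ws'' ::= Const 0 ;; ?W ;;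
     ''lim'' ::= Add (Mul (var ''ws'') (var ''mz'')) (var ''mz'') ;; ?F"
  have "wpt b (?A ;; ?Z) init_time env s"
    unfolding init_time_def
  proof (rule wpt_Seq[OF wpt_init_bs[OF s(1,2)] le_refl])
    fix s1 assume s1: "bounded b s1" "\<forall>x. x \<notin> writes ?A \<longrightarrow> s1 x = s x" "s1 ''bs'' 0 = base"
    have mb: "int (2 * n + 1) < 2 ^ b" by (rule small) simp
    define s2 where "s2 = store_upd ''mz'' 0 (2 * int n + 1) s1"
    have s2: "bounded b s2" unfolding s2_def by (rule bounded_upd) (use s1(1) b_pos mb in simp_all)
    have v2: "s2 ''n'' 0 = int n" "\<And>v. v < n \<Longrightarrow> s2 ''weight'' v = int (w v)"
      using s1(2) s(2,4) by (simp_all add: s2_def store_upd_other)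
    have "wpt b (?W ;; ''lim'' ::= Add (Mul (var ''ws'') (var ''mz'')) (var ''mz'') ;; ?F)
      ((n * 3 + 2) + (1 + (n * (lm * 3 + 5) + 2))) env (store_upd ''ws'' 0 0 s2)"
    proof (rule wpt_Seq[OF wpt_init_ws[OF s2 v2] le_refl])
      fix s3 assume s3: "bounded b s3" "\<forall>x. x \<notin> writes ?W \<longrightarrow> s3 x = store_upd ''ws'' 0 0 s2 x"
        "s3 ''ws'' 0 = int wsum_max"
      define s4 where "s4 = store_upd ''lim'' 0 (int lm) s3"
      have s4: "bounded b s4" unfolding s4_def by (rule bounded_upd) (use s3(1) b_pos b_lm in simp_all)
      have v3: "s3 ''mz'' 0 = 2 * int n + 1" using s3(2) by (simp add: s2_def store_upd_apply store_upd_other)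
      have v4: "s4 ''n'' 0 = int n" "\<And>v. v < n \<Longrightarrow> s4 ''weight'' v = int (w v)" "s4 ''bs'' 0 = base"
        "s4 ''mz'' 0 = 2 * int n + 1" "s4 ''lim'' 0 = int lm" "s4 ''k'' 0 = int k"
        "\<And>u v. u < n \<Longrightarrow> v < n \<Longrightarrow> s4 ''adj'' (u * n + v) = of_bool ((u, v) \<in> E)"
        using s3(2) s1(2,3) s by (simp_all add: s4_def s2_def store_upd_apply store_upd_other)
      have F: "wpt b ?F (n * (lm * 3 + 5) + 2) env s4"
      proof (rule wpt_weaken[OF wpt_init_pw[OF s4 v4(1-4)] le_refl])
        fix s' assume "\<forall>x. x \<notin> writes ?F \<longrightarrow> s' x = s4 x"
          "\<forall>v<n. s' ''pw'' v = base ^ (w v * (2 * n + 1) + 1)"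
        then show "env s'" using v4 by (simp add: env_def)
      qed
      have "int wsum_max * (2 * int n + 1) + (2 * int n + 1) = int lm" by (simp add: lm_def algebra_simps)
      then show "wpt b (''lim'' ::= Add (Mul (var ''ws'') (var ''mz'')) (var ''mz'') ;; ?F)
          (1 + (n * (lm * 3 + 5) + 2)) env s3"
        using F s3(1,3) v3 b_pos b_lm by (simp add: wpt_Write_Seq s4_def)
    qed
    then show "wpt b ?Z (1 + (1 + ((n * 3 + 2) + (1 + (n * (lm * 3 + 5) + 2))))) env s1"
      using s1(1,2) s(2) mb b_pos s2 by (simp add: wpt_Write_Seq bounded_upd s2_def store_upd_apply)
  qed
  then show ?thesis by (simp add: init_prog_def wpt_Seq_assoc)
qed

lemma wpt_main:
  assumes s: "bounded b s" "s ''n'' 0 = int n" "s ''k'' 0 = int k"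
    "\<And>v. v < n \<Longrightarrow> s ''weight'' v = int (w v)"
    "\<And>u v. u < n \<Longrightarrow> v < n \<Longrightarrow> s ''adj'' (u * n + v) = of_bool ((u, v) \<in> E)" "s ''found'' 0 = 0"
  shows "wpt b main_prog (init_time + (n * (root_time + 2) + 2)) (best_upto n) s"
  unfolding main_prog_def
proof (rule wpt_Seq[OF wpt_init[OF s(1-5)] le_refl])
  fix s1 assume s1: "bounded b s1" "\<forall>x. x \<notin> writes init_prog \<longrightarrow> s1 x = s x" "env s1"
  have f: "s1 ''found'' 0 = 0" using s1(2) s(6) by (simp add: init_prog_def)
  show "wpt b (for_loop ''r'' (var ''n'') root_prog) (n * (root_time + 2) + 2) (best_upto n) s1"
  proof (rule wpt_for_loop[where N = n and K = root_time and I = best_upto])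
    fix r s' assume r: "r < n" "bounded b s'" "best_upto r s'" "s' ''r'' 0 = int r"
      and fr: "\<forall>x. x \<notin> insert ''r'' (writes root_prog) \<longrightarrow> s' x = s1 x"
    have "env s'" by (rule env_frame[OF s1(3) fr]) (simp add: root_prog_def root_defs)
    then show "wpt b root_prog root_time (best_upto (Suc r)) s'"
      by (rule wpt_root[OF r(2) _ r(4,3,1)])
  next
    show "int n < 2 ^ b" by (rule small) simp
    show "best_upto 0 s1" using f by (simp add: best_upto_def)
    fix s' assume fr: "\<forall>x. x \<notin> insert ''r'' (writes root_prog) \<longrightarrow> s' x = s1 x"
    show "expr_val s' (var ''n'') = int n"
      using fr s1(3) by (simp add: root_prog_def root_defs env_def)
  qed (use s1(1) b_pos in \<open>simp_all add: root_prog_def root_defs best_upto_def store_upd_other\<close>)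
qed

end

section \<open>Polynomial bounds\<close>

definition cap_lm :: "(nat \<Rightarrow> nat) \<Rightarrow> nat \<Rightarrow> nat" where
  "cap_lm p n = (n * p n) * (2 * n + 1) + (2 * n + 1)"

text \<open>A bit length rather than a value: \<open>x < 2 ^ x\<close> applied to
  \<open>2 * (n * n) + 1\<close> bounds the base by a power of 2, and the exponent of
  \<open>peak\<close> is multiplied on.\<close>

definition cap_peak :: "(nat \<Rightarrow> nat) \<Rightarrow> nat \<Rightarrow> nat" where
  "cap_peak p n = (2 * (n * n) + 1) * n * ((n * p n) * (2 * n + 1) + 1)"

text \<open>The first summands cover addresses, exponents and weights. The parenthesis lists the bit
  lengths of the factors in \<open>b_big\<close> in the same order.\<close>

definition cap_b :: "(nat \<Rightarrow> nat) \<Rightarrow> nat \<Rightarrow> nat" where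
  "cap_b p n = n * n + 2 * n + 3 + cap_lm p n + p n + 1 +
    (n + cap_peak p n * n + (n + (n * n * n + cap_peak p n * (n + 1))))"

text \<open>The factor 1 stands where \<open>min_bound\<close> has \<open>2 ^ k\<close>, which
  \<open>time_caps\<close> pulls out in front.\<close>

definition cap_min :: "(nat \<Rightarrow> nat) \<Rightarrow> nat \<Rightarrow> nat" where
  "cap_min p n = (3 * n + 6 + 1 * (mask_time n + 2)) + (cap_lm p n * 5 + 3)"

definition cap_compress :: "(nat \<Rightarrow> nat) \<Rightarrow> nat \<Rightarrow> nat" where
  "cap_compress p n = (10 * (n * n) + 10 * n + 10) + ((n * 3 + 2) + (cap_min p n + (2 + ((n * (cap_min p n + 5) + 2) + (n * 3 + 2)))))"

definition cap_root :: "(nat \<Rightarrow> nat) \<Rightarrow> nat \<Rightarrow> nat" where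
  "cap_root p n = reach_time n + ((n * (cap_compress p n + 4) + 2) + (3 + (n * 3 + 2)))"

definition cap_main :: "(nat \<Rightarrow> nat) \<Rightarrow> nat \<Rightarrow> nat" where
  "cap_main p n = ((n * 3 + 3) + (1 + (1 + ((n * 3 + 2) + (1 + (n * (cap_lm p n * 3 + 5) + 2)))))) +
    (n * (cap_root p n + 2) + 2)"

lemma poly_bounded_times: "poly_bounded mask_time" "poly_bounded reach_time"
  unfolding mask_time_def[abs_def] reach_time_def[abs_def]
  by (intro poly_bounded_intros)+

lemma poly_bounded_caps:
  assumes "poly_bounded p"
  shows "poly_bounded (cap_b p)" "poly_bounded (cap_main p)"
  unfolding cap_b_def[abs_def] cap_main_def[abs_def] cap_root_def cap_compress_def cap_min_def
    cap_lm_def cap_peak_def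
  by (intro poly_bounded_intros poly_bounded_times assms)+

text \<open>Pulls a common factor out of a time bound term by term, so that \<open>2 ^ k\<close>
  stays a single factor although it occurs deep inside nested loops.\<close>

lemma scale:
  fixes K :: nat
  shows "x \<le> K * x' \<Longrightarrow> y \<le> K * y' \<Longrightarrow> x + y \<le> K * (x' + y')"
    and "x \<le> K * x' \<Longrightarrow> c * x \<le> K * (c * x')"
  by (simp_all add: add_mult_distrib2 add_mono mult.left_commute)

context machine
begin

lemma wsum_max_le: "\<forall>v<n. w v \<le> c \<Longrightarrow> wsum_max \<le> n * c"
  unfolding wsum_max_def using sum_bounded_above[of "{..<n}" w c] by simp

lemma lm_le: "\<forall>v<n. w v \<le> p n \<Longrightarrow> lm \<le> cap_lm p n"
  unfolding lm_def cap_lm_def by (intro add_right_mono mult_le_mono1 wsum_max_le)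

lemma peak_le:
  assumes "\<forall>v<n. w v \<le> p n"
  shows "base ^ (wsum_max * (2 * n + 1) + 1) \<le> 2 ^ cap_peak p n"
proof -
  let ?x = "2 * (n * n) + 1"
  have "int ?x < int (2 ^ ?x)" using less_exp[of ?x] of_nat_less_iff by blast
  then have x: "2 * (int n * int n) + 1 \<le> 2 ^ ?x" by simp
  have "base ^ (wsum_max * (2 * n + 1) + 1) \<le> base ^ (n * p n * (2 * n + 1) + 1)"
    using wsum_max_le[OF assms] by (intro power_increasing add_right_mono mult_le_mono1) (simp_all add: base_def)
  also have "\<dots> \<le> ((2 ^ ?x) ^ n) ^ (n * p n * (2 * n + 1) + 1)"
    unfolding base_def using x by (intro power_mono) simp_all
  also have "\<dots> = 2 ^ cap_peak p n" by (simp only: cap_peak_def power_mult)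
  finally show ?thesis .
qed

lemma big_machine_caps:
  assumes w: "\<forall>v<n. w v \<le> p n" and k: "k \<le> n" and b: "cap_b p n \<le> b"
  shows "big_machine E n k b w (base ^ (wsum_max * (2 * n + 1) + 1))"
proof unfold_locales
  show "k \<le> n" by (rule k)
  have "lm < b" using lm_le[of p] w b by (simp add: cap_b_def)
  also have "b < 2 ^ b" by (rule less_exp)
  finally have "lm < 2 ^ b" .
  then show "int lm < 2 ^ b" by (metis of_nat_less_numeral_power_cancel_iff)
  let ?p = "base ^ (wsum_max * (2 * n + 1) + 1)" and ?A = "cap_peak p n"
  have p: "?p \<le> 2 ^ ?A" "0 \<le> ?p" using peak_le[of p] w by (simp_all add: base_def)
  have pn: "?p ^ i \<le> 2 ^ (?A * i)" for i unfolding power_mult by (rule power_mono[OF p])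
  have n1: "int n \<le> 2 ^ n" using less_exp[of n] by (metis less_imp_le of_nat_less_numeral_power_cancel_iff)
  have "n * n < 2 ^ (n * n)" by (rule less_exp)
  then have n2: "int (n * n) \<le> 2 ^ (n * n)" by (metis less_imp_le of_nat_less_numeral_power_cancel_iff)
  have n3: "int (n * n) ^ n \<le> 2 ^ (n * n * n)" unfolding power_mult[of 2 "n * n"] by (rule power_mono[OF n2]) simp
  have "2 ^ n * ?p ^ n * (int n * (int (n * n) ^ n * ?p ^ (n + 1))) \<le>
      2 ^ n * 2 ^ (?A * n) * (2 ^ n * (2 ^ (n * n * n) * 2 ^ (?A * (n + 1))))"
    using p(2) by (intro mult_mono pn n1 n3 order_refl) (simp_all del: power_Suc)
  also have "\<dots> = 2 ^ (n + ?A * n + (n + (n * n * n + ?A * (n + 1))))" by (simp only: power_add)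
  also have "\<dots> < 2 ^ b" by (rule power_strict_increasing) (use b in \<open>unfold cap_b_def, linarith, simp\<close>)
  finally show "2 ^ n * ?p ^ n * (int n * (int (n * n) ^ n * ?p ^ (n + 1))) < 2 ^ b" .
qed (rule refl)

end

context big_machine
begin

lemma time_caps:
  assumes "\<forall>v<n. w v \<le> p n"
  shows "init_time + (n * (root_time + 2) + 2) \<le> 2 ^ k * cap_main p n"
proof -
  let ?K = "2 ^ k :: nat"
  have c: "c \<le> ?K * c" for c by simp
  have lm: "lm \<le> ?K * cap_lm p n" using lm_le[of p] assms c[of "cap_lm p n"] le_trans by blast
  have 0: "?K * y \<le> ?K * (1 * y)" for y by simp
  have 1: "min_bound \<le> ?K * cap_min p n"
    unfolding min_bound_def cap_min_def
    by (intro scale(1) c 0 scale(2)[of lm _ _ 5, unfolded mult.commute[of 5]] lm)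
  have 2: "compress_time \<le> ?K * cap_compress p n"
    unfolding compress_time_def cap_compress_def by (intro scale c 1)
  have 3: "root_time \<le> ?K * cap_root p n"
    unfolding root_time_def cap_root_def by (intro scale c 2)
  have 4: "init_time \<le> ?K * ((n * 3 + 3) + (1 + (1 + ((n * 3 + 2) + (1 + (n * (cap_lm p n * 3 + 5) + 2))))))"
    unfolding init_time_def
    by (intro scale c scale(2)[of lm _ _ 3, unfolded mult.commute[of 3]] lm)
  show ?thesis unfolding cap_main_def by (intro scale(1) 4 scale(2) 3 c)
qed

end

section \<open>Graphs\<close>

text \<open>The library passes to the symmetric closure first, which does not change symmetric arcs.
  Its reachability also demands that the path stays in the vertex set, as restriction of the
  relation to \<open>X\<close> does.\<close>

lemma connected_induce_subgraph_iff:
  assumes "sym (parcs G)"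
  shows "connected (induce_subgraph (with_proj G) X) \<longleftrightarrow> X \<noteq> {} \<and> conn (parcs G) X"
proof -
  let ?M = "mk_symmetric (induce_subgraph (with_proj G) X)"
  have M: "pverts ?M = X" "parcs ?M = Restr (parcs G) X"
    using assms by (auto simp: mk_symmetric_def dest: symD)
  have "reachable (with_proj ?M) u v \<longleftrightarrow> (u, v) \<in> (Restr (parcs G) X)\<^sup>*" if "u \<in> X" "v \<in> X" for u v
    using that rtrancl_consistent_rtrancl_on[of u v "Restr (parcs G) X" X]
    by (auto simp: reachable_def M intro: rtrancl_on_rtranclI)
  then show ?thesis
    by (simp add: connected_def strongly_connected_def conn_def M)
qed

text \<open>The input \<open>k\<close> may be arbitrarily large compared with \<open>n\<close>. No
  cover has more than \<open>n\<close> vertices, so clipping changes no answer, and from then on all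
  numbers are bounded in terms of \<open>n\<close>.\<close>

definition clip_prog :: program where
  "clip_prog = Cond (Less (var ''n'') (var ''k'')) (''k'' ::= var ''n'') Skip"

definition cvc_prog :: program where
  "cvc_prog = (clip_prog ;; Cond (Less (Const 0) (var ''n'')) main_prog Skip)"

lemma input_store_bounded:
  assumes "\<forall>v<n. w v \<le> p n" "k \<le> n" "cap_b p n \<le> b"
  shows "bounded b (input_store n G w k)"
proof -
  have b: "n * n < b" "n < b" "n < 2 ^ b" "p n < 2 ^ b"
  proof -
    have "b < 2 ^ b" by (rule less_exp)
    moreover show "n * n < b" "n < b" using assms(3) by (simp_all add: cap_b_def)
    moreover have "p n < b" using assms(3) by (simp add: cap_b_def)
    ultimately show "n < 2 ^ b" "p n < 2 ^ b" by (blast intro: less_trans)+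
  qed
  have "int x < 2 ^ b" if "x < 2 ^ b" for x using that by (metis of_nat_less_numeral_power_cancel_iff)
  moreover have "w v < 2 ^ b" if "v < n" for v using assms(1) b(4) that le_less_trans by blast
  ultimately show ?thesis
    using b assms(2) unfolding bounded_def input_store_def
    by (auto split: if_splits intro: order_less_trans)
qed

lemma store_space_input_store:
  assumes "\<forall>v<n. w v \<le> p n" "cap_b p n \<le> b"
  shows "store_space (input_store n G w k) \<le> card names * b * (b + 1 + (b + 1 + bits (int k)))"
proof (rule store_space_le_card)
  fix x i assume nz: "input_store n G w k x i \<noteq> 0"
  show "x \<in> names \<and> i < b \<and> bits (input_store n G w k x i) \<le> b + 1 + bits (int k)"
  proof (cases "x = ''k''")
    case True
    then have "i = 0" using nz by (auto simp: input_store_def split: if_splits)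
    then show ?thesis using True assms(2) by (auto simp: input_store_def cap_b_def)
  next
    case False
    then have eq: "input_store n G w k x i = input_store n G w 0 x i" by (simp add: input_store_def)
    have bd: "bounded b (input_store n G w 0)" using input_store_bounded[OF assms(1) _ assms(2)] by simp
    have "x \<in> names" "i < b" using bd nz unfolding eq bounded_def by auto
    moreover have "bits (input_store n G w k x i) \<le> b + 1" unfolding eq by (intro bits_le boundedD[OF bd])
    ultimately show ?thesis by simp
  qed
qed

text \<open>Argued directly with \<open>run\<close>, since before the clipping the store need not be
  \<open>bounded\<close>; this is where the length of \<open>k\<close> enters time and
  space.\<close>

lemma run_clip:
  "\<exists>t. run clip_prog (input_store n G w k) t
      (max (store_space (input_store n G w k)) (store_space (input_store n G w (min k n))))
      (input_store n G w (min k n)) \<and> t \<le> 30 + 4 * bits (int n) + 4 * bits (int k)"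
proof -
  let ?s = "input_store n G w k"
  have v: "?s ''n'' 0 = int n" "?s ''k'' 0 = int k" by (simp_all add: input_store_def)
  have b0: "bits 0 = 1" by (simp add: bits_def floorlog_def)
  show ?thesis
  proof (cases "n < k")
    case True
    have upd: "store_upd ''k'' 0 (int n) ?s = input_store n G w (min k n)"
      using True by (auto simp: store_upd_def input_store_def fun_eq_iff)
    have "run (''k'' ::= var ''n'') ?s (expr_cost ?s (Const 0) + expr_cost ?s (var ''n'') + 1)
        (max (store_space ?s) (store_space (input_store n G w (min k n)))) (input_store n G w (min k n))"
      by (rule run_Write) (simp add: v upd)
    then have "run clip_prog ?s (test_cost ?s (Less (var ''n'') (var ''k'')) +
        (expr_cost ?s (Const 0) + expr_cost ?s (var ''n'') + 1) + 1)
        (max (store_space ?s) (store_space (input_store n G w (min k n)))) (input_store n G w (min k n))"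
      unfolding clip_prog_def by (rule run_Cond_True[rotated]) (use True in \<open>simp add: v\<close>)
    then show ?thesis by (intro exI conjI, assumption) (simp add: v b0)
  next
    case False
    then have "run clip_prog ?s (test_cost ?s (Less (var ''n'') (var ''k'')) + 1 + 1) (store_space ?s) ?s"
      unfolding clip_prog_def by (intro run_Cond_False run_Skip) (simp add: v)
    moreover have "min k n = k" using False by simp
    ultimately show ?thesis by (intro exI conjI) (assumption | simp add: v b0)+
  qed
qed

lemma feasible_iff:
  assumes G: "pair_graph G" "pverts G = {..<n}"
  shows "feasible G k X \<longleftrightarrow> X \<noteq> {} \<and> X \<subseteq> {..<n} \<and> conn (parcs G) X \<and> covers (parcs G) X \<and> card X \<le> k"
proof -
  interpret pair_graph G by (rule G(1))
  have "sym (parcs G)" using pair_sym_arcs by (simp add: symmetric_def)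
  then show ?thesis
    unfolding feasible_def connected_vertex_cover_def vertex_cover_def covers_def G(2)
    by (auto simp: connected_induce_subgraph_iff)
qed

lemma cvc_prog_correct:
  assumes G: "pair_graph G" "pverts G = {..<n}" and w: "\<forall>v\<in>pverts G. w v \<le> p n" and b: "cap_b p n \<le> b"
  shows "\<exists>t m s. run cvc_prog (input_store n G w k) t m s \<and>
    t \<le> (30 + 4 * bits (int n) + 4 * bits (int k)) + (2 ^ min k n * cap_main p n + 1) * step_cap b cvc_prog \<and>
    m \<le> card names * b * (b + 1 + (b + 1 + bits (int k))) \<and> correct_output G w k s"
proof -
  interpret pair_graph G by (rule G(1))
  let ?k = "min k n" and ?E = "parcs G"
  let ?s = "input_store n G w ?k" and ?M = "card names * b * (b + 1 + (b + 1 + bits (int k)))"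
  let ?Q = "Cond (Less (Const 0) (var ''n'')) main_prog Skip"
  have w': "\<forall>v<n. w v \<le> p n" using w G(2) by simp
  have symE: "sym ?E" using pair_sym_arcs by (simp add: symmetric_def)
  have E: "?E \<subseteq> {..<n} \<times> {..<n}" using wellformed' G(2) by auto
  have bd: "bounded b ?s" by (rule input_store_bounded[OF w' _ b]) simp
  have "\<exists>t s'. steps b ?Q ?s t s' \<and> t \<le> 2 ^ ?k * cap_main p n + 1 \<and> correct_output G w k s'"
  proof (cases "n = 0")
    case True
    \<comment> \<open>Without vertices no cover is connected, and \<open>''found''\<close> is 0 in
      the input store already.\<close>
    have "steps b ?Q ?s (1 + 1) ?s"
      by (rule steps_Cond_False[OF _ steps_Skip[OF bd]]) (use True in \<open>simp add: input_store_def\<close>)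
    moreover have "1 \<le> cap_main p n" by (simp add: cap_main_def)
    then have "1 + 1 \<le> 2 ^ ?k * cap_main p n + 1" using True by simp
    moreover have "correct_output G w k ?s"
      unfolding correct_output_def using feasible_iff[OF G] True by (simp add: input_store_def)
    ultimately show ?thesis by blast
  next
    case False
    interpret m: machine ?E n ?k b w
      by unfold_locales (use E symE False b in \<open>auto simp: cap_b_def\<close>)
    interpret m: big_machine ?E n ?k b w "m.base ^ (m.wsum_max * (2 * n + 1) + 1)"
      by (rule m.big_machine_caps[where p = p, OF w' _ b]) simp
    have adj: "?s ''adj'' (u * n + v) = of_bool ((u, v) \<in> ?E)" if "u < n" "v < n" for u v
    proof -
      have "u * n + v < (u + 1) * n" using that by simp
      also have "\<dots> \<le> n * n" using that by (intro mult_le_mono1) simp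
      finally show ?thesis using that by (simp add: input_store_def)
    qed
    have "wpt b main_prog (m.init_time + (n * (m.root_time + 2) + 2)) (m.best_upto n) ?s"
      by (rule m.wpt_main[OF bd]) (use adj in \<open>simp_all add: input_store_def\<close>)
    then obtain t s' where t: "steps b main_prog ?s t s'" "t \<le> m.init_time + (n * (m.root_time + 2) + 2)"
      "m.best_upto n s'" unfolding wpt_def wp_def by blast
    have "steps b ?Q ?s (t + 1) s'"
      by (rule steps_Cond_True[OF _ t(1)]) (use False in \<open>simp add: input_store_def\<close>)
    moreover have "t + 1 \<le> 2 ^ ?k * cap_main p n + 1" using t(2) m.time_caps[where p = p, OF w'] by linarith
    moreover have "correct_output G w k s'"
    proof -
      \<comment> \<open>This makes the bounds \<open>k\<close> and \<open>min k n\<close>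
        interchangeable.\<close>
      have card: "card X \<le> n" if "X \<subseteq> {..<n}" for X using card_mono[OF _ that] by simp
      have f: "feasible G k X \<longleftrightarrow> m.cvc X" for X
        unfolding feasible_iff[OF G] m.cvc_def using card by auto
      have hit: "S \<inter> {..<n} \<noteq> {}" if "m.cvc S" for S using that by (auto simp: m.cvc_def)
      show ?thesis
      proof (cases "s' ''found'' 0 = 0")
        case True
        then have "\<nexists>S. m.cvc S \<and> S \<inter> {..<n} \<noteq> {}" using t(3) by (simp add: m.best_upto_def)
        then have "\<nexists>S. m.cvc S" using hit by metis
        then show ?thesis using True by (simp add: correct_output_def f)
      next
        case False
        then have "\<exists>X. holds_set n (s' ''sol'') X \<and> m.cvc X \<and> s' ''best'' 0 = int (weight w X) \<and>
            (\<forall>S. m.cvc S \<and> S \<inter> {..<n} \<noteq> {} \<longrightarrow> weight w X \<le> weight w S)"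
          using t(3) by (simp add: m.best_upto_def)
        then obtain X where X: "holds_set n (s' ''sol'') X" "m.cvc X"
            "\<forall>S. m.cvc S \<and> S \<inter> {..<n} \<noteq> {} \<longrightarrow> weight w X \<le> weight w S" by auto
        have min: "weight w X \<le> weight w S" if "m.cvc S" for S using X(3) hit[OF that] that by simp
        have "{v \<in> pverts G. s' ''sol'' v \<noteq> 0} = X"
          using X(1,2) G(2) by (auto simp: holds_set_def m.cvc_def)
        then show ?thesis using False X(2) min
          unfolding correct_output_def is_arg_min_def f by (simp add: not_less)
      qed
    qed
    ultimately show ?thesis by blast
  qed
  then obtain t s' where t: "steps b ?Q ?s t s'" "t \<le> 2 ^ ?k * cap_main p n + 1" "correct_output G w k s'"
    by blast
  obtain t2 m2 where 2: "run ?Q ?s t2 m2 s'" "t2 \<le> t * step_cap b ?Q" "m2 \<le> space_cap b"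
    using run_steps[OF t(1)] by blast
  obtain t1 where 1: "run clip_prog (input_store n G w k) t1
      (max (store_space (input_store n G w k)) (store_space ?s)) ?s"
    "t1 \<le> 30 + 4 * bits (int n) + 4 * bits (int k)" using run_clip by blast
  have "run cvc_prog (input_store n G w k) (t1 + t2)
      (max (max (store_space (input_store n G w k)) (store_space ?s)) m2) s'"
    unfolding cvc_prog_def by (rule run_Seq[OF 1(1) 2(1)])
  moreover have "t * step_cap b ?Q \<le> (2 ^ ?k * cap_main p n + 1) * step_cap b cvc_prog"
    using t(2) by (intro mult_le_mono) (simp_all add: cvc_prog_def)
  then have "t1 + t2 \<le> (30 + 4 * bits (int n) + 4 * bits (int k)) + (2 ^ ?k * cap_main p n + 1) * step_cap b cvc_prog"
    using 1(2) 2(2) by linarith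
  moreover have "space_cap b \<le> ?M" unfolding space_cap_def by (intro mult_le_mono) simp_all
  then have "max (max (store_space (input_store n G w k)) (store_space ?s)) m2 \<le> ?M"
    using store_space_input_store[OF w' b, of G k] store_space_le[OF bd] 2(3) by simp
  ultimately show ?thesis using t(3) by blast
qed

lemma bits_le_self: "bits (int n) \<le> n + 2"
proof -
  have "n < 2 ^ n" by (rule less_exp)
  then have "int n < 2 ^ n" by (metis of_nat_less_numeral_power_cancel_iff)
  then show ?thesis using bits_le[of "int n" n] by simp
qed

theorem theorem3:
  shows "\<exists>P :: program. \<forall>p :: nat poly. \<exists>q r :: nat poly.
    \<forall>(n :: nat) (G :: nat pair_pre_digraph) (w :: nat \<Rightarrow> nat) (k :: nat).
      pair_graph G \<and> pverts G = {..<n} \<and> (\<forall>v \<in> pverts G. w v \<le> poly p n) \<longrightarrow>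
      (\<exists>t m s. run P (input_store n G w k) t m s \<and>
        t \<le> 2 ^ k * poly q n \<and>
        m \<le> poly r (n + bits (int k)) \<and>
        correct_output G w k s)"
proof (rule exI[of _ cvc_prog], rule allI)
  fix p :: "nat poly"
  have caps: "poly_bounded (cap_b (poly p))" "poly_bounded (cap_main (poly p))"
    by (rule poly_bounded_caps[OF poly_bounded_poly])+
  obtain B where B: "\<And>n. cap_b (poly p) n \<le> poly B n" using caps(1) by (auto simp: poly_bounded_def)
  have "poly_bounded (\<lambda>n. (30 + 4 * (n + 2) + 4 * 2) + 4 + (cap_main (poly p) n + 1) * step_cap (poly B n) cvc_prog)"
    by (intro poly_bounded_intros caps(2) poly_bounded_compose[OF poly_bounded_step_cap])
  then obtain q where q: "\<And>n. (30 + 4 * (n + 2) + 4 * 2) + 4 +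
      (cap_main (poly p) n + 1) * step_cap (poly B n) cvc_prog \<le> poly q n"
    by (auto simp: poly_bounded_def)
  have "poly_bounded (\<lambda>n. card names * poly B n * (poly B n + 1 + (poly B n + 1 + n)))"
    by (intro poly_bounded_intros)
  then obtain r where r: "\<And>n. card names * poly B n * (poly B n + 1 + (poly B n + 1 + n)) \<le> poly r n"
    by (auto simp: poly_bounded_def)
  show "\<exists>q r :: nat poly. \<forall>(n :: nat) (G :: nat pair_pre_digraph) (w :: nat \<Rightarrow> nat) (k :: nat).
      pair_graph G \<and> pverts G = {..<n} \<and> (\<forall>v \<in> pverts G. w v \<le> poly p n) \<longrightarrow>
      (\<exists>t m s. run cvc_prog (input_store n G w k) t m s \<and>
        t \<le> 2 ^ k * poly q n \<and>
        m \<le> poly r (n + bits (int k)) \<and>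
        correct_output G w k s)"
  proof (rule exI[of _ q], rule exI[of _ r], intro allI impI)
    fix n :: nat and G :: "nat pair_pre_digraph" and w :: "nat \<Rightarrow> nat" and k :: nat
    assume "pair_graph G \<and> pverts G = {..<n} \<and> (\<forall>v \<in> pverts G. w v \<le> poly p n)"
    then obtain t m s where run: "run cvc_prog (input_store n G w k) t m s" "correct_output G w k s"
      and t: "t \<le> (30 + 4 * bits (int n) + 4 * bits (int k)) +
        (2 ^ min k n * cap_main (poly p) n + 1) * step_cap (poly B n) cvc_prog"
      and m: "m \<le> card names * poly B n * (poly B n + 1 + (poly B n + 1 + bits (int k)))"
      using cvc_prog_correct[of G n w "poly p" "poly B n" k] B by blast
    let ?K = "2 ^ k :: nat" and ?S = "step_cap (poly B n) cvc_prog"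
    have "bits (int k) \<le> k + 2" by (rule bits_le_self)
    moreover have "k < ?K" by (rule less_exp)
    \<comment> \<open>The time for handling the unclipped \<open>k\<close> grows with its length,
      which is absorbed into the factor \<open>2 ^ k\<close>; the space bound has no such factor and
      mentions \<open>bits (int k)\<close> instead.\<close>
    ultimately have bk: "bits (int k) \<le> ?K * 1 + ?K * 2" by linarith
    have c: "c \<le> ?K * c" for c by simp
    have "2 ^ min k n \<le> ?K" by (rule power_increasing) auto
    then have "2 ^ min k n * cap_main (poly p) n \<le> ?K * cap_main (poly p) n" by (rule mult_le_mono1)
    then have "2 ^ min k n * cap_main (poly p) n + 1 \<le> ?K * (cap_main (poly p) n + 1)"
      using c[of 1] by (simp only: add_mult_distrib2)
    then have "(2 ^ min k n * cap_main (poly p) n + 1) * ?S \<le> ?K * ((cap_main (poly p) n + 1) * ?S)"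
      using mult_le_mono1 by (metis mult.assoc)
    moreover have "30 + 4 * bits (int n) + 4 * bits (int k) \<le> ?K * ((30 + 4 * (n + 2) + 4 * 2) + 4)"
    proof -
      have "30 + 4 * bits (int n) \<le> 30 + 4 * (n + 2)" using bits_le_self[of n] by simp
      also have "\<dots> \<le> ?K * (30 + 4 * (n + 2))" by (rule c)
      finally have "30 + 4 * bits (int n) + 4 * bits (int k) \<le> ?K * (30 + 4 * (n + 2)) + ?K * (4 * 2 + 4)"
        using bk by (intro add_mono) simp_all
      then show ?thesis by (simp only: add_mult_distrib2 add.assoc)
    qed
    ultimately have "t \<le> ?K * ((30 + 4 * (n + 2) + 4 * 2) + 4 + (cap_main (poly p) n + 1) * ?S)"
      using t unfolding add_mult_distrib2[of ?K "30 + 4 * (n + 2) + 4 * 2 + 4"] by (meson add_mono order_trans)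
    also have "\<dots> \<le> ?K * poly q n" by (rule mult_le_mono2[OF q])
    finally have "t \<le> 2 ^ k * poly q n" .
    moreover have "m \<le> poly r (n + bits (int k))"
    proof -
      let ?x = "n + bits (int k)"
      have "poly B n \<le> poly B ?x" by (rule poly_mono_nat) simp
      then have "card names * poly B n * (poly B n + 1 + (poly B n + 1 + bits (int k))) \<le>
          card names * poly B ?x * (poly B ?x + 1 + (poly B ?x + 1 + ?x))"
        by (intro mult_le_mono add_mono) simp_all
      then show ?thesis using m r[of ?x] by linarith
    qed
    ultimately show "\<exists>t m s. run cvc_prog (input_store n G w k) t m s \<and> t \<le> 2 ^ k * poly q n \<and>
        m \<le> poly r (n + bits (int k)) \<and> correct_output G w k s"
      using run by blast
  qed
qed

end
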